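(* Let $\lambda,\mu\in\mathbb{C}$. Let $\mathscr{G}_{\mu,\lambda}:\mathcal{N}_{\mu,\lambda+1}\to\mathcal{N}_{\mu,\lambda}$ and $\mathscr{T}_{\mu,\lambda}:\mathcal{N}_{\mu,\lambda}\to\mathcal{N}_{\mu,\lambda+1}$ be the left $D_N$-linear maps given respectively by right multiplication by $U_1+\mu\sigma_1$ and by $U_{-1}$. Then $$\mathscr{T}_{\mu,\lambda}\circ\mathscr{G}_{\mu,\lambda}=(\lambda+k\mu)(\lambda+1)\ \text{ on }\mathcal{N}_{\mu,\lambda+1},\qquad \mathscr{G}_{\mu,\lambda}\circ\mathscr{T}_{\mu,\lambda}=(\lambda+k\mu)(\lambda+1)\ \text{ on }\mathcal{N}_{\mu,\lambda}$$ (multiplication by the scalar). Consequently, for $\lambda\neq -1$ and $\lambda\neq -k\mu$, $\mathscr{T}_{\mu,\lambda}$ is an isomorphism from $\mathcal{N}_{\mu,\lambda}$ to $\mathcal{N}_{\mu,\lambda+1}$ and $\mathscr{G}_{\mu,\lambda}$ is an isomorphism from $\mathcal{N}_{\mu,\lambda+1}$ to $\mathcal{N}_{\mu,\lambda}$.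
   Context: Let $k\ge 2$ be an integer and $N=\mathbb{C}^k$ with coordinates $\sigma_1,\dots,\sigma_k$, $\partial_h=\partial/\partial\sigma_h$; $D_N$ is the sheaf of holomorphic differential operators on $N$. Intervals $[p,q]$ are intervals of integers; $\sigma_0:=1$, $\sigma_{k+1}:=0$. Put $$E=\sum_{h=1}^k\sigma_h\partial_h,\quad U_{-1}=\sum_{h=0}^{k-1}(k-h)\sigma_h\partial_{h+1},\quad U_0=\sum_{h=1}^k h\sigma_h\partial_h,\quad U_1=\sum_{h=1}^k(\sigma_1\sigma_h-(h+1)\sigma_{h+1})\partial_h .$$ For $\mu\in\mathbb{C}$, $\mathcal{I}_\mu$ is the left ideal of $D_N$ generated by the operators $A_{p,q}=\partial_p\partial_q-\partial_{p+1}\partial_{q-1}$ ($p\in[1,k-1]$, $q\in[2,k]$) and $\mathcal{T}^m_\mu=\partial_1\partial_{m-1}+\partial_m(E+\mu)$ ($m\in[2,k]$). For $\lambda\in\mathbb{C}$, $\mathcal{N}_{\mu,\lambda}:=D_N/(\mathcal{I}_\mu+D_N(U_0-\lambda))$. Right multiplication by $X$ means the map sending the class of $\Pi$ to the class of $\Pi X$; the two maps in the statement are well defined. *)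

theory Defs
  imports "HOL-Analysis.Analysis" "HOL-Library.Function_Algebras"
begin

definition hol_on :: "(complex^'n \<Rightarrow> complex) \<Rightarrow> (complex^'n) set \<Rightarrow> bool" where
  "hol_on f W \<longleftrightarrow>
     (\<forall>x\<in>W. \<exists>f'. (f has_derivative f') (at x) \<and> (\<forall>a v. f' (a *s v) = a * f' v))"

definition hol_at :: "(complex^'n \<Rightarrow> complex) \<Rightarrow> complex^'n \<Rightarrow> bool" where
  "hol_at f x \<longleftrightarrow> (\<exists>W. open W \<and> x \<in> W \<and> hol_on f W)"

text \<open>Operators are total functions; only their effect on functions holomorphic near a point
  matters, and \<open>op_eq V\<close> is equality as operators on the sheaf of holomorphic functions
  over \<open>V\<close>. Sums and differences of operators are the pointwise ones, products are
  compositions.\<close>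

type_synonym 'n oper = "(complex^'n \<Rightarrow> complex) \<Rightarrow> complex^'n \<Rightarrow> complex"

definition op_eq :: "(complex^'n) set \<Rightarrow> 'n oper \<Rightarrow> 'n oper \<Rightarrow> bool" where
  "op_eq V P Q \<longleftrightarrow> (\<forall>x\<in>V. \<forall>f. hol_at f x \<longrightarrow> P f x = Q f x)"

definition mult_op :: "(complex^'n \<Rightarrow> complex) \<Rightarrow> 'n oper" where
  "mult_op g = (\<lambda>f x. g x * f x)"

definition scalar_op :: "complex \<Rightarrow> ('n::finite) oper" where
  "scalar_op a = mult_op (\<lambda>x. a)"

definition pd :: "'n::finite \<Rightarrow> 'n oper" where
  "pd i = (\<lambda>f x. deriv (\<lambda>z. f (x + axis i z)) 0)"

inductive_set diffop_alg :: "(complex^'n) set \<Rightarrow> 'n oper set" for V where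
  mult: "hol_on g V \<Longrightarrow> mult_op g \<in> diffop_alg V"
| partial: "pd i \<in> diffop_alg V"
| sum: "P \<in> diffop_alg V \<Longrightarrow> Q \<in> diffop_alg V \<Longrightarrow> P + Q \<in> diffop_alg V"
| comp: "P \<in> diffop_alg V \<Longrightarrow> Q \<in> diffop_alg V \<Longrightarrow> P \<circ> Q \<in> diffop_alg V"

text \<open>Sections over \<open>U\<close> of the sheaf of holomorphic differential operators, i.e. of the sheaf
  of algebras of operators on holomorphic functions generated by multiplications by holomorphic
  functions and partial derivatives. As for \<open>holomorphic_on\<close>, two operators
  represent the same section over \<open>U\<close> iff they are related by \<open>op_eq U\<close>.\<close>

definition DN :: "(complex^'n) set \<Rightarrow> 'n oper set" where
  "DN U = {P. \<forall>x\<in>U. \<exists>V. open V \<and> x \<in> V \<and> (\<exists>Q\<in>diffop_alg V. op_eq V P Q)}"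

type_synonym 'n ideal_sheaf = "(complex^'n) set \<Rightarrow> 'n oper set"

definition left_ideal :: "('n::finite) oper set \<Rightarrow> 'n ideal_sheaf" where
  "left_ideal G U = {P \<in> DN U. \<forall>x\<in>U. \<exists>V. open V \<and> x \<in> V \<and> V \<subseteq> U \<and>
     (\<exists>F R. finite F \<and> F \<subseteq> G \<and> (\<forall>A\<in>F. R A \<in> DN V) \<and> op_eq V P (\<Sum>A\<in>F. R A \<circ> A))}"

definition ideal_sum :: "('n::finite) ideal_sheaf \<Rightarrow> 'n ideal_sheaf \<Rightarrow> 'n ideal_sheaf" where
  "ideal_sum I J U = {P \<in> DN U. \<forall>x\<in>U. \<exists>V. open V \<and> x \<in> V \<and> V \<subseteq> U \<and>
     (\<exists>A\<in>I V. \<exists>B\<in>J V. op_eq V P (A + B))}"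

text \<open>The class of the germ of \<open>P\<close> at \<open>x\<close> in the stalk at \<open>x\<close> of the quotient by \<open>J\<close>.\<close>

definition germ_class :: "'n ideal_sheaf \<Rightarrow> complex^'n \<Rightarrow> 'n oper \<Rightarrow> 'n oper set" where
  "germ_class J x P =
     {Q. \<exists>V. open V \<and> x \<in> V \<and> P \<in> DN V \<and> Q \<in> DN V \<and> P - Q \<in> J V}"

text \<open>Data of a sheaf of left modules over \<open>DN\<close>; \<open>restr V\<close> restricts a section over any
  larger open set to \<open>V\<close>.\<close>

record ('n, 's) dmodule =
  sections :: "(complex^'n) set \<Rightarrow> 's set"
  restr :: "(complex^'n) set \<Rightarrow> 's \<Rightarrow> 's"
  plus_sec :: "'s \<Rightarrow> 's \<Rightarrow> 's"
  act :: "'n oper \<Rightarrow> 's \<Rightarrow> 's"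

type_synonym 'n qsection = "complex^'n \<Rightarrow> 'n oper set"

definition section_class ::
    "'n ideal_sheaf \<Rightarrow> (complex^'n) set \<Rightarrow> 'n oper \<Rightarrow> 'n qsection" where
  "section_class J U P = (\<lambda>x. if x \<in> U then germ_class J x P else {})"

text \<open>The quotient sheaf, i.e. the sheafification of the presheaf of quotients: a section
  over \<open>U\<close> assigns to each point of \<open>U\<close> an element of the stalk there, locally
  the class of one operator; it takes the dummy value \<open>{}\<close> outside \<open>U\<close>.\<close>

definition quotient_sheaf :: "('n::finite) ideal_sheaf \<Rightarrow> ('n, 'n qsection) dmodule" where
  "quotient_sheaf J =
    \<lparr> sections = (\<lambda>U. {s. (\<forall>x. x \<notin> U \<longrightarrow> s x = {}) \<and>
        (\<forall>x\<in>U. \<exists>V P. open V \<and> x \<in> V \<and> V \<subseteq> U \<and> P \<in> DN V \<and>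
                     (\<forall>y\<in>V. s y = germ_class J y P))}),
      restr = (\<lambda>V s x. if x \<in> V then s x else {}),
      plus_sec = (\<lambda>s t x. \<Union>P\<in>s x. \<Union>Q\<in>t x. germ_class J x (P + Q)),
      act = (\<lambda>R s x. \<Union>P\<in>s x. germ_class J x (R \<circ> P)) \<rparr>"

type_synonym ('n, 's, 't) sheaf_map = "(complex^'n) set \<Rightarrow> 's \<Rightarrow> 't"

definition dmodule_hom ::
    "('n::finite, 's) dmodule \<Rightarrow> ('n, 't) dmodule \<Rightarrow> ('n, 's, 't) sheaf_map \<Rightarrow> bool" where
  "dmodule_hom M M' \<phi> \<longleftrightarrow> (\<forall>U. open U \<longrightarrow>
     (\<forall>s\<in>sections M U. \<phi> U s \<in> sections M' U \<and>
        (\<forall>V. open V \<and> V \<subseteq> U \<longrightarrow> \<phi> V (restr M V s) = restr M' V (\<phi> U s)) \<and>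
        (\<forall>t\<in>sections M U. \<phi> U (plus_sec M s t) = plus_sec M' (\<phi> U s) (\<phi> U t)) \<and>
        (\<forall>R\<in>DN U. \<phi> U (act M R s) = act M' R (\<phi> U s))))"

definition dmodule_iso ::
    "('n::finite, 's) dmodule \<Rightarrow> ('n, 't) dmodule \<Rightarrow> ('n, 's, 't) sheaf_map \<Rightarrow> bool" where
  "dmodule_iso M M' \<phi> \<longleftrightarrow> dmodule_hom M M' \<phi> \<and>
     (\<exists>\<psi>. dmodule_hom M' M \<psi> \<and> (\<forall>U. open U \<longrightarrow>
        (\<forall>s\<in>sections M U. \<psi> U (\<phi> U s) = s) \<and>
        (\<forall>t\<in>sections M' U. \<phi> U (\<psi> U t) = t)))"

text \<open>Right multiplication by \<open>X\<close>, with values in the quotient by \<open>J'\<close>. The union over the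
  representatives of a class is a single class exactly when the map is well defined.\<close>

definition right_mult ::
    "('n::finite) ideal_sheaf \<Rightarrow> 'n oper \<Rightarrow> ('n, 'n qsection, 'n qsection) sheaf_map" where
  "right_mult J' X U s = (\<lambda>x. \<Union>P\<in>s x. germ_class J' x (P \<circ> X))"

text \<open>The coordinates are numbered from 1 to \<open>k\<close> by an enumeration \<open>c\<close> of the index type,
  that is, a bijection from \<open>{1..k}\<close> onto it.\<close>

definition sig :: "nat \<Rightarrow> (nat \<Rightarrow> 'n) \<Rightarrow> nat \<Rightarrow> complex^'n \<Rightarrow> complex" where
  "sig k c h = (\<lambda>x. if h = 0 then 1 else if h \<le> k then x $ c h else 0)"

definition E_op :: "nat \<Rightarrow> (nat \<Rightarrow> 'n::finite) \<Rightarrow> 'n oper" where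
  "E_op k c = (\<Sum>h=1..k. mult_op (sig k c h) \<circ> pd (c h))"

definition Um1_op :: "nat \<Rightarrow> (nat \<Rightarrow> 'n::finite) \<Rightarrow> 'n oper" where
  "Um1_op k c = (\<Sum>h=0..k-1. mult_op (\<lambda>x. of_nat (k - h) * sig k c h x) \<circ> pd (c (h + 1)))"

definition U0_op :: "nat \<Rightarrow> (nat \<Rightarrow> 'n::finite) \<Rightarrow> 'n oper" where
  "U0_op k c = (\<Sum>h=1..k. mult_op (\<lambda>x. of_nat h * sig k c h x) \<circ> pd (c h))"

definition U1_op :: "nat \<Rightarrow> (nat \<Rightarrow> 'n::finite) \<Rightarrow> 'n oper" where
  "U1_op k c = (\<Sum>h=1..k.
     mult_op (\<lambda>x. sig k c 1 x * sig k c h x - of_nat (h + 1) * sig k c (h + 1) x) \<circ> pd (c h))"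

definition A_op :: "(nat \<Rightarrow> 'n::finite) \<Rightarrow> nat \<Rightarrow> nat \<Rightarrow> 'n oper" where
  "A_op c p q = (pd (c p) \<circ> pd (c q)) - (pd (c (p + 1)) \<circ> pd (c (q - 1)))"

definition T_op :: "nat \<Rightarrow> (nat \<Rightarrow> 'n::finite) \<Rightarrow> complex \<Rightarrow> nat \<Rightarrow> 'n oper" where
  "T_op k c \<mu> m =
     (pd (c 1) \<circ> pd (c (m - 1))) + (pd (c m) \<circ> (E_op k c + scalar_op \<mu>))"

definition I_ideal :: "nat \<Rightarrow> (nat \<Rightarrow> 'n::finite) \<Rightarrow> complex \<Rightarrow> 'n ideal_sheaf" where
  "I_ideal k c \<mu> = left_ideal
     ({A_op c p q | p q. p \<in> {1..k-1} \<and> q \<in> {2..k}} \<union> {T_op k c \<mu> m | m. m \<in> {2..k}})"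

definition J_ideal :: "nat \<Rightarrow> (nat \<Rightarrow> 'n::finite) \<Rightarrow> complex \<Rightarrow> complex \<Rightarrow> 'n ideal_sheaf" where
  "J_ideal k c \<mu> l = ideal_sum (I_ideal k c \<mu>) (left_ideal {U0_op k c - scalar_op l})"

definition N_mod :: "nat \<Rightarrow> (nat \<Rightarrow> 'n::finite) \<Rightarrow> complex \<Rightarrow> complex \<Rightarrow> ('n, 'n qsection) dmodule" where
  "N_mod k c \<mu> l = quotient_sheaf (J_ideal k c \<mu> l)"

definition G_map ::
    "nat \<Rightarrow> (nat \<Rightarrow> 'n::finite) \<Rightarrow> complex \<Rightarrow> complex \<Rightarrow> ('n, 'n qsection, 'n qsection) sheaf_map" where
  "G_map k c \<mu> l =
     right_mult (J_ideal k c \<mu> l) (U1_op k c + mult_op (\<lambda>x. \<mu> * sig k c 1 x))"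

definition T_map ::
    "nat \<Rightarrow> (nat \<Rightarrow> 'n::finite) \<Rightarrow> complex \<Rightarrow> complex \<Rightarrow> ('n, 'n qsection, 'n qsection) sheaf_map" where
  "T_map k c \<mu> l = right_mult (J_ideal k c \<mu> (l + 1)) (Um1_op k c)"

end

theory Submission
  imports Defs "HOL-Complex_Analysis.Cauchy_Integral_Formula"
begin

text \<open>Put \<open>\<partial>\<^sub>0 = - (E + \<mu>)\<close>. Then \<open>\<T>\<^sup>m\<close> is \<open>\<partial>\<^sub>1 \<partial>\<^bsub>m-1\<^esub> - \<partial>\<^sub>m \<partial>\<^sub>0\<close>, so that modulo the ideal
  \<open>\<partial>\<^sub>i \<partial>\<^sub>j\<close> (with \<open>i \<ge> 1\<close>, \<open>j \<ge> 0\<close>) depends on \<open>i + j\<close> only, while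
  \<open>X = U\<^sub>1 + \<mu> \<sigma>\<^sub>1\<close> and \<open>Y = U\<^bsub>-1\<^esub>\<close> become \<open>X = - (\<Sum>j. (j+1) \<sigma>\<^bsub>j+1\<^esub> \<partial>\<^sub>j)\<close> and
  \<open>Y = (\<Sum>h. (k-h) \<sigma>\<^sub>h \<partial>\<^bsub>h+1\<^esub>)\<close>, with \<open>[\<partial>\<^sub>i, X] = \<sigma>\<^sub>1 \<partial>\<^sub>i - i \<partial>\<^bsub>i-1\<^esub>\<close> and
  \<open>[\<partial>\<^sub>i, Y] = (k-i) \<partial>\<^bsub>i+1\<^esub>\<close> for all \<open>i \<ge> 0\<close>. Hence right multiplication by \<open>X\<close> or \<open>Y\<close> preserves
  the ideal. Exchanging the indices in \<open>\<partial>\<^bsub>h+1\<^esub> \<partial>\<^sub>j\<close> in the two products and using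
  \<open>(\<Sum>h. (k-h) \<sigma>\<^sub>h \<partial>\<^sub>h) = - (k \<mu> + U\<^sub>0)\<close> gives \<open>Y X \<equiv> (U\<^sub>0 + 1) (U\<^sub>0 + k \<mu>)\<close> and
  \<open>X Y \<equiv> U\<^sub>0 (U\<^sub>0 + k \<mu> - 1)\<close>.\<close>

section \<open>Partial derivatives of holomorphic functions\<close>

text \<open>Congruence modulo a left ideal does not survive multiplication on the right, and
  \<open>d 0\<close> does not commute with \<open>D i\<close>. A relation between products
  \<open>d i * d j\<close> can therefore be pushed through the two operators only because the
  corrections, after all indices are brought to a common shape, depend on the total index alone.
  Operators are bare functions on total functions: composition distributes exactly over sums in its
  left factor, but in its right factor only up to \<open>op_eq\<close> and only for operators that
  are additive on holomorphic functions. Hence the global sections of \<open>DN\<close> are made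
  into a genuine ring, in which the algebra is carried out. Every operator in the statement is
  global, so the sheaf side reduces to global generators. The analytic input is that a partial
  derivative of a complex differentiable function is again complex differentiable, and that partial
  derivatives commute.\<close>

lemma norm_vector_smult: "norm (a *s (v::complex^'n)) = cmod a * norm v"
  unfolding norm_vec_def by (simp add: norm_mult L2_set_right_distrib)

lemma axis_eq_smult: "axis i z = z *s (axis i 1 :: complex^'n)"
  by (simp add: vec_eq_iff axis_def)

text \<open>A derivative is a priori only real linear; homogeneity over complex scalars turns it
  into multiplication by the number \<open>f' v\<close> along the line, so that one-variable complex
  analysis applies.\<close>

lemma has_field_derivative_along_line:
  fixes f :: "complex^'n \<Rightarrow> complex"
  assumes f: "(f has_derivative f') (at (y + t *s v))" and lin: "\<And>a w. f' (a *s w) = a * f' w"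
  shows "((\<lambda>s. f (y + s *s v)) has_field_derivative f' v) (at t)"
proof -
  have "((\<lambda>s. y + s *s v) has_derivative (\<lambda>s. s *s v)) (at t)"
  proof -
    have "bounded_linear (\<lambda>s. s *s v)"
      by (rule bounded_linear_intro[where K="norm v"])
        (simp_all add: vector_sadd_rdistrib vec_eq_iff norm_vector_smult)
    from has_derivative_add[OF has_derivative_const bounded_linear_imp_has_derivative[OF this]]
    show ?thesis by simp
  qed
  from has_derivative_compose[OF this f]
  show ?thesis
    unfolding has_field_derivative_def by (simp add: lin mult_commute_abs)
qed

lemma pd_eq_derivative:
  assumes "(f has_derivative f') (at x)" and "\<And>a w. f' (a *s w) = a * f' w"
  shows "((\<lambda>z. f (x + axis i z)) has_field_derivative f' (axis i 1)) (at 0)"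
    and "pd i f x = f' (axis i 1)"
proof -
  show *: "((\<lambda>z. f (x + axis i z)) has_field_derivative f' (axis i 1)) (at 0)"
  proof -
    have "(\<lambda>z. f (x + axis i z)) = (\<lambda>z. f (x + z *s axis i 1))"
      by (rule ext, subst axis_eq_smult, rule refl)
    then show ?thesis
      using has_field_derivative_along_line[of f f' x 0 "axis i 1"] assms by simp
  qed
  then show "pd i f x = f' (axis i 1)"
    unfolding pd_def by (rule DERIV_imp_deriv)
qed

lemma hol_on_line_holomorphic:
  fixes f :: "complex^'n \<Rightarrow> complex"
  assumes "hol_on f W" and "\<And>t. t \<in> S \<Longrightarrow> y + t *s v \<in> W"
  shows "(\<lambda>t. f (y + t *s v)) holomorphic_on S"
proof -
  have "(\<lambda>t. f (y + t *s v)) field_differentiable (at t)" if "t \<in> S" for t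
    using assms that has_field_derivative_along_line unfolding hol_on_def field_differentiable_def
    by metis
  then show ?thesis
    unfolding holomorphic_on_def by (meson field_differentiable_at_within)
qed

lemma hol_on_continuous: "hol_on f W \<Longrightarrow> continuous_on W f"
  unfolding hol_on_def
  by (intro continuous_at_imp_continuous_on) (blast intro: has_derivative_continuous)

text \<open>First-order Taylor expansion on \<open>cball 0 \<rho>\<close>, with the second
  derivative bounded by the Cauchy inequality on discs of radius \<rho>, which stay inside the
  larger ball. There is no factor 1/2 because \<open>complex_Taylor\<close> divides by
  \<open>fact n\<close>, not by \<open>fact (Suc n)\<close>.\<close>

lemma holomorphic_quotient_remainder:
  assumes hol: "g holomorphic_on ball 0 (3 * \<rho>)" and bd: "\<And>t. t \<in> ball 0 (3 * \<rho>) \<Longrightarrow> cmod (g t) \<le> M"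
    and "0 < \<rho>" and t: "cmod t \<le> \<rho>"
  shows "cmod (g t - g 0 - deriv g 0 * t) \<le> 2 * M / \<rho>\<^sup>2 * cmod t ^ 2"
proof -
  have "cmod (((deriv ^^ 0) g) t - (\<Sum>i\<le>1. ((deriv ^^ i) g) 0 * (t - 0) ^ i / fact i))
        \<le> 2 * M / \<rho>\<^sup>2 * cmod (t - 0) ^ Suc 1 / fact 1"
  proof (rule complex_Taylor[where S="cball 0 \<rho>"])
    fix i and s :: complex assume s: "s \<in> cball 0 \<rho>"
    have sb: "s \<in> ball 0 (3*\<rho>)" using s \<open>0<\<rho>\<close> by simp
    have "(deriv ^^ i) g holomorphic_on ball 0 (3*\<rho>)"
      using hol by (rule holomorphic_higher_deriv) simp
    then show "((deriv ^^ i) g has_field_derivative (deriv ^^ Suc i) g s) (at s within cball 0 \<rho>)"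
      using sb holomorphic_derivI has_field_derivative_at_within
      by (metis comp_apply funpow.simps(2) open_ball)
  next
    fix s :: complex assume s: "s \<in> cball 0 \<rho>"
    have sub: "cball s \<rho> \<subseteq> ball 0 (3*\<rho>)"
    proof
      fix w assume "w \<in> cball s \<rho>"
      then show "w \<in> ball 0 (3*\<rho>)"
        using s \<open>0<\<rho>\<close> norm_triangle_ineq2[of w s] by (simp add: dist_norm norm_minus_commute)
    qed
    have "cmod ((deriv ^^ 2) g s) \<le> fact 2 * M / \<rho>^2"
    proof (rule Cauchy_inequality)
      show "g holomorphic_on ball s \<rho>"
        using hol sub ball_subset_cball holomorphic_on_subset by (metis order_trans)
      show "continuous_on (cball s \<rho>) g"
        using hol sub holomorphic_on_imp_continuous_on holomorphic_on_subset by metis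
      show "cmod (g w) \<le> M" if "cmod (s - w) = \<rho>" for w
        using bd sub that by (metis dist_norm mem_cball order_refl subsetD)
    qed fact
    then show "cmod ((deriv ^^ Suc 1) g s) \<le> 2 * M / \<rho>\<^sup>2" by (simp add: numeral_2_eq_2)
  qed (use t \<open>0<\<rho>\<close> in auto)
  then show ?thesis by (simp add: power2_eq_square algebra_simps)
qed

lemma derivative_bound:
  fixes H :: "complex^'n \<Rightarrow> complex"
  assumes hol: "hol_on H (ball y \<rho>)" and bd: "\<And>z. z \<in> ball y \<rho> \<Longrightarrow> cmod (H z) \<le> B" and "0 < \<rho>"
    and H': "(H has_derivative H') (at y)" and lin: "\<And>a w. H' (a *s w) = a * H' w"
  shows "cmod (H' v) \<le> 2 * B / \<rho> * norm v"
proof (cases "v = 0")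
  case True
  then show ?thesis using lin[of 0 0] by simp
next
  case False
  \<comment> \<open>Half of the limiting radius: the closed disc then stays in the open ball, at the
    price of the factor 2 in the bound.\<close>
  define s where "s = \<rho> / (2 * norm v)"
  have s: "0 < s" using False \<open>0<\<rho>\<close> by (simp add: s_def)
  have inb: "y + t *s v \<in> ball y \<rho>" if "cmod t \<le> s" for t
  proof -
    have "cmod t * norm v \<le> s * norm v" using that by (simp add: mult_right_mono)
    also have "\<dots> < \<rho>" using False \<open>0<\<rho>\<close> by (simp add: s_def)
    finally show ?thesis by (simp add: dist_norm norm_vector_smult)
  qed
  have "(\<lambda>t. H (y + t *s v)) holomorphic_on cball 0 s"
    using inb by (intro hol_on_line_holomorphic[OF hol]) simp
  then have "cmod ((deriv ^^ 1) (\<lambda>t. H (y + t *s v)) 0) \<le> fact 1 * B / s ^ 1"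
  proof (intro Cauchy_inequality)
    show "cmod (H (y + w *s v)) \<le> B" if "cmod (0 - w) = s" for w
      using that bd inb by simp
  qed (use s in \<open>auto intro: holomorphic_on_imp_continuous_on holomorphic_on_subset\<close>)
  moreover have "deriv (\<lambda>t. H (y + t *s v)) 0 = H' v"
    using has_field_derivative_along_line[of H H' y 0 v] H' lin by (simp add: DERIV_imp_deriv)
  ultimately show ?thesis by (simp add: s_def field_simps)
qed

text \<open>The difference quotients of \<open>f\<close> in direction \<open>i\<close> converge uniformly near \<open>x\<close>, by the
  one-variable Cauchy estimates along complex lines; the same estimates applied to differences of
  quotients show that their derivatives form a uniform Cauchy sequence.\<close>

lemma pd_has_derivative:
  fixes f :: "complex^'n \<Rightarrow> complex"
  assumes "open W" and hol: "hol_on f W" and "x \<in> W"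
  obtains D \<epsilon> where "(pd i f has_derivative D) (at x)" and "\<And>a v. D (a *s v) = a * D v"
    and "\<epsilon> \<longlonglongrightarrow> 0" and "\<And>n. \<epsilon> n \<noteq> 0"
    and "\<And>j. (\<lambda>n. (pd j f (x + axis i (\<epsilon> n)) - pd j f x) / \<epsilon> n) \<longlonglongrightarrow> D (axis j 1)"
proof -
  obtain r where "r > 0" and r: "cball x r \<subseteq> W"
    using assms open_contains_cball by blast
  define \<rho> where "\<rho> = r / 5"
  have \<rho>: "0 < \<rho>" and W: "cball x (5 * \<rho>) \<subseteq> W"
    using \<open>r > 0\<close> r by (simp_all add: \<rho>_def)
  obtain F where F: "\<And>y. y \<in> W \<Longrightarrow> (f has_derivative F y) (at y)"
    and Flin: "\<And>y a v. y \<in> W \<Longrightarrow> F y (a *s v) = a * F y v"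
    using hol unfolding hol_on_def by metis
  have "compact (f ` cball x (5*\<rho>))"
    using hol_on_continuous[OF hol] W by (metis compact_cball compact_continuous_image continuous_on_subset)
  then obtain M where M: "\<And>y. y \<in> cball x (5*\<rho>) \<Longrightarrow> cmod (f y) \<le> M"
    by (metis compact_imp_bounded bounded_iff imageI)
  define e :: "complex^'n" where "e = axis i 1"
  have ne: "norm e = 1" 
    by (simp add: e_def norm_vec_def axis_def L2_set_def if_distrib[where f=norm]
        if_distrib[where f="\<lambda>x. x\<^sup>2"] cong: if_cong)
  define \<epsilon> where "\<epsilon> n = complex_of_real (\<rho> / real (Suc n))" for n
  have \<epsilon>0: "\<epsilon> n \<noteq> 0" and \<epsilon>r: "cmod (\<epsilon> n) \<le> \<rho>" for n
    using \<rho> by (auto simp: \<epsilon>_def norm_divide divide_simps simp del: of_nat_Suc)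
  have "(\<lambda>n. complex_of_real (\<rho> * inverse (real (Suc n)))) \<longlonglongrightarrow> complex_of_real (\<rho> * 0)"
    by (intro tendsto_intros LIMSEQ_inverse_real_of_nat)
  then have \<epsilon>: "\<epsilon> \<longlonglongrightarrow> 0"
    by (simp add: \<epsilon>_def[abs_def] divide_inverse del: of_nat_Suc)
  define K where "K = 2 * M / \<rho>\<^sup>2"
  have "0 \<le> M" using M[of x] \<rho> norm_ge_zero[of "f x"] by (auto simp del: norm_ge_zero)
  then have K: "0 \<le> K" by (simp add: K_def)
  define Q where "Q n y = (f (y + \<epsilon> n *s e) - f y) / \<epsilon> n" for n y
  define Q' where "Q' n y v = (F (y + \<epsilon> n *s e) v - F y v) / \<epsilon> n" for n y v
  have shift: "y + t *s e \<in> ball x (s + u)" if "y \<in> ball x s" "cmod t \<le> u" for y t s u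
    using that ne norm_triangle_ineq[of "x-y" "- (t *s e)"]
    by (simp add: dist_norm norm_vector_smult algebra_simps)
  have inW: "y \<in> W" "y + \<epsilon> n *s e \<in> W" if "y \<in> ball x (2*\<rho>)" for y n
  proof -
    show "y \<in> W" using that W \<rho> by auto
    have "y + \<epsilon> n *s e \<in> ball x (2*\<rho> + \<rho>)" using that \<epsilon>r by (rule shift)
    then show "y + \<epsilon> n *s e \<in> W" using W \<rho> by auto
  qed
  have Qest: "cmod (Q n y - F y e) \<le> K * cmod (\<epsilon> n)" if y: "y \<in> ball x (2*\<rho>)" for n y
  proof -
    let ?g = "\<lambda>t. f (y + t *s e)"
    have inb: "y + t *s e \<in> cball x (5*\<rho>)" if "t \<in> ball 0 (3*\<rho>)" for t
      using shift[OF y, of t "3*\<rho>"] that by simp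
    have "deriv ?g 0 = F y e"
      using has_field_derivative_along_line[of f "F y" y 0 e] F Flin inW(1)[OF y]
      by (simp add: DERIV_imp_deriv)
    moreover have "cmod (?g (\<epsilon> n) - ?g 0 - deriv ?g 0 * \<epsilon> n) \<le> 2 * M / \<rho>\<^sup>2 * cmod (\<epsilon> n) ^ 2"
    proof (rule holomorphic_quotient_remainder)
      show "?g holomorphic_on ball 0 (3*\<rho>)"
        using inb W by (intro hol_on_line_holomorphic[OF hol]) auto
    qed (use inb M \<rho> \<epsilon>r in auto)
    ultimately have "cmod (f (y + \<epsilon> n *s e) - f y - F y e * \<epsilon> n) \<le> K * cmod (\<epsilon> n) ^ 2"
      by (simp add: K_def)
    moreover have "f (y + \<epsilon> n *s e) - f y - F y e * \<epsilon> n = (Q n y - F y e) * \<epsilon> n"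
      using \<epsilon>0[of n] by (simp add: Q_def field_simps)
    ultimately have "cmod (Q n y - F y e) * cmod (\<epsilon> n) \<le> (K * cmod (\<epsilon> n)) * cmod (\<epsilon> n)"
      by (metis mult.assoc norm_mult power2_eq_square)
    then show ?thesis
      using \<epsilon>0[of n] by simp
  qed
  have Q'lin: "Q' n y (a *s v) = a * Q' n y v" if "y \<in> ball x (2*\<rho>)" for n y a v
    using inW[OF that] by (simp add: Q'_def Flin right_diff_distrib)
  have dQ: "(Q n has_derivative Q' n y) (at y)" if y: "y \<in> ball x (2*\<rho>)" for n y
  proof -
    have "((\<lambda>y. f (y + \<epsilon> n *s e)) has_derivative F (y + \<epsilon> n *s e)) (at y)"
      using has_derivative_compose[OF has_derivative_add[OF has_derivative_ident has_derivative_const] F[OF inW(2)[OF y]]]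
      by simp
    then show ?thesis
      unfolding Q_def Q'_def divide_inverse
      by (intro has_derivative_mult_left has_derivative_diff F inW(1)[OF y])
  qed
  \<comment> \<open>\<open>Q n - Q m\<close> is small on \<open>ball y \<rho>\<close> because both
    quotients are close to \<open>F z e\<close>; \<open>derivative_bound\<close> transfers this
    smallness to the derivatives.\<close>
  have est: "cmod (Q' n y v - Q' m y v) \<le> 2 * (K * (cmod (\<epsilon> n) + cmod (\<epsilon> m))) / \<rho> * norm v"
    if y: "y \<in> ball x \<rho>" for n m y v
  proof -
    have sub: "ball y \<rho> \<subseteq> ball x (2*\<rho>)"
    proof
      fix z assume "z \<in> ball y \<rho>"
      then show "z \<in> ball x (2*\<rho>)" using y dist_triangle[of x z y] by simp
    qed
    show ?thesis
    proof (rule derivative_bound[where H="\<lambda>z. Q n z - Q m z" and y=y])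
      show "hol_on (\<lambda>z. Q n z - Q m z) (ball y \<rho>)"
        unfolding hol_on_def
      proof
        fix z assume z: "z \<in> ball y \<rho>"
        show "\<exists>f'. ((\<lambda>z. Q n z - Q m z) has_derivative f') (at z) \<and> (\<forall>a v. f' (a *s v) = a * f' v)"
          using z sub by (intro exI[of _ "\<lambda>v. Q' n z v - Q' m z v"])
            (auto simp: Q'lin right_diff_distrib intro!: has_derivative_diff dQ)
      qed
      show "cmod (Q n z - Q m z) \<le> K * (cmod (\<epsilon> n) + cmod (\<epsilon> m))" if "z \<in> ball y \<rho>" for z
      proof -
        have "z \<in> ball x (2*\<rho>)" using that sub by auto
        from Qest[OF this, of n] Qest[OF this, of m] show ?thesis
          using norm_triangle_ineq4[of "Q n z - F z e" "Q m z - F z e"] by (simp add: algebra_simps)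
      qed
      have "y \<in> ball x (2*\<rho>)" using y \<rho> by simp
      then show "((\<lambda>z. Q n z - Q m z) has_derivative (\<lambda>v. Q' n y v - Q' m y v)) (at y)"
        "\<And>a w. Q' n y (a *s w) - Q' m y (a *s w) = a * (Q' n y w - Q' m y w)"
        by (auto simp: Q'lin right_diff_distrib intro!: has_derivative_diff dQ)
    qed fact
  qed
  have "convergent (\<lambda>n. Q' n y v)" if y: "y \<in> ball x \<rho>" for y v
    unfolding convergent_eq_Cauchy[symmetric] convergent_def
  proof (rule Cauchy_convergent[unfolded convergent_def], rule CauchyI)
    fix \<delta> :: real assume "0 < \<delta>"
    define C where "C = 2 * K / \<rho> * norm v"
    have C: "0 \<le> C" using K \<rho> by (simp add: C_def)
    have "eventually (\<lambda>n. cmod (\<epsilon> n) < \<delta> / (2 * C + 1)) sequentially"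
      using tendsto_norm[OF \<epsilon>] \<open>0<\<delta>\<close> C by (intro order_tendstoD(2)) auto
    then obtain N where N: "\<And>n. n \<ge> N \<Longrightarrow> cmod (\<epsilon> n) < \<delta> / (2 * C + 1)"
      by (auto simp: eventually_sequentially)
    show "\<exists>N. \<forall>m\<ge>N. \<forall>n\<ge>N. cmod (Q' m y v - Q' n y v) < \<delta>"
    proof (intro exI allI impI)
      fix m n assume "N \<le> m" "N \<le> n"
      have "cmod (Q' m y v - Q' n y v) \<le> C * (cmod (\<epsilon> m) + cmod (\<epsilon> n))"
        using est[OF y, of m v n] by (simp add: C_def algebra_simps)
      also have "\<dots> \<le> C * (\<delta> / (2 * C + 1) + \<delta> / (2 * C + 1))"
        using N[OF \<open>N \<le> m\<close>] N[OF \<open>N \<le> n\<close>] C by (intro mult_left_mono add_mono) auto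
      also have "\<dots> = 2 * C * \<delta> / (2 * C + 1)"
        by (simp flip: add_divide_distrib)
      also have "\<dots> < \<delta>" using C \<open>0<\<delta>\<close> by (simp add: divide_less_eq algebra_simps)
      finally show "cmod (Q' m y v - Q' n y v) < \<delta>" .
    qed
  qed
  then obtain G where G: "\<And>y v. y \<in> ball x \<rho> \<Longrightarrow> (\<lambda>n. Q' n y v) \<longlonglongrightarrow> G y v"
    unfolding convergent_def by metis
  have estG: "cmod (Q' n y v - G y v) \<le> 2 * (K * cmod (\<epsilon> n)) / \<rho> * norm v"
    if y: "y \<in> ball x \<rho>" for n y v
  proof (rule tendsto_le[OF _ _ tendsto_norm])
    show "(\<lambda>m. 2 * (K * (cmod (\<epsilon> n) + cmod (\<epsilon> m))) / \<rho> * norm v) \<longlonglongrightarrow> 2 * (K * cmod (\<epsilon> n)) / \<rho> * norm v"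
      by (rule tendsto_eq_intros \<epsilon> refl | (use \<rho> in simp))+
    show "(\<lambda>m. Q' n y v - Q' m y v) \<longlonglongrightarrow> Q' n y v - G y v"
      by (intro tendsto_intros G y)
  qed (use est[OF y] in auto)
  have Qlim: "(\<lambda>n. Q n y) \<longlonglongrightarrow> F y e" if y: "y \<in> ball x \<rho>" for y
  proof -
    have lim0: "(\<lambda>n. K * cmod (\<epsilon> n)) \<longlonglongrightarrow> 0"
      by (rule tendsto_eq_intros \<epsilon> refl | simp)+
    have "cmod (Q n y - F y e) \<le> K * cmod (\<epsilon> n)" for n
      using y \<rho> by (intro Qest) simp
    then have "(\<lambda>n. Q n y - F y e) \<longlonglongrightarrow> 0"
      by (intro Lim_null_comparison[OF _ lim0]) (simp add: always_eventually)
    then show ?thesis by (simp add: LIM_zero_iff)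
  qed
  \<comment> \<open>The derivatives \<open>Q' n\<close> converge to \<open>G\<close> uniformly, so
    the limit of \<open>Q n\<close>, which is \<open>pd i f\<close>, has derivative
    \<open>G\<close>.\<close>
  have "\<exists>g. \<forall>y\<in>ball x \<rho>. (\<lambda>n. Q n y) \<longlonglongrightarrow> g y \<and> (g has_derivative G y) (at y within ball x \<rho>)"
  proof (rule has_derivative_sequence)
    show "(Q n has_derivative Q' n y) (at y within ball x \<rho>)" if "y \<in> ball x \<rho>" for n y
      using dQ[of y n] that \<rho> by (simp add: has_derivative_at_withinI)
    show "\<forall>\<^sub>F n in sequentially. \<forall>y\<in>ball x \<rho>. \<forall>h. norm (Q' n y h - G y h) \<le> d * norm h"
      if "0 < d" for d
    proof -
      have "(\<lambda>n. 2 * (K * cmod (\<epsilon> n)) / \<rho>) \<longlonglongrightarrow> 0"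
        by (rule tendsto_eq_intros \<epsilon> refl | (use \<rho> in simp))+
      then have "\<forall>\<^sub>F n in sequentially. 2 * (K * cmod (\<epsilon> n)) / \<rho> < d"
        using \<open>0 < d\<close> by (rule order_tendstoD(2))
      then show ?thesis
      proof eventually_elim
        case (elim n)
        then show ?case
          using estG[of _ n] by (meson less_imp_le mult_right_mono norm_ge_zero order_trans)
      qed
    qed
    show "x \<in> ball x \<rho>" using \<rho> by simp
    then show "(\<lambda>n. Q n x) \<longlonglongrightarrow> F x e" by (rule Qlim)
  qed simp
  then obtain g where g: "\<And>y. y \<in> ball x \<rho> \<Longrightarrow> (\<lambda>n. Q n y) \<longlonglongrightarrow> g y"
    and dg: "\<And>y. y \<in> ball x \<rho> \<Longrightarrow> (g has_derivative G y) (at y within ball x \<rho>)" by blast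
  have x: "x \<in> ball x \<rho>" using \<rho> by simp
  have pdF: "pd j f y = F y (axis j 1)" if "y \<in> W" for j y
    using pd_eq_derivative(2)[OF F[OF that] Flin[OF that]] .
  have "g y = pd i f y" if y: "y \<in> ball x \<rho>" for y
    using LIMSEQ_unique[OF g[OF y] Qlim[OF y]] pdF[of y i] inW(1)[of y] y \<rho> by (simp add: e_def)
  then have G1: "(pd i f has_derivative G x) (at x)"
    using has_derivative_transform_within_open[OF _ _ x] dg[OF x] x at_within_open[OF x] by (metis open_ball)
  have G2: "G x (a *s v) = a * G x v" for a v
  proof (rule LIMSEQ_unique[OF G[OF x]])
    show "(\<lambda>n. Q' n x (a *s v)) \<longlonglongrightarrow> a * G x v"
      using tendsto_mult_left[OF G[OF x, of v], of a] Q'lin[of x] \<rho> by simp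
  qed
  \<comment> \<open>\<open>Q' n x (axis j 1)\<close> is also the difference quotient of
    \<open>pd j f\<close> in direction \<open>i\<close>, so one limit computes both mixed
    derivatives.\<close>
  have G3: "(\<lambda>n. (pd j f (x + axis i (\<epsilon> n)) - pd j f x) / \<epsilon> n) \<longlonglongrightarrow> G x (axis j 1)" for j
  proof -
    have "x \<in> ball x (2*\<rho>)" using \<rho> by simp
    from inW[OF this] have "(pd j f (x + axis i (\<epsilon> n)) - pd j f x) / \<epsilon> n = Q' n x (axis j 1)" for n
      by (simp add: Q'_def pdF e_def axis_eq_smult[of i "\<epsilon> n"])
    then show ?thesis using G[OF x] by simp
  qed
  show ?thesis by (rule that[OF G1 G2 \<epsilon> \<epsilon>0 G3])
qed

lemma hol_on_pd:
  assumes "open W" and "hol_on f W"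
  shows "hol_on (pd i f) W"
  unfolding hol_on_def
proof
  fix x assume "x \<in> W"
  show "\<exists>D. (pd i f has_derivative D) (at x) \<and> (\<forall>a v. D (a *s v) = a * D v)"
    by (rule pd_has_derivative[OF assms \<open>x \<in> W\<close>, of i]) blast
qed

text \<open>At \<open>axis j 1\<close> the derivative \<open>D\<close> of \<open>pd i f\<close>
  gives \<open>pd j (pd i f)\<close>; the limit clause of \<open>pd_has_derivative\<close>
  identifies the same number with \<open>pd i (pd j f)\<close>.\<close>

lemma pd_commute:
  assumes W: "open W" "hol_on f W" "x \<in> W"
  shows "pd i (pd j f) x = pd j (pd i f) x"
proof -
  obtain D \<epsilon> where D: "(pd i f has_derivative D) (at x)" "\<And>a v. D (a *s v) = a * D v"
    and \<epsilon>: "\<epsilon> \<longlonglongrightarrow> 0" "\<And>n. \<epsilon> n \<noteq> 0"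
    and lim: "(\<lambda>n. (pd j f (x + axis i (\<epsilon> n)) - pd j f x) / \<epsilon> n) \<longlonglongrightarrow> D (axis j 1)"
    by (rule pd_has_derivative[OF W, of i]) blast
  obtain D' where D': "(pd j f has_derivative D') (at x)" "\<And>a v. D' (a *s v) = a * D' v"
    using hol_on_pd[OF W(1,2), of j] W(3) unfolding hol_on_def by metis
  have "((\<lambda>z. pd j f (x + axis i z)) has_field_derivative pd i (pd j f) x) (at 0)"
    using pd_eq_derivative[OF D'] by simp
  then have "((\<lambda>z. (pd j f (x + axis i z) - pd j f x) / z) \<longlongrightarrow> pd i (pd j f) x) (at 0)"
    unfolding has_field_derivative_iff by (simp add: axis_eq_smult[of i 0])
  then have "(\<lambda>n. (pd j f (x + axis i (\<epsilon> n)) - pd j f x) / \<epsilon> n) \<longlonglongrightarrow> pd i (pd j f) x"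
    by (rule filterlim_compose) (use \<epsilon> in \<open>simp add: filterlim_at\<close>)
  with lim have "pd i (pd j f) x = D (axis j 1)" by (simp add: LIMSEQ_unique)
  then show ?thesis using pd_eq_derivative(2)[OF D] by simp
qed

section \<open>The relations in an abstract Weyl algebra\<close>

lemma mult_of_nat_left: "x * (of_nat n * y) = of_nat n * (x * (y::'a::semiring_1))"
  by (metis mult.assoc mult_of_nat_commute)

section \<open>Congruence modulo a left ideal\<close>

locale left_ideal_of_ring =
  fixes I :: "'a::ring_1 set"
  assumes zero: "0 \<in> I" and add: "a \<in> I \<Longrightarrow> b \<in> I \<Longrightarrow> a + b \<in> I"
    and mult: "a \<in> I \<Longrightarrow> r * a \<in> I"
begin

text \<open>Only multiplication from the left is compatible with this relation; right multiplication
  by \<open>Up\<close> and \<open>Um\<close> has to be earned in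
  \<open>generator_mult_in\<close>.\<close>

definition cong :: "'a \<Rightarrow> 'a \<Rightarrow> bool" (infix "\<doteq>" 50) where
  "a \<doteq> b \<longleftrightarrow> a - b \<in> I"

lemma uminus: "a \<in> I \<Longrightarrow> - a \<in> I"
  using mult[of a "- 1"] by simp

lemma cong_refl [simp, intro]: "a \<doteq> a"
  by (simp add: cong_def zero)

lemma cong_sym: "a \<doteq> b \<Longrightarrow> b \<doteq> a"
  unfolding cong_def using uminus by fastforce

lemma cong_trans [trans]: "a \<doteq> b \<Longrightarrow> b \<doteq> c \<Longrightarrow> a \<doteq> c"
  unfolding cong_def using add[of "a - b" "b - c"] by simp

lemma cong_add: "a \<doteq> b \<Longrightarrow> a' \<doteq> b' \<Longrightarrow> a + a' \<doteq> b + b'"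
  unfolding cong_def using add[of "a - b" "a' - b'"] by (simp add: algebra_simps)

lemma cong_uminus: "a \<doteq> b \<Longrightarrow> - a \<doteq> - b"
  unfolding cong_def using uminus[of "a - b"] by (simp add: algebra_simps)

lemma cong_diff: "a \<doteq> b \<Longrightarrow> a' \<doteq> b' \<Longrightarrow> a - a' \<doteq> b - b'"
  using cong_add[of a b "- a'" "- b'"] cong_uminus by simp

lemma cong_mult: "a \<doteq> b \<Longrightarrow> r * a \<doteq> r * b"
  unfolding cong_def using mult[of "a - b" r] by (simp add: algebra_simps)

lemma cong_sum: "(\<And>i. i \<in> S \<Longrightarrow> f i \<doteq> g i) \<Longrightarrow> sum f S \<doteq> sum g S"
  by (induction S rule: infinite_finite_induct) (auto intro: cong_add)

end

text \<open>The scalar \<mu> is an element \<open>m\<close> commuting with the generators, since a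
  bare ring carries no complex scalars. \<open>D 0\<close> and \<open>D (Suc k)\<close> obey no
  relation with \<open>s\<close> or the other \<open>D j\<close>, so formulas must avoid them or
  give them coefficient 0.\<close>

locale weyl_algebra =
  fixes s D :: "nat \<Rightarrow> 'a::ring_1" and k :: nat and m :: 'a
  assumes s_0: "s 0 = 1" and s_gt: "s (Suc k) = 0"
    and s_s: "s i * s j = s j * s i"
    and D_D: "\<lbrakk>i \<in> {1..k}; j \<in> {1..k}\<rbrakk> \<Longrightarrow> D i * D j = D j * D i"
    and D_s: "\<lbrakk>i \<in> {1..k}; j \<le> k\<rbrakk> \<Longrightarrow> D i * s j = s j * D i + (if i = j then 1 else 0)"
    and m_s: "m * s i = s i * m" and m_D: "m * D i = D i * m"
begin

text \<open>Euler fields with arbitrary weights, so that one commutator computation serves both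
  \<open>E\<close> and \<open>U0\<close>.\<close>

definition W :: "(nat \<Rightarrow> nat) \<Rightarrow> 'a" where
  "W n = (\<Sum>h=1..k. of_nat (n h) * (s h * D h))"

abbreviation "E \<equiv> W (\<lambda>h. 1)"
abbreviation "U0 \<equiv> W (\<lambda>h. h)"

text \<open>With \<open>d 0 = - (E + m)\<close> the relations \<open>T\<close> become the relations \<open>A\<close> with an index 0 on
  the right, and the commutators with \<open>Up\<close> and \<open>Um\<close> are uniform in the index.\<close>

definition d :: "nat \<Rightarrow> 'a" where
  "d j = (if j = 0 then - (E + m) else D j)"

definition Up :: 'a where
  "Up = - (\<Sum>j<k. of_nat (Suc j) * (s (Suc j) * d j))"

definition Um :: 'a where
  "Um = (\<Sum>h<k. of_nat (k - h) * (s h * d (Suc h)))"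

lemma D_W:
  assumes i: "i \<in> {1..k}"
  shows "D i * W n = W n * D i + of_nat (n i) * D i"
proof -
  have "D i * (of_nat (n h) * (s h * D h))
      = of_nat (n h) * (s h * D h) * D i + (if h = i then of_nat (n i) * D i else 0)"
    if "h \<in> {1..k}" for h
  proof -
    have "D i * (s h * D h) = s h * (D i * D h) + (if i = h then D h else 0)"
      using D_s[OF i, of h] that by (simp flip: mult.assoc add: distrib_right)
    then show ?thesis
      using D_D[OF i that] by (simp add: mult_of_nat_left distrib_left mult.assoc)
  qed
  then have "D i * W n = (\<Sum>h=1..k. of_nat (n h) * (s h * D h) * D i + (if h = i then of_nat (n i) * D i else 0))"
    unfolding W_def sum_distrib_left by (rule sum.cong[OF refl])
  also have "\<dots> = W n * D i + of_nat (n i) * D i"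
    unfolding W_def sum.distrib sum_distrib_right using i by simp
  finally show ?thesis .
qed

lemma W_s:
  assumes j: "j \<in> {1..k}"
  shows "W n * s j = s j * W n + of_nat (n j) * s j"
proof -
  have "of_nat (n h) * (s h * D h) * s j
      = s j * (of_nat (n h) * (s h * D h)) + (if h = j then of_nat (n j) * s j else 0)"
    if h: "h \<in> {1..k}" for h
  proof -
    have "s h * (D h * s j) = s h * (s j * D h) + (if h = j then s h else 0)"
      using D_s[OF h, of j] j by (simp add: distrib_left)
    moreover have "s h * (s j * D h) = s j * (s h * D h)"
      by (metis mult.assoc s_s)
    ultimately show ?thesis
      by (simp add: mult_of_nat_left distrib_left mult.assoc)
  qed
  then have "W n * s j = (\<Sum>h=1..k. s j * (of_nat (n h) * (s h * D h)) + (if h = j then of_nat (n j) * s j else 0))"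
    unfolding W_def sum_distrib_right by (rule sum.cong[OF refl])
  also have "\<dots> = s j * W n + of_nat (n j) * s j"
    unfolding W_def sum.distrib sum_distrib_left using j by simp
  finally show ?thesis .
qed

text \<open>Under the commutator with \<open>W n\<close>, \<open>s j\<close> has weight
  \<open>n j\<close> and \<open>D i\<close> has weight \<open>- n i\<close>; the two contributions
  sit on opposite sides because the weights are natural numbers.\<close>

lemma W_s_D:
  assumes "j \<in> {1..k}" "i \<in> {1..k}"
  shows "W n * (s j * D i) + of_nat (n i) * (s j * D i) = s j * D i * W n + of_nat (n j) * (s j * D i)"
proof -
  have "W n * (s j * D i) = s j * (W n * D i) + of_nat (n j) * (s j * D i)"
    using W_s[OF assms(1), of n] by (simp flip: mult.assoc add: distrib_right)
  also have "W n * D i = D i * W n - of_nat (n i) * D i"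
    using D_W[OF assms(2), of n] by simp
  finally show ?thesis
    by (simp add: right_diff_distrib mult_of_nat_left mult.assoc)
qed

text \<open>Each summand \<open>s h * D h\<close> of the other field has weight 0.\<close>

lemma W_commute: "W n * W n' = W n' * W n"
proof -
  have "W n * (of_nat (n' h) * (s h * D h)) = of_nat (n' h) * (s h * D h) * W n"
    if "h \<in> {1..k}" for h
    using W_s_D[OF that that, of n] by (simp add: mult_of_nat_left mult.assoc)
  then show ?thesis
    unfolding W_def[of n'] sum_distrib_left sum_distrib_right by (rule sum.cong[OF refl])
qed

lemma m_W: "m * W n = W n * m"
proof -
  have "m * (of_nat (n h) * (s h * D h)) = of_nat (n h) * (s h * D h) * m" for h
    by (metis mult_of_nat_left mult.assoc m_s m_D)
  then show ?thesis
    unfolding W_def sum_distrib_left sum_distrib_right by simp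
qed

lemma m_d: "m * d j = d j * m"
  by (cases "j = 0") (simp_all add: d_def m_D m_W left_diff_distrib right_diff_distrib)

text \<open>The exceptional term is the commutator of \<open>D i\<close> with \<open>E\<close>.
  Because of it, the relations keep an index from \<open>1\<close> to \<open>k\<close> in the left
  factor.\<close>

lemma D_d:
  assumes i: "i \<in> {1..k}" and "j \<le> k"
  shows "D i * d j = d j * D i - (if j = 0 then D i else 0)"
  using D_W[OF i, of "\<lambda>h. 1"] D_D[OF i, of j] m_D[of i] \<open>j \<le> k\<close>
  by (auto simp: d_def algebra_simps)

text \<open>Index 0 fits the weight rule with weight 0: \<open>s 0\<close> is 1, and
  \<open>d 0\<close> commutes with every \<open>W n\<close>.\<close>

lemma W_s_d:
  assumes "j \<le> k" "i \<le> k" "n 0 = 0"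
  shows "W n * (s j * d i) + of_nat (n i) * (s j * d i) = s j * d i * W n + of_nat (n j) * (s j * d i)"
proof -
  have 1: "W n * s j = s j * W n + of_nat (n j) * s j"
    using W_s[of j n] assms by (cases "j = 0") (auto simp: s_0)
  have 2: "W n * d i = d i * W n - of_nat (n i) * d i"
    using D_W[of i n] W_commute[of n] m_W[of n] assms
    by (cases "i = 0") (auto simp: d_def algebra_simps)
  have "W n * (s j * d i) = s j * (W n * d i) + of_nat (n j) * (s j * d i)"
    using 1 by (simp flip: mult.assoc add: distrib_right)
  then show ?thesis
    by (simp add: 2 right_diff_distrib mult_of_nat_left mult.assoc)
qed

text \<open>Every summand \<open>s (Suc j) * d j\<close> has weight 1 under \<open>U0\<close>; in
  \<open>Um\<close> every summand has weight -1. This is the shift of \<lambda> by one in the two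
  maps.\<close>

lemma U0_Up: "U0 * Up = Up * U0 + Up"
proof -
  have "U0 * (of_nat (Suc j) * (s (Suc j) * d j))
      = of_nat (Suc j) * (s (Suc j) * d j) * U0 + of_nat (Suc j) * (s (Suc j) * d j)"
    if "j < k" for j
  proof -
    have "U0 * (s (Suc j) * d j) = s (Suc j) * d j * U0 + s (Suc j) * d j"
      using W_s_d[of "Suc j" j "\<lambda>h. h"] that by (simp add: algebra_simps)
    then show ?thesis
      by (simp only: mult_of_nat_left distrib_left mult.assoc)
  qed
  then show ?thesis
    unfolding Up_def by (simp add: sum_distrib_left sum_distrib_right sum.distrib del: of_nat_Suc)
qed

lemma U0_Um: "U0 * Um = Um * U0 - Um"
proof -
  have "U0 * (of_nat (k - h) * (s h * d (Suc h)))
      = of_nat (k - h) * (s h * d (Suc h)) * U0 - of_nat (k - h) * (s h * d (Suc h))"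
    if "h < k" for h
  proof -
    have "U0 * (s h * d (Suc h)) = s h * d (Suc h) * U0 - s h * d (Suc h)"
      using W_s_d[of h "Suc h" "\<lambda>h. h"] that by (simp add: algebra_simps)
    then show ?thesis
      by (simp only: mult_of_nat_left right_diff_distrib mult.assoc)
  qed
  then show ?thesis
    unfolding Um_def by (simp add: sum_distrib_left sum_distrib_right sum_subtractf)
qed

text \<open>The products \<open>D i * d j\<close> are deliberately left uncommuted:
  \<open>d_Up\<close> commutes them exactly, whereas \<open>Um_Up\<close> first exchanges their
  indices modulo the ideal.\<close>

lemma D_Up_sum:
  assumes i: "i \<in> {1..k}"
  shows "D i * Up = - (\<Sum>j<k. of_nat (Suc j) * (s (Suc j) * (D i * d j))) - of_nat i * d (i - 1)"
proof -
  \<comment> \<open>\<open>D i\<close> meets its own coordinate only in the summand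
    \<open>Suc j = i\<close>, whose coefficient is \<open>i\<close>.\<close>
  have "D i * (of_nat (Suc j) * (s (Suc j) * d j)) =
      of_nat (Suc j) * (s (Suc j) * (D i * d j)) + (if j = i - 1 then of_nat i * d (i - 1) else 0)"
    if "j < k" for j
  proof -
    have "D i * (s (Suc j) * d j) = s (Suc j) * (D i * d j) + (if i = Suc j then d j else 0)"
      using D_s[OF i, of "Suc j"] that by (simp flip: mult.assoc add: distrib_right)
    then show ?thesis
      using i by (auto simp: mult_of_nat_left distrib_left mult.assoc simp del: of_nat_Suc)
  qed
  then have "D i * (\<Sum>j<k. of_nat (Suc j) * (s (Suc j) * d j)) =
      (\<Sum>j<k. of_nat (Suc j) * (s (Suc j) * (D i * d j)) + (if j = i - 1 then of_nat i * d (i - 1) else 0))"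
    unfolding sum_distrib_left by (intro sum.cong) auto
  also have "\<dots> = (\<Sum>j<k. of_nat (Suc j) * (s (Suc j) * (D i * d j))) + of_nat i * d (i - 1)"
    using i unfolding sum.distrib by (simp add: less_eq_Suc_le del: of_nat_Suc)
  finally show ?thesis by (simp add: Up_def)
qed

text \<open>For positive \<open>i\<close>, the term \<open>s 1 * d i\<close> comes from moving
  \<open>D i\<close> past \<open>d 0\<close> in the summand \<open>j = 0\<close>. For
  \<open>i = 0\<close> it comes from \<open>E\<close>, under which \<open>s (Suc j) * d j\<close>
  has weight 0 except for \<open>j = 0\<close>, where the weight is 1; the term in
  \<open>d (i - 1)\<close> then has coefficient 0.\<close>

lemma d_Up:
  assumes "i \<le> k" "k \<ge> 1"
  shows "d i * Up = Up * d i + s 1 * d i - of_nat i * d (i - 1)"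
proof (cases "i = 0")
  case False
  then have i: "i \<in> {1..k}" using assms by simp
  have "of_nat (Suc j) * (s (Suc j) * (D i * d j)) =
      of_nat (Suc j) * (s (Suc j) * d j) * D i - (if j = 0 then s 1 * D i else 0)" if "j < k" for j
    using that by (subst D_d[OF i]) (auto simp: right_diff_distrib mult.assoc)
  then have "(\<Sum>j<k. of_nat (Suc j) * (s (Suc j) * (D i * d j))) = - Up * D i - s 1 * D i"
    using assms by (simp add: Up_def sum_subtractf sum_distrib_right del: of_nat_Suc)
  then show ?thesis
    using D_Up_sum[OF i] False by (simp add: d_def)
next
  case True
  have "E * (of_nat (Suc j) * (s (Suc j) * d j)) =
      of_nat (Suc j) * (s (Suc j) * d j) * E + (if j = 0 then s 1 * d 0 else 0)" if "j < k" for j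
  proof (cases "j = 0")
    case True
    have "E * (s 1 * d 0) = s 1 * (E * d 0) + s 1 * d 0"
      using W_s[of 1 "\<lambda>h. 1"] assms by (simp flip: mult.assoc add: distrib_right)
    moreover have "E * d 0 = d 0 * E"
      using m_W[of "\<lambda>h. 1"] by (simp add: d_def algebra_simps)
    ultimately show ?thesis using True by (simp add: mult.assoc)
  next
    case False
    then show ?thesis
      using W_s_D[of "Suc j" j "\<lambda>h. 1"] that
      by (simp add: d_def mult_of_nat_left mult.assoc del: of_nat_Suc)
  qed
  then have "E * Up = Up * E - s 1 * d 0"
    using assms by (simp add: Up_def sum.distrib sum_distrib_left sum_distrib_right del: of_nat_Suc)
  moreover have "m * Up = Up * m"
  proof -
    have "m * (of_nat (Suc j) * (s (Suc j) * d j)) = of_nat (Suc j) * (s (Suc j) * d j) * m" for j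
      by (metis mult_of_nat_left mult.assoc m_s m_d)
    then show ?thesis by (simp add: Up_def sum_distrib_left sum_distrib_right del: of_nat_Suc)
  qed
  ultimately show ?thesis using True by (simp add: d_def algebra_simps)
qed

text \<open>Under \<open>E\<close> the summand \<open>s h * d (Suc h)\<close> has weight 0 except
  for \<open>h = 0\<close>, where \<open>s 0 = 1\<close> leaves weight -1; this yields the case
  \<open>i = 0\<close>. For \<open>i = k\<close> the coefficient 0 removes the uncontrolled
  \<open>d (Suc k)\<close>.\<close>

lemma d_Um:
  assumes "i \<le> k" "k \<ge> 1"
  shows "d i * Um = Um * d i + of_nat (k - i) * d (Suc i)"
proof (cases "i = 0")
  case False
  then have i: "i \<in> {1..k}" using assms by simp
  have "D i * (of_nat (k - h) * (s h * d (Suc h))) =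
      of_nat (k - h) * (s h * d (Suc h)) * D i + (if h = i then of_nat (k - i) * d (Suc i) else 0)"
    if "h < k" for h
  proof -
    have "D i * (s h * d (Suc h)) = s h * (D i * d (Suc h)) + (if i = h then d (Suc h) else 0)"
      using D_s[OF i, of h] that by (simp flip: mult.assoc add: distrib_right)
    then show ?thesis
      using D_d[OF i, of "Suc h"] that
      by (simp add: mult_of_nat_left distrib_left mult.assoc del: of_nat_diff)
  qed
  then have "D i * Um = Um * D i + (\<Sum>h<k. if h = i then of_nat (k - i) * d (Suc i) else 0)"
    by (simp add: Um_def sum.distrib sum_distrib_left sum_distrib_right)
  then show ?thesis
    using False assms by (cases "i = k") (auto simp: d_def)
next
  case True
  have "E * (of_nat (k - h) * (s h * d (Suc h))) =
      of_nat (k - h) * (s h * d (Suc h)) * E - (if h = 0 then of_nat k * d 1 else 0)" if "h < k" for h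
  proof (cases "h = 0")
    case True
    moreover have "E * D 1 = D 1 * E - D 1"
      using D_W[of 1 "\<lambda>h. 1"] assms by simp
    ultimately show ?thesis
      by (simp add: d_def s_0 mult_of_nat_left right_diff_distrib mult.assoc)
  next
    case False
    then show ?thesis
      using W_s_D[of h "Suc h" "\<lambda>h. 1"] that
      by (simp add: d_def mult_of_nat_left mult.assoc del: of_nat_diff)
  qed
  then have "E * Um = Um * E - of_nat k * d 1"
    using assms by (simp add: Um_def sum_subtractf sum_distrib_left sum_distrib_right)
  moreover have "m * Um = Um * m"
  proof -
    have "m * (of_nat (k - h) * (s h * d (Suc h))) = of_nat (k - h) * (s h * d (Suc h)) * m" for h
      by (metis mult_of_nat_left mult.assoc m_s m_d)
    then show ?thesis by (simp add: Um_def sum_distrib_left sum_distrib_right del: of_nat_diff)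
  qed
  ultimately show ?thesis using True by (simp add: d_def algebra_simps)
qed

text \<open>Splitting \<open>k - h\<close> gives \<open>k\<close> copies of
  \<open>d 0 + E = - m\<close>, minus the sum for \<open>U0\<close>; this is the origin of
  \<open>k * \<mu>\<close> in the scalar.\<close>

lemma sum_weighted_s_d: "(\<Sum>h<k. of_nat (k - h) * (s h * d h)) = - (of_nat k * m + U0)"
proof -
  have "(\<Sum>h<k. of_nat (k - h) * (s h * d h)) = (\<Sum>h\<le>k. of_nat (k - h) * (s h * d h))"
    by (simp flip: lessThan_Suc_atMost)
  also have "\<dots> = (\<Sum>h\<le>k. of_nat k * (s h * d h) - of_nat h * (s h * d h))"
    by (intro sum.cong) (auto simp: of_nat_diff left_diff_distrib)
  also have "\<dots> = of_nat k * (\<Sum>h\<le>k. s h * d h) - (\<Sum>h\<le>k. of_nat h * (s h * d h))"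
    by (simp add: sum_subtractf sum_distrib_left)
  also have "(\<Sum>h\<le>k. s h * d h) = d 0 + E"
    by (simp add: W_def d_def s_0 sum.atMost_shift sum.atLeast1_atMost_eq)
  also have "(\<Sum>h\<le>k. of_nat h * (s h * d h)) = U0"
    by (simp add: W_def d_def sum.atMost_shift sum.atLeast1_atMost_eq)
  finally show ?thesis by (simp add: d_def algebra_simps)
qed

end

section \<open>Products of two derivatives modulo the ideal\<close>

locale weyl_ideal = weyl_algebra s D k m + left_ideal_of_ring I
  for s D :: "nat \<Rightarrow> 'a::ring_1" and k m and I :: "'a set" +
  assumes k: "k \<ge> 2"
    and A_in: "\<lbrakk>p \<in> {1..k-1}; q \<in> {2..k}\<rbrakk> \<Longrightarrow> D p * D q - D (p + 1) * D (q - 1) \<in> I"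
    and T_in: "j \<in> {2..k} \<Longrightarrow> D 1 * D (j - 1) + D j * (E + m) \<in> I"
begin

lemma d_d_step:
  assumes "1 \<le> p" "p < k" "q < k"
  shows "d p * d (Suc q) \<doteq> d (Suc p) * d q"
proof (cases "q = 0")
  case True
  \<comment> \<open>With \<open>d 0 = - (E + m)\<close> this difference is the generator
    \<open>T\<close> of index \<open>Suc p\<close>, once \<open>D p\<close> and \<open>D 1\<close>
    are commuted.\<close>
  then have "d p * d (Suc q) - d (Suc p) * d q = D 1 * D (Suc p - 1) + D (Suc p) * (E + m)"
    using assms D_D[of 1 p] by (simp add: d_def algebra_simps)
  then show ?thesis
    using T_in[of "Suc p"] assms by (simp add: cong_def)
next
  case False
  then show ?thesis
    using A_in[of p "Suc q"] assms by (simp add: cong_def d_def)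
qed

lemma d_d_shift:
  assumes "1 \<le> p" "p + t \<le> k" "q + t \<le> k"
  shows "d p * d (q + t) \<doteq> d (p + t) * d q"
  using assms
proof (induction t arbitrary: q)
  case (Suc t)
  have "d p * d (Suc q + t) \<doteq> d (p + t) * d (Suc q)"
    using Suc.prems by (intro Suc.IH) auto
  also have "d (p + t) * d (Suc q) \<doteq> d (Suc (p + t)) * d q"
    using Suc.prems by (intro d_d_step) auto
  finally show ?case by simp
qed simp

lemma d_d_cong:
  assumes "i \<in> {1..k}" "j \<le> k" "i' \<in> {1..k}" "j' \<le> k" "i + j = i' + j'"
  shows "d i * d j \<doteq> d i' * d j'"
proof (cases "i \<le> i'")
  case True
  then have "j' + (i' - i) = j" "i + (i' - i) = i'" using assms by auto
  then show ?thesis using d_d_shift[of i "i' - i" j'] assms by simp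
next
  case False
  then have "j + (i - i') = j'" "i' + (i - i') = i" using assms by auto
  then show ?thesis using d_d_shift[of i' "i - i'" j] assms by (simp add: cong_sym)
qed

text \<open>Commuting with \<open>Up\<close> lowers one of the two indices by 1, and modulo the
  ideal both lowered products equal \<open>d a * d b\<close>. The coefficients then combine to
  \<open>i + j\<close>, so the remainder depends on the total index only.\<close>

lemma d_d_Up:
  assumes i: "i \<in> {1..k}" and j: "j \<le> k" and ab: "a \<in> {1..k}" "b \<le> k" "Suc (a + b) = i + j"
  shows "d i * d j * Up \<doteq> (Up + 2 * s 1) * (d i * d j) - of_nat (i + j) * (d a * d b)"
proof -
  have di: "d i = D i" using i by (simp add: d_def)
  have D_s1: "D i * s 1 = s 1 * D i + (if i = 1 then 1 else 0)"
    using D_s[OF i, of 1] k by simp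
  \<comment> \<open>For \<open>i = 1\<close> the index 0 lands on the left, where no exchange is
    available. The extra \<open>d j\<close> from moving \<open>D 1\<close> past \<open>s 1\<close>
    repairs this: \<open>d 0 * d j - d j = d j * d 0\<close> for positive \<open>j\<close>.\<close>
  define R where "R = of_nat i * (d (i - 1) * d j) - (if i = 1 then d j else 0)"
  have R: "R \<doteq> of_nat i * (d a * d b)"
  proof (cases "i = 1")
    case True
    \<comment> \<open>\<open>j = 0\<close> would give \<open>a + b = 0\<close>, against
      \<open>a\<close> being positive.\<close>
    then have "j \<in> {1..k}" using j ab by auto
    then have "R = d j * d 0"
      using True D_d[of j 0] by (simp add: R_def d_def)
    also have "\<dots> \<doteq> d a * d b"
      using \<open>j \<in> {1..k}\<close> True ab by (intro d_d_cong) auto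
    finally show ?thesis using True by simp
  next
    case False
    then have "R = of_nat i * (d (i - 1) * d j)" by (simp add: R_def)
    also have "\<dots> \<doteq> of_nat i * (d a * d b)"
      using False i j ab by (intro cong_mult d_d_cong) auto
    finally show ?thesis .
  qed
  have S: "of_nat j * (d i * d (j - 1)) \<doteq> of_nat j * (d a * d b)"
  proof (cases "j = 0")
    case False
    then show ?thesis using i j ab by (intro cong_mult d_d_cong) auto
  qed simp
  have 1: "d i * d j * Up = d i * Up * d j + D i * s 1 * d j - of_nat j * (d i * d (j - 1))"
    using d_Up[OF j] k by (simp add: mult.assoc distrib_left right_diff_distrib mult_of_nat_left di)
  have 2: "d i * Up * d j = Up * (d i * d j) + s 1 * (d i * d j) - of_nat i * (d (i - 1) * d j)"
    using d_Up[of i] i k by (simp add: left_diff_distrib distrib_right mult.assoc)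
  have 3: "D i * s 1 * d j = s 1 * (d i * d j) + (if i = 1 then d j else 0)"
    by (simp only: D_s1 distrib_right mult.assoc di) auto
  have "d i * d j * Up = (Up + 2 * s 1) * (d i * d j) - (R + of_nat j * (d i * d (j - 1)))"
    unfolding 1 2 3 R_def by (simp add: distrib_right mult_2)
  moreover have "(Up + 2 * s 1) * (d i * d j) - (R + of_nat j * (d i * d (j - 1)))
      \<doteq> (Up + 2 * s 1) * (d i * d j) - (of_nat i * (d a * d b) + of_nat j * (d a * d b))"
    by (intro cong_diff cong_add R S cong_refl)
  ultimately show ?thesis by (simp only: of_nat_add distrib_right)
qed

text \<open>Now an index is raised, so the left one stays positive and no repair as in
  \<open>d_d_Up\<close> is needed. The coefficients \<open>k - i\<close> and \<open>k - j\<close>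
  add up to a function of \<open>i + j\<close>, and they vanish when the raised index would exceed
  \<open>k\<close>.\<close>

lemma d_d_Um:
  assumes i: "i \<in> {1..k}" and j: "j \<le> k" and ab: "a \<in> {1..k}" "b \<le> k" "a + b = Suc (i + j)"
  shows "d i * d j * Um \<doteq> Um * (d i * d j) + of_nat (2 * k - (i + j)) * (d a * d b)"
proof -
  have "of_nat (k - i) * (d (Suc i) * d j) \<doteq> of_nat (k - i) * (d a * d b)"
    using i j ab by (cases "i = k") (auto intro!: cong_mult d_d_cong)
  moreover have "of_nat (k - j) * (d i * d (Suc j)) \<doteq> of_nat (k - j) * (d a * d b)"
    using i j ab by (cases "j = k") (auto intro!: cong_mult d_d_cong)
  ultimately have "Um * (d i * d j) + (of_nat (k - i) * (d (Suc i) * d j) + of_nat (k - j) * (d i * d (Suc j)))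
      \<doteq> Um * (d i * d j) + (of_nat (k - i) * (d a * d b) + of_nat (k - j) * (d a * d b))"
    by (intro cong_add cong_refl)
  moreover have "d i * d j * Um = Um * (d i * d j) + (of_nat (k - i) * (d (Suc i) * d j) + of_nat (k - j) * (d i * d (Suc j)))"
  proof -
    have "d i * d j * Um = d i * Um * d j + of_nat (k - j) * (d i * d (Suc j))"
      using d_Um[OF j] k by (simp add: mult.assoc distrib_left mult_of_nat_left)
    moreover have "d i * Um * d j = Um * (d i * d j) + of_nat (k - i) * (d (Suc i) * d j)"
      using d_Um[of i] i k by (simp add: distrib_right mult.assoc)
    ultimately show ?thesis by (simp add: algebra_simps)
  qed
  moreover have "of_nat (k - i) * (d a * d b) + of_nat (k - j) * (d a * d b)
      = of_nat (2 * k - (i + j)) * (d a * d b)"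
  proof -
    have "k - i + (k - j) = 2 * k - (i + j)" using i j by simp
    then show ?thesis by (metis distrib_right of_nat_add)
  qed
  ultimately show ?thesis by simp
qed

text \<open>Both products are first moved to the right of the operator; their remainders agree since
  they depend on the common total index, and what is left is a left multiple of the original
  relation. The bounds on \<open>i + j\<close> leave room for a total index one lower or one
  higher.\<close>

lemma generator_mult_in:
  assumes i: "i \<in> {1..k}" "j \<le> k" and i': "i' \<in> {1..k}" "j' \<le> k"
    and eq: "i + j = i' + j'" and sum: "2 \<le> i + j" "i + j < 2 * k"
  shows "(d i * d j - d i' * d j') * Up \<in> I" and "(d i * d j - d i' * d j') * Um \<in> I"
proof -
  have *: "d i * d j \<doteq> d i' * d j'" by (rule d_d_cong[OF i i' eq])
  \<comment> \<open>The left index is taken as large as possible, which keeps the right one at most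
    \<open>k\<close>; \<open>2 \<le> i + j\<close> makes the left one positive.\<close>
  obtain a b where ab: "a \<in> {1..k}" "b \<le> k" "Suc (a + b) = i + j"
    using sum k that[of "min k (i + j - 1)" "i + j - 1 - min k (i + j - 1)"] by auto
  have "d i * d j * Up \<doteq> (Up + 2 * s 1) * (d i * d j) - of_nat (i + j) * (d a * d b)"
    by (rule d_d_Up[OF i ab])
  also have "\<dots> \<doteq> (Up + 2 * s 1) * (d i' * d j') - of_nat (i + j) * (d a * d b)"
    by (intro cong_diff cong_mult * cong_refl)
  also have "\<dots> \<doteq> d i' * d j' * Up"
    using d_d_Up[OF i' ab(1,2)] ab eq by (auto intro: cong_sym)
  finally show "(d i * d j - d i' * d j') * Up \<in> I"
    by (simp add: cong_def left_diff_distrib)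
  obtain a b where ab: "a \<in> {1..k}" "b \<le> k" "a + b = Suc (i + j)"
    using sum k that[of "min k (i + j)" "Suc (i + j) - min k (i + j)"] by auto
  have "d i * d j * Um \<doteq> Um * (d i * d j) + of_nat (2 * k - (i + j)) * (d a * d b)"
    by (rule d_d_Um[OF i ab])
  also have "\<dots> \<doteq> Um * (d i' * d j') + of_nat (2 * k - (i + j)) * (d a * d b)"
    by (intro cong_add cong_mult * cong_refl)
  also have "\<dots> \<doteq> d i' * d j' * Um"
    using d_d_Um[OF i' ab(1,2)] ab eq by (auto intro: cong_sym)
  finally show "(d i * d j - d i' * d j') * Um \<in> I"
    by (simp add: cong_def left_diff_distrib)
qed

lemma A_mult_in:
  assumes "p \<in> {1..k-1}" "q \<in> {2..k}"
  shows "(D p * D q - D (p + 1) * D (q - 1)) * Up \<in> I" and "(D p * D q - D (p + 1) * D (q - 1)) * Um \<in> I"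
proof -
  have *: "D p * D q - D (p + 1) * D (q - 1) = d p * d q - d (p + 1) * d (q - 1)"
    using assms by (simp add: d_def)
  show "(D p * D q - D (p + 1) * D (q - 1)) * Up \<in> I"
    unfolding * by (rule generator_mult_in(1)) (use assms in auto)
  show "(D p * D q - D (p + 1) * D (q - 1)) * Um \<in> I"
    unfolding * by (rule generator_mult_in(2)) (use assms in auto)
qed

lemma T_mult_in:
  assumes "j \<in> {2..k}"
  shows "(D 1 * D (j - 1) + D j * (E + m)) * Up \<in> I" and "(D 1 * D (j - 1) + D j * (E + m)) * Um \<in> I"
proof -
  have *: "D 1 * D (j - 1) + D j * (E + m) = d 1 * d (j - 1) - d j * d 0"
    using assms by (simp add: d_def algebra_simps)
  show "(D 1 * D (j - 1) + D j * (E + m)) * Up \<in> I"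
    unfolding * by (rule generator_mult_in(1)) (use assms in auto)
  show "(D 1 * D (j - 1) + D j * (E + m)) * Um \<in> I"
    unfolding * by (rule generator_mult_in(2)) (use assms in auto)
qed

text \<open>After the exchange, the inner sum over \<open>j\<close> is \<open>U0 * d h\<close>, and
  the outer sum over \<open>h\<close> is evaluated by \<open>sum_weighted_s_d\<close>.\<close>

lemma Um_Up: "Um * Up \<doteq> (U0 + 1) * (U0 + of_nat k * m)"
proof -
  have U0_d: "(\<Sum>j<k. of_nat (Suc j) * (s (Suc j) * (d (Suc j) * d h))) = U0 * d h" for h
  proof -
    have "U0 = (\<Sum>j<k. of_nat (Suc j) * (s (Suc j) * d (Suc j)))"
      by (simp add: W_def d_def sum.atLeast1_atMost_eq)
    then show ?thesis by (simp only: sum_distrib_right mult.assoc)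
  qed
  \<comment> \<open>Moving \<open>U0\<close> to the left of \<open>s h\<close> cancels
    \<open>h\<close> of the \<open>Suc h\<close> copies of \<open>s h * d h\<close>; the remaining
    copy is the summand 1 in \<open>U0 + 1\<close>.\<close>
  have swapped: "s h * (- (U0 * d h) - of_nat (Suc h) * d h) = - ((U0 + 1) * (s h * d h))" if "h < k" for h
  proof -
    have "U0 * s h = s h * U0 + of_nat h * s h"
      using W_s[of h "\<lambda>h. h"] that by (cases "h = 0") (auto simp: s_0)
    then have "U0 * s h * d h = s h * U0 * d h + of_nat h * s h * d h"
      by (simp add: distrib_right)
    then have "s h * (U0 * d h) = U0 * (s h * d h) - of_nat h * (s h * d h)"
      by (simp add: mult.assoc)
    then show ?thesis
      by (simp add: right_diff_distrib distrib_left distrib_right mult_of_nat_left)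
  qed
  have lhs: "Um * Up = (\<Sum>h<k. of_nat (k - h) * (s h *
      (- (\<Sum>j<k. of_nat (Suc j) * (s (Suc j) * (d (Suc h) * d j))) - of_nat (Suc h) * d h)))"
  proof -
    have "Um * Up = (\<Sum>h<k. of_nat (k - h) * (s h * (D (Suc h) * Up)))"
      by (simp add: Um_def d_def sum_distrib_right mult.assoc)
    also have "\<dots> = (\<Sum>h<k. of_nat (k - h) * (s h *
        (- (\<Sum>j<k. of_nat (Suc j) * (s (Suc j) * (d (Suc h) * d j))) - of_nat (Suc h) * d h)))"
      using D_Up_sum by (intro sum.cong) (auto simp: d_def[of "Suc h" for h])
    finally show ?thesis .
  qed
  have rhs: "(\<Sum>h<k. of_nat (k - h) * (s h * (- (U0 * d h) - of_nat (Suc h) * d h)))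
      = (U0 + 1) * (U0 + of_nat k * m)"
  proof -
    have "(\<Sum>h<k. of_nat (k - h) * (s h * (- (U0 * d h) - of_nat (Suc h) * d h)))
        = (\<Sum>h<k. - (U0 + 1) * (of_nat (k - h) * (s h * d h)))"
    proof (rule sum.cong[OF refl])
      fix h assume "h \<in> {..<k}"
      then show "of_nat (k - h) * (s h * (- (U0 * d h) - of_nat (Suc h) * d h))
          = - (U0 + 1) * (of_nat (k - h) * (s h * d h))"
        by (simp only: swapped lessThan_iff mult_of_nat_left mult_minus_left mult_minus_right)
    qed
    also have "\<dots> = - (U0 + 1) * - (of_nat k * m + U0)"
      by (simp only: sum_distrib_left[symmetric] sum_weighted_s_d)
    also have "\<dots> = (U0 + 1) * (U0 + of_nat k * m)"
      by (simp only: minus_mult_minus add.commute)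
    finally show ?thesis .
  qed
  have "(\<Sum>h<k. of_nat (k - h) * (s h *
        (- (\<Sum>j<k. of_nat (Suc j) * (s (Suc j) * (d (Suc h) * d j))) - of_nat (Suc h) * d h)))
      \<doteq> (\<Sum>h<k. of_nat (k - h) * (s h *
        (- (\<Sum>j<k. of_nat (Suc j) * (s (Suc j) * (d (Suc j) * d h))) - of_nat (Suc h) * d h)))"
    by (intro cong_sum cong_mult cong_diff cong_uminus d_d_cong cong_refl) auto
  then show ?thesis
    by (simp only: lhs U0_d rhs)
qed

text \<open>Here \<open>d j\<close> may be \<open>d 0\<close>, so no index can be exchanged while it
  stands on the left. Moving \<open>Um\<close> in front of it puts the positive index
  \<open>Suc h\<close> on the left instead.\<close>

lemma Up_Um: "Up * Um \<doteq> U0 * (U0 + of_nat k * m - 1)"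
proof -
  have *: "d j * Um \<doteq> - (D (Suc j) * (U0 + of_nat k * m - 1))" if j: "j < k" for j
  proof -
    have lhs: "d j * Um = (\<Sum>h<k. of_nat (k - h) * (s h * (d (Suc h) * d j))) + of_nat (k - j) * d (Suc j)"
    proof -
      have "Um * d j = (\<Sum>h<k. of_nat (k - h) * (s h * (d (Suc h) * d j)))"
        by (simp only: Um_def sum_distrib_right mult.assoc)
      then show ?thesis using d_Um[of j] j by simp
    qed
    have "(\<Sum>h<k. of_nat (k - h) * (s h * (d (Suc j) * d h)))
        = (\<Sum>h<k. D (Suc j) * (of_nat (k - h) * (s h * d h)) - (if h = Suc j then of_nat (k - Suc j) * d (Suc j) else 0))"
    proof (rule sum.cong[OF refl])
      fix h assume "h \<in> {..<k}"
      then have "s h * D (Suc j) = D (Suc j) * s h - (if h = Suc j then 1 else 0)"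
        using D_s[of "Suc j" h] j by auto
      then have "s h * D (Suc j) * d h = D (Suc j) * s h * d h - (if h = Suc j then d (Suc j) else 0)"
        by (simp add: left_diff_distrib)
      then have "s h * (D (Suc j) * d h) = D (Suc j) * (s h * d h) - (if h = Suc j then d (Suc j) else 0)"
        by (simp add: mult.assoc)
      then show "of_nat (k - h) * (s h * (d (Suc j) * d h))
          = D (Suc j) * (of_nat (k - h) * (s h * d h)) - (if h = Suc j then of_nat (k - Suc j) * d (Suc j) else 0)"
        by (simp add: d_def[of "Suc j"] mult_of_nat_left right_diff_distrib del: of_nat_diff)
    qed
    \<comment> \<open>If \<open>Suc j = k\<close>, no \<open>h\<close> in the range meets the
      condition, but then the coefficient \<open>k - Suc j\<close> is 0 as well.\<close>
    also have "\<dots> = D (Suc j) * - (of_nat k * m + U0) - of_nat (k - Suc j) * d (Suc j)"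
      unfolding sum_subtractf sum_distrib_left[symmetric] sum_weighted_s_d
      using j by (cases "Suc j = k") auto
    finally have rhs: "(\<Sum>h<k. of_nat (k - h) * (s h * (d (Suc j) * d h)))
        = D (Suc j) * - (of_nat k * m + U0) - of_nat (k - Suc j) * d (Suc j)" .
    have "(\<Sum>h<k. of_nat (k - h) * (s h * (d (Suc h) * d j))) + of_nat (k - j) * d (Suc j)
        \<doteq> (\<Sum>h<k. of_nat (k - h) * (s h * (d (Suc j) * d h))) + of_nat (k - j) * d (Suc j)"
      using j by (intro cong_sum cong_mult cong_add d_d_cong cong_refl) auto
    \<comment> \<open>Moving \<open>d j\<close> past \<open>Um\<close> contributes
      \<open>k - j\<close>, moving \<open>s h\<close> past \<open>D (Suc j)\<close> takes away
      \<open>k - Suc j\<close>; the surplus of one is the \<open>- 1\<close> in the result.\<close>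
    moreover have "D (Suc j) * - (of_nat k * m + U0) - of_nat (k - Suc j) * d (Suc j) + of_nat (k - j) * d (Suc j)
        = - (D (Suc j) * (U0 + of_nat k * m - 1))"
    proof -
      have "k - j = Suc (k - Suc j)" using j by simp
      then have "of_nat (k - j) * d (Suc j) = of_nat (k - Suc j) * d (Suc j) + D (Suc j)"
        by (simp add: d_def distrib_right del: of_nat_diff)
      then show ?thesis
        by (simp add: right_diff_distrib distrib_left del: of_nat_diff)
    qed
    ultimately show ?thesis by (simp only: lhs rhs)
  qed
  have lhs: "Up * Um = - (\<Sum>j<k. of_nat (Suc j) * (s (Suc j) * (d j * Um)))"
    by (simp only: Up_def sum_distrib_right mult.assoc mult_minus_left)
  have rhs: "- (\<Sum>j<k. of_nat (Suc j) * (s (Suc j) * - (D (Suc j) * (U0 + of_nat k * m - 1))))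
      = U0 * (U0 + of_nat k * m - 1)"
  proof -
    have "U0 = (\<Sum>j<k. of_nat (Suc j) * (s (Suc j) * D (Suc j)))"
      by (simp add: W_def sum.atLeast1_atMost_eq)
    then have "U0 * y = (\<Sum>j<k. of_nat (Suc j) * (s (Suc j) * (D (Suc j) * y)))" for y
      by (simp only: sum_distrib_right mult.assoc)
    then show ?thesis
      by (simp add: sum_negf del: of_nat_Suc)
  qed
  have "- (\<Sum>j<k. of_nat (Suc j) * (s (Suc j) * (d j * Um)))
      \<doteq> - (\<Sum>j<k. of_nat (Suc j) * (s (Suc j) * - (D (Suc j) * (U0 + of_nat k * m - 1))))"
    using * by (intro cong_uminus cong_sum cong_mult) simp
  then show ?thesis by (simp only: lhs rhs)
qed

end

section \<open>Differential operators\<close>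

lemma hol_on_subset: "hol_on f W \<Longrightarrow> W' \<subseteq> W \<Longrightarrow> hol_on f W'"
  unfolding hol_on_def by blast

lemma hol_on_cong:
  assumes "open W" "hol_on f W" "\<And>x. x \<in> W \<Longrightarrow> f x = g x"
  shows "hol_on g W"
  unfolding hol_on_def
proof
  fix x assume "x \<in> W"
  obtain f' where f': "(f has_derivative f') (at x)" "\<forall>a v. f' (a *s v) = a * f' v"
    using assms(2) \<open>x \<in> W\<close> unfolding hol_on_def by blast
  have "(g has_derivative f') (at x)"
    by (rule has_derivative_transform_within_open[OF f'(1) assms(1) \<open>x \<in> W\<close> assms(3)])
  with f'(2) show "\<exists>f'. (g has_derivative f') (at x) \<and> (\<forall>a v. f' (a *s v) = a * f' v)"
    by blast
qed

lemma hol_on_const: "hol_on (\<lambda>x. a) W"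
  unfolding hol_on_def by (auto intro!: exI[of _ "\<lambda>v. 0"])

lemma hol_on_coord: "hol_on (\<lambda>x::complex^'n. x $ i) W"
  unfolding hol_on_def
proof
  fix x :: "complex^'n"
  show "\<exists>f'. ((\<lambda>x. x $ i) has_derivative f') (at x) \<and> (\<forall>a v. f' (a *s v) = a * f' v)"
    by (intro exI[of _ "\<lambda>v. v $ i"] conjI bounded_linear_imp_has_derivative bounded_linear_vec_nth) simp
qed

lemma hol_on_add:
  assumes "hol_on f W" "hol_on g W"
  shows "hol_on (\<lambda>x. f x + g x) W"
  unfolding hol_on_def
proof
  fix x assume "x \<in> W"
  obtain f' g' where *: "(f has_derivative f') (at x)" "\<forall>a v. f' (a *s v) = a * f' v"
    "(g has_derivative g') (at x)" "\<forall>a v. g' (a *s v) = a * g' v"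
    using assms \<open>x \<in> W\<close> unfolding hol_on_def by blast
  have "((\<lambda>x. f x + g x) has_derivative (\<lambda>v. f' v + g' v)) (at x)"
    by (intro has_derivative_add *)
  with * show "\<exists>h'. ((\<lambda>x. f x + g x) has_derivative h') (at x) \<and> (\<forall>a v. h' (a *s v) = a * h' v)"
    by (intro exI[of _ "\<lambda>v. f' v + g' v"]) (simp add: distrib_left)
qed

lemma hol_on_mult:
  assumes "hol_on f W" "hol_on g W"
  shows "hol_on (\<lambda>x. f x * g x) W"
  unfolding hol_on_def
proof
  fix x assume "x \<in> W"
  obtain f' g' where *: "(f has_derivative f') (at x)" "\<forall>a v. f' (a *s v) = a * f' v"
    "(g has_derivative g') (at x)" "\<forall>a v. g' (a *s v) = a * g' v"
    using assms \<open>x \<in> W\<close> unfolding hol_on_def by blast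
  have "((\<lambda>x. f x * g x) has_derivative (\<lambda>v. f x * g' v + f' v * g x)) (at x)"
    by (intro has_derivative_mult *)
  with * show "\<exists>h'. ((\<lambda>x. f x * g x) has_derivative h') (at x) \<and> (\<forall>a v. h' (a *s v) = a * h' v)"
    by (intro exI[of _ "\<lambda>v. f x * g' v + f' v * g x"]) (simp add: algebra_simps)
qed

lemma hol_at_field_derivative:
  assumes "hol_on f W" "x \<in> W"
  shows "((\<lambda>z. f (x + axis i z)) has_field_derivative pd i f x) (at 0)"
proof -
  obtain f' where f': "(f has_derivative f') (at x)" "\<And>a v. f' (a *s v) = a * f' v"
    using assms unfolding hol_on_def by blast
  show ?thesis using pd_eq_derivative[OF f'] by simp
qed

lemma axis_0 [simp]: "axis i (0::'a::zero) = 0"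
  by (simp add: vec_eq_iff axis_def)

lemma pd_add:
  assumes "hol_on f W" "hol_on g W" "x \<in> W"
  shows "pd i (\<lambda>x. f x + g x) x = pd i f x + pd i g x"
  using DERIV_add[OF hol_at_field_derivative[OF assms(1,3), of i] hol_at_field_derivative[OF assms(2,3), of i]]
  by (subst pd_def) (simp add: DERIV_imp_deriv)

lemma pd_mult:
  assumes "hol_on f W" "hol_on g W" "x \<in> W"
  shows "pd i (\<lambda>x. f x * g x) x = pd i f x * g x + f x * pd i g x"
  using DERIV_mult[OF hol_at_field_derivative[OF assms(1,3), of i] hol_at_field_derivative[OF assms(2,3), of i]]
  by (subst pd_def) (simp add: DERIV_imp_deriv mult.commute)

lemma pd_const: "pd i (\<lambda>x. a) x = 0"
  unfolding pd_def by simp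

lemma pd_coord: "pd i (\<lambda>x. x $ j) x = (if i = j then 1 else 0)"
proof -
  have "((\<lambda>z. (x + axis i z) $ j) has_field_derivative (if i = j then 1 else 0)) (at 0)"
    by (auto simp: axis_def intro!: derivative_eq_intros)
  then show ?thesis unfolding pd_def by (rule DERIV_imp_deriv)
qed

lemma pd_local:
  assumes "open W" "x \<in> W" "\<And>y. y \<in> W \<Longrightarrow> f y = g y"
  shows "pd i f x = pd i g x"
proof -
  have "((\<lambda>z. x + axis i z) \<longlongrightarrow> x + axis i 0) (nhds 0)"
  proof (rule vec_tendstoI)
    fix j
    have "((\<lambda>z. x $ j + (if j = i then z else 0)) \<longlongrightarrow> x $ j + (if j = i then 0 else 0)) (nhds 0)"
      by (cases "j = i") (auto intro!: tendsto_eq_intros filterlim_ident)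
    then show "((\<lambda>z. (x + axis i z) $ j) \<longlongrightarrow> (x + axis i 0) $ j) (nhds 0)"
      by (simp add: axis_def if_distrib)
  qed
  then have "eventually (\<lambda>z. x + axis i z \<in> W) (nhds 0)"
    using assms(1,2) by (simp add: topological_tendstoD)
  then have "eventually (\<lambda>z. f (x + axis i z) = g (x + axis i z)) (nhds 0)"
    by eventually_elim (rule assms(3))
  then show ?thesis
    unfolding pd_def by (rule deriv_cong_ev) simp
qed

text \<open>The traces of being a differential operator that the ring axioms rely on: preservation
  of holomorphy and locality for composition up to \<open>op_eq\<close>, additivity for
  distributivity in the right factor, homogeneity for the centrality of scalars. Locality matters
  because the functions are total and only their values on \<open>W\<close> are controlled.\<close>

definition hol_operator :: "(complex^'n) set \<Rightarrow> ('n::finite) oper \<Rightarrow> bool" where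
  "hol_operator V P \<longleftrightarrow> (\<forall>W f. open W \<longrightarrow> W \<subseteq> V \<longrightarrow> hol_on f W \<longrightarrow>
     hol_on (P f) W \<and>
     (\<forall>g. (\<forall>x\<in>W. f x = g x) \<longrightarrow> (\<forall>x\<in>W. P f x = P g x)) \<and>
     (\<forall>g. hol_on g W \<longrightarrow> (\<forall>x\<in>W. P (\<lambda>x. f x + g x) x = P f x + P g x)) \<and>
     (\<forall>a. \<forall>x\<in>W. P (\<lambda>x. a * f x) x = a * P f x))"

lemma hol_operatorI:
  assumes "\<And>W f. open W \<Longrightarrow> W \<subseteq> V \<Longrightarrow> hol_on f W \<Longrightarrow> hol_on (P f) W"
    and "\<And>W f g x. open W \<Longrightarrow> W \<subseteq> V \<Longrightarrow> hol_on f W \<Longrightarrow> (\<And>y. y \<in> W \<Longrightarrow> f y = g y) \<Longrightarrow> x \<in> W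
      \<Longrightarrow> P f x = P g x"
    and "\<And>W f g x. open W \<Longrightarrow> W \<subseteq> V \<Longrightarrow> hol_on f W \<Longrightarrow> hol_on g W \<Longrightarrow> x \<in> W
      \<Longrightarrow> P (\<lambda>x. f x + g x) x = P f x + P g x"
    and "\<And>W f a x. open W \<Longrightarrow> W \<subseteq> V \<Longrightarrow> hol_on f W \<Longrightarrow> x \<in> W \<Longrightarrow> P (\<lambda>x. a * f x) x = a * P f x"
  shows "hol_operator V P"
  unfolding hol_operator_def
proof (intro allI impI conjI ballI)
  fix W f assume W: "open W" "W \<subseteq> V" "hol_on f W"
  show "hol_on (P f) W" by (rule assms(1)[OF W])
  show "P f x = P g x" if "\<forall>x\<in>W. f x = g x" "x \<in> W" for g x
    by (rule assms(2)[OF W _ that(2)]) (simp add: that(1))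
  show "P (\<lambda>x. f x + g x) x = P f x + P g x" if "hol_on g W" "x \<in> W" for g x
    by (rule assms(3)[OF W that])
  show "P (\<lambda>x. a * f x) x = a * P f x" if "x \<in> W" for a x
    by (rule assms(4)[OF W that])
qed

lemma
  assumes "hol_operator V P" "open W" "W \<subseteq> V" "hol_on f W"
  shows hol_operator_hol_on: "hol_on (P f) W"
    and hol_operator_local: "(\<And>y. y \<in> W \<Longrightarrow> f y = g y) \<Longrightarrow> x \<in> W \<Longrightarrow> P f x = P g x"
    and hol_operator_add: "hol_on g W \<Longrightarrow> x \<in> W \<Longrightarrow> P (\<lambda>x. f x + g x) x = P f x + P g x"
    and hol_operator_scale: "x \<in> W \<Longrightarrow> P (\<lambda>x. a * f x) x = a * P f x"
proof -
  have *: "hol_on (P f) W \<and>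
     (\<forall>g. (\<forall>x\<in>W. f x = g x) \<longrightarrow> (\<forall>x\<in>W. P f x = P g x)) \<and>
     (\<forall>g. hol_on g W \<longrightarrow> (\<forall>x\<in>W. P (\<lambda>x. f x + g x) x = P f x + P g x)) \<and>
     (\<forall>a. \<forall>x\<in>W. P (\<lambda>x. a * f x) x = a * P f x)"
    by (rule assms(1)[unfolded hol_operator_def, THEN spec, THEN spec, THEN mp, THEN mp, THEN mp, OF assms(2-4)])
  show "hol_on (P f) W" by (rule conjunct1[OF *])
  show "P f x = P g x" if "\<And>y. y \<in> W \<Longrightarrow> f y = g y" "x \<in> W"
    by (rule conjunct1[OF conjunct2[OF *], THEN spec, THEN mp, THEN bspec]) (simp_all add: that)
  show "P (\<lambda>x. f x + g x) x = P f x + P g x" if "hol_on g W" "x \<in> W"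
    by (rule conjunct1[OF conjunct2[OF conjunct2[OF *]], THEN spec, THEN mp, THEN bspec, OF that])
  show "P (\<lambda>x. a * f x) x = a * P f x" if "x \<in> W"
    by (rule conjunct2[OF conjunct2[OF conjunct2[OF *]], THEN spec, THEN bspec, OF that])
qed

lemma diffop_alg_hol_operator:
  fixes P :: "('n::finite) oper"
  shows "P \<in> diffop_alg V \<Longrightarrow> hol_operator V P"
proof (induction rule: diffop_alg.induct)
  case (mult g)
  then show ?case
    by (intro hol_operatorI)
      (auto simp: mult_op_def algebra_simps intro: hol_on_mult hol_on_subset)
next
  case (partial i)
  show ?case
  proof (rule hol_operatorI)
    fix W f a and x :: "complex^'n" assume *: "open W" "hol_on f W" "x \<in> W"
    show "pd i (\<lambda>x. a * f x) x = a * pd i f x"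
      using pd_mult[OF hol_on_const *(2,3), of i a] by (simp add: pd_const)
  qed (auto intro: hol_on_pd pd_local pd_add)
next
  case (sum P Q)
  show ?case
  proof (rule hol_operatorI)
    fix W f assume "open W" "W \<subseteq> V" "hol_on f W"
    then show "hol_on ((P + Q) f) W"
      using hol_on_add[OF sum.IH[THEN hol_operator_hol_on]] by (simp add: plus_fun_def)
  next
    fix W f g x assume "open W" "W \<subseteq> V" "hol_on f W" "\<And>y. y \<in> W \<Longrightarrow> f y = g y" "x \<in> W"
    then show "(P + Q) f x = (P + Q) g x"
      using sum.IH[THEN hol_operator_local, of W f g x] by simp
  next
    fix W f g x assume "open W" "W \<subseteq> V" "hol_on f W" "hol_on g W" "x \<in> W"
    then show "(P + Q) (\<lambda>x. f x + g x) x = (P + Q) f x + (P + Q) g x"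
      using sum.IH[THEN hol_operator_add, of W f g x] by simp
  next
    fix W f a x assume "open W" "W \<subseteq> V" "hol_on f W" "x \<in> W"
    then show "(P + Q) (\<lambda>x. a * f x) x = a * (P + Q) f x"
      using sum.IH[THEN hol_operator_scale, of W f x a] by (simp add: distrib_left)
  qed
next
  case (comp P Q)
  note Q = comp.IH(2)[THEN hol_operator_hol_on]
  show ?case
  proof (rule hol_operatorI)
    fix W f assume "open W" "W \<subseteq> V" "hol_on f W"
    then show "hol_on ((P \<circ> Q) f) W"
      using Q comp.IH(1)[THEN hol_operator_hol_on] by simp
  next
    fix W f g x assume *: "open W" "W \<subseteq> V" "hol_on f W" "\<And>y. y \<in> W \<Longrightarrow> f y = g y" "x \<in> W"
    have "Q f y = Q g y" if "y \<in> W" for y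
      using comp.IH(2)[THEN hol_operator_local, of W f g y] * that by simp
    then show "(P \<circ> Q) f x = (P \<circ> Q) g x"
      using comp.IH(1)[THEN hol_operator_local, of W "Q f" "Q g" x] * Q[of W f] by simp
  next
    fix W f g x assume *: "open W" "W \<subseteq> V" "hol_on f W" "hol_on g W" "x \<in> W"
    have "Q (\<lambda>x. f x + g x) y = Q f y + Q g y" if "y \<in> W" for y
      using comp.IH(2)[THEN hol_operator_add, of W f g y] * that by simp
    \<comment> \<open>The two arguments of \<open>P\<close> agree on \<open>W\<close> only, so its
      locality has to be used before its additivity.\<close>
    then have "P (Q (\<lambda>x. f x + g x)) x = P (\<lambda>x. Q f x + Q g x) x"
      using comp.IH(1)[THEN hol_operator_local, of W "Q (\<lambda>x. f x + g x)" "\<lambda>x. Q f x + Q g x" x]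
        * Q[of W "\<lambda>x. f x + g x"] by (simp add: hol_on_add)
    then show "(P \<circ> Q) (\<lambda>x. f x + g x) x = (P \<circ> Q) f x + (P \<circ> Q) g x"
      using comp.IH(1)[THEN hol_operator_add, of W "Q f" "Q g" x] * Q[of W f] Q[of W g] by simp
  next
    fix W f a x assume *: "open W" "W \<subseteq> V" "hol_on f W" "x \<in> W"
    have "Q (\<lambda>x. a * f x) y = a * Q f y" if "y \<in> W" for y
      using comp.IH(2)[THEN hol_operator_scale, of W f y a] * that by simp
    then have "P (Q (\<lambda>x. a * f x)) x = P (\<lambda>x. a * Q f x) x"
      using comp.IH(1)[THEN hol_operator_local, of W "Q (\<lambda>x. a * f x)" "\<lambda>x. a * Q f x" x]
        * Q[of W "\<lambda>x. a * f x"] by (simp add: hol_on_mult hol_on_const)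
    then show "(P \<circ> Q) (\<lambda>x. a * f x) x = a * (P \<circ> Q) f x"
      using comp.IH(1)[THEN hol_operator_scale, of W "Q f" x a] * Q[of W f] by simp
  qed
qed

section \<open>Equality of operators and closure properties of \<open>DN\<close>\<close>

lemma op_eq_refl [simp]: "op_eq V P P"
  by (simp add: op_eq_def)

lemma op_eq_sym: "op_eq V P Q \<Longrightarrow> op_eq V Q P"
  by (simp add: op_eq_def)

lemma op_eq_trans: "op_eq V P Q \<Longrightarrow> op_eq V Q R \<Longrightarrow> op_eq V P R"
  by (simp add: op_eq_def)

lemma op_eq_subset: "op_eq V P Q \<Longrightarrow> V' \<subseteq> V \<Longrightarrow> op_eq V' P Q"
  by (auto simp: op_eq_def)

lemma op_eq_add: "op_eq V P Q \<Longrightarrow> op_eq V P' Q' \<Longrightarrow> op_eq V (P + P') (Q + Q')"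
  by (simp add: op_eq_def)

lemma op_eq_diff: "op_eq V P Q \<Longrightarrow> op_eq V P' Q' \<Longrightarrow> op_eq V (P - P') (Q - Q')"
  by (simp add: op_eq_def)

lemma op_eqD: "op_eq V P Q \<Longrightarrow> open W \<Longrightarrow> hol_on f W \<Longrightarrow> x \<in> W \<Longrightarrow> x \<in> V \<Longrightarrow> P f x = Q f x"
  unfolding op_eq_def hol_at_def by blast

lemma op_eqI:
  assumes "open V" "\<And>W f x. open W \<Longrightarrow> W \<subseteq> V \<Longrightarrow> hol_on f W \<Longrightarrow> x \<in> W \<Longrightarrow> P f x = Q f x"
  shows "op_eq V P Q"
  unfolding op_eq_def hol_at_def
proof (intro ballI allI impI)
  fix x f assume "x \<in> V" "\<exists>W. open W \<and> x \<in> W \<and> hol_on f W"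
  then obtain W where "open W" "x \<in> W" "hol_on f W" by blast
  then show "P f x = Q f x"
    using assms(2)[of "W \<inter> V" f x] \<open>x \<in> V\<close> assms(1) hol_on_subset[of f W "W \<inter> V"] by auto
qed

lemma diffop_alg_subset: "P \<in> diffop_alg V \<Longrightarrow> V' \<subseteq> V \<Longrightarrow> P \<in> diffop_alg V'"
  by (induction rule: diffop_alg.induct) (auto intro: diffop_alg.intros hol_on_subset)

lemma DN_hol_operator:
  assumes P: "P \<in> DN V"
  shows "hol_operator V P"
proof -
  \<comment> \<open>Around each point \<open>P\<close> can be traded for an operator of the
    generated algebra; each clause below is checked on such a neighbourhood.\<close>
  have *: "\<exists>W' Q. open W' \<and> x \<in> W' \<and> W' \<subseteq> W \<and> hol_operator W' Q \<and> op_eq W' P Q"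
    if W: "open W" "W \<subseteq> V" "x \<in> W" for W x
  proof -
    obtain V' Q where V': "open V'" "x \<in> V'" "Q \<in> diffop_alg V'" "op_eq V' P Q"
      using P W unfolding DN_def by blast
    then have "hol_operator (V' \<inter> W) Q" "op_eq (V' \<inter> W) P Q"
      by (auto intro: diffop_alg_hol_operator diffop_alg_subset op_eq_subset)
    then show ?thesis using V' W by (intro exI[of _ "V' \<inter> W"] exI[of _ Q]) auto
  qed
  show ?thesis
  proof (rule hol_operatorI)
    fix W f assume W: "open W" "W \<subseteq> V" "hol_on f W"
    show "hol_on (P f) W"
      unfolding hol_on_def
    proof
      fix x assume "x \<in> W"
      obtain W' Q where W': "open W'" "x \<in> W'" "W' \<subseteq> W" "hol_operator W' Q" "op_eq W' P Q"
        using *[OF W(1,2) \<open>x \<in> W\<close>] by blast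
      have f: "hol_on f W'" using W(3) W'(3) by (rule hol_on_subset)
      have "hol_on (P f) W'"
        using hol_on_cong[OF W'(1) hol_operator_hol_on[OF W'(4,1) subset_refl f]]
          op_eqD[OF op_eq_sym[OF W'(5)] W'(1) f] by blast
      then show "\<exists>f'. (P f has_derivative f') (at x) \<and> (\<forall>a v. f' (a *s v) = a * f' v)"
        using W'(2) unfolding hol_on_def by blast
    qed
  next
    fix W f g x assume W: "open W" "W \<subseteq> V" "hol_on f W" "\<And>y. y \<in> W \<Longrightarrow> f y = g y" "x \<in> W"
    obtain W' Q where W': "open W'" "x \<in> W'" "W' \<subseteq> W" "hol_operator W' Q" "op_eq W' P Q"
      using *[OF W(1,2,5)] by blast
    have f: "hol_on f W'" "hol_on g W'"
      using W W' hol_on_cong[OF W(1,3,4)] by (auto intro: hol_on_subset)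
    have "Q f x = Q g x"
      by (rule hol_operator_local[OF W'(4,1) subset_refl f(1)]) (use W W' in auto)
    then show "P f x = P g x"
      using op_eqD[OF W'(5,1) f(1) W'(2,2)] op_eqD[OF W'(5,1) f(2) W'(2,2)] by simp
  next
    fix W f g x assume W: "open W" "W \<subseteq> V" "hol_on f W" "hol_on g W" "x \<in> W"
    obtain W' Q where W': "open W'" "x \<in> W'" "W' \<subseteq> W" "hol_operator W' Q" "op_eq W' P Q"
      using *[OF W(1,2,5)] by blast
    have f: "hol_on f W'" "hol_on g W'"
      using W W' by (auto intro: hol_on_subset)
    show "P (\<lambda>x. f x + g x) x = P f x + P g x"
      using op_eqD[OF W'(5,1) f(1) W'(2,2)] op_eqD[OF W'(5,1) f(2) W'(2,2)]
        op_eqD[OF W'(5,1) hol_on_add[OF f] W'(2,2)]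
        hol_operator_add[OF W'(4,1) subset_refl f W'(2)] by simp
  next
    fix W f a x assume W: "open W" "W \<subseteq> V" "hol_on f W" "x \<in> W"
    obtain W' Q where W': "open W'" "x \<in> W'" "W' \<subseteq> W" "hol_operator W' Q" "op_eq W' P Q"
      using *[OF W(1,2,4)] by blast
    have f: "hol_on f W'"
      using W W' by (auto intro: hol_on_subset)
    show "P (\<lambda>x. a * f x) x = a * P f x"
      using op_eqD[OF W'(5,1) f W'(2,2)] 
        op_eqD[OF W'(5,1) hol_on_mult[OF hol_on_const f] W'(2,2), of a]
        hol_operator_scale[OF W'(4,1) subset_refl f W'(2), of a] by simp
  qed
qed

lemma DN_subset: "P \<in> DN V \<Longrightarrow> V' \<subseteq> V \<Longrightarrow> P \<in> DN V'"
  unfolding DN_def by blast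

lemma DN_UNIV: "P \<in> DN UNIV \<Longrightarrow> P \<in> DN V"
  by (rule DN_subset) auto

lemma DN_pd: "pd i \<in> DN V"
  unfolding DN_def by (blast intro: open_UNIV diffop_alg.partial op_eq_refl)

lemma DN_mult_op: "hol_on g UNIV \<Longrightarrow> mult_op g \<in> DN V"
  unfolding DN_def by (blast intro: open_UNIV diffop_alg.mult op_eq_refl)

lemma DN_scalar_op: "scalar_op a \<in> DN V"
  unfolding scalar_op_def by (intro DN_mult_op hol_on_const)

lemma DN_cong:
  assumes "open V" "op_eq V P Q" "P \<in> DN V"
  shows "Q \<in> DN V"
  unfolding DN_def
proof (intro CollectI ballI)
  fix x assume "x \<in> V"
  then obtain V' R where "open V'" "x \<in> V'" "R \<in> diffop_alg V'" "op_eq V' P R"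
    using assms(3) unfolding DN_def by blast
  then show "\<exists>V. open V \<and> x \<in> V \<and> (\<exists>R\<in>diffop_alg V. op_eq V Q R)"
    using assms \<open>x \<in> V\<close>
    by (intro exI[of _ "V' \<inter> V"] conjI bexI[of _ R])
      (auto intro: diffop_alg_subset op_eq_trans[OF op_eq_sym] op_eq_subset)
qed

lemma DN_locally:
  assumes "\<And>x. x \<in> V \<Longrightarrow> \<exists>V'. open V' \<and> x \<in> V' \<and> P \<in> DN V'"
  shows "P \<in> DN V"
  using assms unfolding DN_def by blast

text \<open>\<open>P' f\<close> and \<open>Q' f\<close> agree on \<open>W\<close> but may differ
  elsewhere, so locality of \<open>P\<close> is what makes composition compatible with
  \<open>op_eq\<close>.\<close>

lemma op_eq_comp:
  assumes "open V" "op_eq V P Q" "op_eq V P' Q'" "P \<in> DN V" "P' \<in> DN V"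
  shows "op_eq V (P \<circ> P') (Q \<circ> Q')"
proof (rule op_eqI[OF assms(1)])
  fix W f x assume W: "open W" "W \<subseteq> V" "hol_on f W" "x \<in> W"
  have eq: "P' f y = Q' f y" if "y \<in> W" for y
    using op_eqD[OF assms(3) W(1,3) that] that W(2) by auto
  have hol: "hol_on (P' f) W"
    by (rule hol_operator_hol_on[OF DN_hol_operator[OF assms(5)] W(1-3)])
  then have hol': "hol_on (Q' f) W"
    by (rule hol_on_cong[OF W(1) _ eq])
  have "P (P' f) x = P (Q' f) x"
    by (rule hol_operator_local[OF DN_hol_operator[OF assms(4)] W(1,2) hol eq W(4)])
  also have "\<dots> = Q (Q' f) x"
    using op_eqD[OF assms(2) W(1) hol' W(4)] W by auto
  finally show "(P \<circ> P') f x = (Q \<circ> Q') f x" by simp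
qed

text \<open>Sum and composition share one argument: intersect the two neighbourhoods and combine the
  local representatives.\<close>

lemma DN_binary:
  assumes "P \<in> DN V" "Q \<in> DN V" "open V"
    and op: "\<And>V P' Q'. P' \<in> diffop_alg V \<Longrightarrow> Q' \<in> diffop_alg V \<Longrightarrow> h P' Q' \<in> diffop_alg V"
    and cong: "\<And>V' P' Q'. open V' \<Longrightarrow> V' \<subseteq> V \<Longrightarrow> op_eq V' P P' \<Longrightarrow> op_eq V' Q Q' \<Longrightarrow>
      op_eq V' (h P Q) (h P' Q')"
  shows "h P Q \<in> DN V"
  unfolding DN_def
proof (intro CollectI ballI)
  fix x assume "x \<in> V"
  obtain V1 P' where 1: "open V1" "x \<in> V1" "P' \<in> diffop_alg V1" "op_eq V1 P P'"
    using assms(1) \<open>x \<in> V\<close> unfolding DN_def by blast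
  obtain V2 Q' where 2: "open V2" "x \<in> V2" "Q' \<in> diffop_alg V2" "op_eq V2 Q Q'"
    using assms(2) \<open>x \<in> V\<close> unfolding DN_def by blast
  let ?V = "V1 \<inter> V2 \<inter> V"
  have "P' \<in> diffop_alg ?V" "Q' \<in> diffop_alg ?V" "op_eq ?V P P'" "op_eq ?V Q Q'"
    using 1 2 by (auto intro: diffop_alg_subset op_eq_subset)
  then show "\<exists>V. open V \<and> x \<in> V \<and> (\<exists>R\<in>diffop_alg V. op_eq V (h P Q) R)"
    using 1 2 \<open>x \<in> V\<close> assms(3) op[of P' ?V Q'] cong[of ?V P' Q']
    by (intro exI[of _ ?V]) auto
qed

lemma DN_add: "P \<in> DN V \<Longrightarrow> Q \<in> DN V \<Longrightarrow> open V \<Longrightarrow> P + Q \<in> DN V"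
  by (rule DN_binary[where h="(+)"]) (auto intro: diffop_alg.sum op_eq_add)

lemma DN_comp:
  assumes "P \<in> DN V" "Q \<in> DN V" "open V"
  shows "P \<circ> Q \<in> DN V"
proof (rule DN_binary[where h="(\<circ>)", OF assms])
  fix V' P' Q' assume "open V'" "V' \<subseteq> V" "op_eq V' P P'" "op_eq V' Q Q'"
  then show "op_eq V' (P \<circ> Q) (P' \<circ> Q')"
    using assms(1,2)[THEN DN_subset] by (intro op_eq_comp)
qed (rule diffop_alg.comp)

lemma zero_op_eq: "(0 :: ('n::finite) oper) = scalar_op 0"
  by (simp add: fun_eq_iff scalar_op_def mult_op_def)

text \<open>\<open>diffop_alg\<close> is generated without subtraction, so differences are built
  from the multiplication operator by -1.\<close>

lemma diff_op_eq: "P - Q = P + (scalar_op (- 1) \<circ> (Q :: ('n::finite) oper))"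
  by (simp add: fun_eq_iff scalar_op_def mult_op_def)

lemma uminus_op_eq: "- Q = scalar_op (- 1) \<circ> (Q :: ('n::finite) oper)"
  by (simp add: fun_eq_iff scalar_op_def mult_op_def)

lemma DN_zero: "0 \<in> DN V"
  unfolding zero_op_eq by (rule DN_scalar_op)

lemma DN_diff: "P \<in> DN V \<Longrightarrow> Q \<in> DN V \<Longrightarrow> open V \<Longrightarrow> P - Q \<in> DN V"
  unfolding diff_op_eq by (intro DN_add DN_comp DN_scalar_op)

lemma DN_uminus: "Q \<in> DN V \<Longrightarrow> open V \<Longrightarrow> - Q \<in> DN V"
  unfolding uminus_op_eq by (intro DN_comp DN_scalar_op)

lemma DN_sum: "(\<And>i. i \<in> S \<Longrightarrow> f i \<in> DN V) \<Longrightarrow> open V \<Longrightarrow> sum f S \<in> DN V"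
  by (induction S rule: infinite_finite_induct) (auto intro: DN_zero DN_add)

lemma comp_add_left: "(P + Q) \<circ> R = (P \<circ> R) + (Q \<circ> (R :: ('n::finite) oper))"
  by (simp add: fun_eq_iff)

lemma comp_diff_left: "(P - Q) \<circ> R = (P \<circ> R) - (Q \<circ> (R :: ('n::finite) oper))"
  by (simp add: fun_eq_iff)

text \<open>In contrast to the left factor, this holds only up to \<open>op_eq\<close>: it is
  additivity of \<open>P\<close> on holomorphic functions.\<close>

lemma comp_add_right:
  assumes "open V" "P \<in> DN V" "Q \<in> DN V" "R \<in> DN V"
  shows "op_eq V (P \<circ> (Q + R)) ((P \<circ> Q) + (P \<circ> R))"
proof (rule op_eqI[OF assms(1)])
  fix W f x assume W: "open W" "W \<subseteq> V" "hol_on f W" "x \<in> W"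
  have "hol_on (Q f) W" "hol_on (R f) W"
    using assms(3,4)[THEN DN_hol_operator] W by (auto intro: hol_operator_hol_on)
  from hol_operator_add[OF DN_hol_operator[OF assms(2)] W(1,2) this W(4)]
  show "(P \<circ> (Q + R)) f x = ((P \<circ> Q) + (P \<circ> R)) f x"
    by (simp add: plus_fun_def)
qed

lemma comp_scalar:
  assumes "open V" "P \<in> DN V"
  shows "op_eq V (P \<circ> scalar_op a) (scalar_op a \<circ> P)"
proof (rule op_eqI[OF assms(1)])
  fix W f x assume W: "open W" "W \<subseteq> V" "hol_on f W" "x \<in> W"
  from hol_operator_scale[OF DN_hol_operator[OF assms(2)] this]
  show "(P \<circ> scalar_op a) f x = (scalar_op a \<circ> P) f x"
    by (simp add: scalar_op_def mult_op_def)
qed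

lemma comp_diff_right:
  assumes "open V" "P \<in> DN V" "Q \<in> DN V" "R \<in> DN V"
  shows "op_eq V (P \<circ> (Q - R)) ((P \<circ> Q) - (P \<circ> R))"
proof -
  have 1: "op_eq V (P \<circ> (Q + (scalar_op (- 1) \<circ> R))) ((P \<circ> Q) + (P \<circ> (scalar_op (- 1) \<circ> R)))"
    by (intro comp_add_right DN_comp DN_scalar_op assms)
  have "op_eq V ((P \<circ> scalar_op (- 1)) \<circ> R) ((scalar_op (- 1) \<circ> P) \<circ> R)"
    by (intro op_eq_comp comp_scalar op_eq_refl DN_comp DN_scalar_op assms)
  then have 2: "op_eq V (P \<circ> (scalar_op (- 1) \<circ> R)) (scalar_op (- 1) \<circ> (P \<circ> R))"
    by (simp only: comp_assoc)
  show ?thesis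
    unfolding diff_op_eq by (rule op_eq_trans[OF 1 op_eq_add[OF op_eq_refl 2]])
qed

\<comment> \<open>The ring of global differential operators, in which the abstract Weyl algebra is
  interpreted. The relation is partial because composition and right distributivity are controlled
  only on \<open>DN\<close>.\<close>
quotient_type (overloaded) 'n diff_op = "('n::finite) oper" /
  partial: "\<lambda>P Q. P \<in> DN UNIV \<and> Q \<in> DN UNIV \<and> op_eq UNIV P Q"
proof (rule part_equivpI)
  show "\<exists>P :: ('n::finite) oper. P \<in> DN UNIV \<and> P \<in> DN UNIV \<and> op_eq UNIV P P"
    using DN_zero by auto
qed (auto simp: symp_def transp_def intro: op_eq_sym op_eq_trans)

instantiation diff_op :: (finite) ring_1
begin

lift_definition zero_diff_op :: "'a diff_op" is 0 by (simp add: DN_zero)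
lift_definition one_diff_op :: "'a diff_op" is "scalar_op 1" by (simp add: DN_scalar_op)
lift_definition plus_diff_op :: "'a diff_op \<Rightarrow> 'a diff_op \<Rightarrow> 'a diff_op" is "(+)"
  by (auto intro: DN_add op_eq_add)
lift_definition minus_diff_op :: "'a diff_op \<Rightarrow> 'a diff_op \<Rightarrow> 'a diff_op" is "(-)"
  by (auto intro: DN_diff op_eq_diff)
lift_definition uminus_diff_op :: "'a diff_op \<Rightarrow> 'a diff_op" is uminus
  by (auto intro: DN_uminus simp: op_eq_def)
lift_definition times_diff_op :: "'a diff_op \<Rightarrow> 'a diff_op \<Rightarrow> 'a diff_op" is "(\<circ>)"
  by (auto intro: DN_comp op_eq_comp)

instance
proof
  fix a b c :: "'a diff_op"
  show "a + b + c = a + (b + c)" "a + b = b + a" "0 + a = a" "- a + a = 0" "a - b = a + - b"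
    by (transfer; auto simp: DN_add DN_zero DN_diff DN_uminus algebra_simps)+
  show "a * b * c = a * (b * c)"
    by transfer (auto simp: DN_comp comp_assoc)
  show "1 * a = a"
    by transfer (auto simp: DN_comp DN_scalar_op scalar_op_def mult_op_def comp_def)
  show "a * 1 = a"
    by transfer (auto simp: DN_comp DN_scalar_op scalar_op_def mult_op_def comp_def)
  show "(a + b) * c = a * c + b * c"
    by transfer (auto simp: DN_comp DN_add comp_add_left)
  show "a * (b + c) = a * b + a * c"
    by transfer (auto simp: DN_comp DN_add intro: comp_add_right)
  show "(0::'a diff_op) \<noteq> 1"
  proof (transfer, clarsimp)
    assume "op_eq UNIV (0 :: 'a oper) (scalar_op 1)"
    from op_eqD[OF this open_UNIV hol_on_const[of 1], of 0] show False
      by (simp add: scalar_op_def mult_op_def)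
  qed
qed

end

section \<open>Ideal sheaves and right multiplication\<close>

lemma comp_zero_right:
  assumes "open V" "S \<in> DN V"
  shows "op_eq V (S \<circ> 0) 0"
proof (rule op_eqI[OF assms(1)])
  fix W and f :: "complex^'a \<Rightarrow> complex" and x assume W: "open W" "W \<subseteq> V" "hol_on f W" "x \<in> W"
  have "S (\<lambda>x. 0 * f x) x = 0 * S f x"
    by (rule hol_operator_scale[OF DN_hol_operator[OF assms(2)] W])
  then show "(S \<circ> 0) f x = 0 f x" by (simp add: zero_fun_def)
qed

lemma comp_sum_right:
  assumes "open V" "S \<in> DN V" "finite F" "\<And>A. A \<in> F \<Longrightarrow> h A \<in> DN V"
  shows "op_eq V (S \<circ> (\<Sum>A\<in>F. h A)) (\<Sum>A\<in>F. S \<circ> h A)"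
  using assms(3,4)
proof (induction F)
  case empty
  then show ?case using comp_zero_right[OF assms(1,2)] by (simp only: sum.empty)
next
  case (insert A F)
  have hA: "h A \<in> DN V" and hF: "\<And>B. B \<in> F \<Longrightarrow> h B \<in> DN V"
    using insert.prems by auto
  show ?case
    unfolding sum.insert[OF insert.hyps]
    by (rule op_eq_trans[OF comp_add_right[OF assms(1,2) hA DN_sum[OF hF assms(1)]]
          op_eq_add[OF op_eq_refl insert.IH[OF hF]]])
qed

text \<open>A sheaf of left ideals given on representatives. Closure under \<open>op_eq\<close>
  makes the choice of representative harmless, and since restricting a section keeps the operator,
  glueing concerns one operator \<open>P\<close> that belongs locally.\<close>

locale ideal_sheaf =
  fixes J :: "('n::finite) ideal_sheaf"
  assumes in_DN: "P \<in> J U \<Longrightarrow> P \<in> DN U"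
    and cong: "\<lbrakk>open U; op_eq U P Q; P \<in> J U\<rbrakk> \<Longrightarrow> Q \<in> J U"
    and zero: "open U \<Longrightarrow> 0 \<in> J U"
    and add: "\<lbrakk>open U; P \<in> J U; Q \<in> J U\<rbrakk> \<Longrightarrow> P + Q \<in> J U"
    and mult: "\<lbrakk>open U; R \<in> DN U; P \<in> J U\<rbrakk> \<Longrightarrow> R \<circ> P \<in> J U"
    and restrict: "\<lbrakk>open U; open V; V \<subseteq> U; P \<in> J U\<rbrakk> \<Longrightarrow> P \<in> J V"
    and glue: "\<lbrakk>open U; \<And>x. x \<in> U \<Longrightarrow> \<exists>V. open V \<and> x \<in> V \<and> V \<subseteq> U \<and> P \<in> J V\<rbrakk> \<Longrightarrow> P \<in> J U"
begin

lemma uminus: "open U \<Longrightarrow> P \<in> J U \<Longrightarrow> - P \<in> J U"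
  unfolding uminus_op_eq by (intro mult DN_scalar_op)

lemma sum: "open U \<Longrightarrow> (\<And>A. A \<in> F \<Longrightarrow> h A \<in> J U) \<Longrightarrow> sum h F \<in> J U"
  by (induction F rule: infinite_finite_induct) (auto intro: zero add)

lemma comp_scalar_in:
  assumes "open U" "P \<in> J U"
  shows "P \<circ> scalar_op a \<in> J U"
  using cong[OF assms(1) op_eq_sym[OF comp_scalar[OF assms(1) in_DN[OF assms(2)]]]]
    mult[OF assms(1) DN_scalar_op assms(2)] by blast

end

lemma left_ideal_ideal_sheaf:
  fixes G :: "('n::finite) oper set"
  assumes G: "G \<subseteq> DN UNIV"
  shows "ideal_sheaf (left_ideal G)"
proof
  fix P and U :: "(complex^'n) set"
  assume "P \<in> left_ideal G U"
  then show "P \<in> DN U" by (simp add: left_ideal_def)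
next
  fix P Q and U :: "(complex^'n) set"
  assume U: "open U" "op_eq U P Q" and P: "P \<in> left_ideal G U"
  show "Q \<in> left_ideal G U"
    unfolding left_ideal_def
  proof (intro CollectI conjI ballI)
    show "Q \<in> DN U" using U P by (auto simp: left_ideal_def intro: DN_cong)
    fix x assume "x \<in> U"
    then obtain V F R where "open V" "x \<in> V" "V \<subseteq> U" "finite F" "F \<subseteq> G" "\<forall>A\<in>F. R A \<in> DN V"
      "op_eq V P (\<Sum>A\<in>F. R A \<circ> A)"
      using P unfolding left_ideal_def by blast
    moreover from this have "op_eq V Q (\<Sum>A\<in>F. R A \<circ> A)"
      using U(2) op_eq_trans op_eq_sym op_eq_subset by blast
    ultimately show "\<exists>V. open V \<and> x \<in> V \<and> V \<subseteq> U \<and>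
      (\<exists>F R. finite F \<and> F \<subseteq> G \<and> (\<forall>A\<in>F. R A \<in> DN V) \<and> op_eq V Q (\<Sum>A\<in>F. R A \<circ> A))"
      by blast
  qed
next
  fix U :: "(complex^'n) set" assume U: "open U"
  have *: "\<exists>F R. finite F \<and> F \<subseteq> G \<and> (\<forall>A\<in>F. R A \<in> DN U) \<and> op_eq U 0 (\<Sum>A\<in>F. R A \<circ> A)"
    by (auto intro!: exI[of _ "{}"])
  show "0 \<in> left_ideal G U"
    unfolding left_ideal_def by (intro CollectI conjI ballI DN_zero exI[of _ U] U subset_refl *)
next
  fix P Q and U :: "(complex^'n) set"
  assume U: "open U" and P: "P \<in> left_ideal G U" and Q: "Q \<in> left_ideal G U"
  show "P + Q \<in> left_ideal G U"
    unfolding left_ideal_def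
  proof (intro CollectI conjI ballI)
    show "P + Q \<in> DN U" using U P Q by (auto simp: left_ideal_def intro: DN_add)
    fix x assume "x \<in> U"
    obtain V1 F1 R1 where 1: "open V1" "x \<in> V1" "V1 \<subseteq> U" "finite F1" "F1 \<subseteq> G" "\<forall>A\<in>F1. R1 A \<in> DN V1"
      "op_eq V1 P (\<Sum>A\<in>F1. R1 A \<circ> A)"
      using P \<open>x \<in> U\<close> unfolding left_ideal_def by blast
    obtain V2 F2 R2 where 2: "open V2" "x \<in> V2" "V2 \<subseteq> U" "finite F2" "F2 \<subseteq> G" "\<forall>A\<in>F2. R2 A \<in> DN V2"
      "op_eq V2 Q (\<Sum>A\<in>F2. R2 A \<circ> A)"
      using Q \<open>x \<in> U\<close> unfolding left_ideal_def by blast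
    \<comment> \<open>A generator occurring in both combinations receives the sum of its two
      coefficients.\<close>
    define R where "R A = (if A \<in> F1 then R1 A else 0) + (if A \<in> F2 then R2 A else 0)" for A
    let ?V = "V1 \<inter> V2" and ?F = "F1 \<union> F2"
    have "(\<Sum>A\<in>?F. R A \<circ> A) = (\<Sum>A\<in>?F. (if A \<in> F1 then R1 A \<circ> A else 0) + (if A \<in> F2 then R2 A \<circ> A else 0))"
      by (intro sum.cong) (auto simp: R_def comp_add_left zero_fun_def fun_eq_iff)
    also have "\<dots> = (\<Sum>A\<in>F1. R1 A \<circ> A) + (\<Sum>A\<in>F2. R2 A \<circ> A)"
      using 1(4) 2(4) unfolding sum.distrib
      by (simp flip: sum.inter_restrict add: Int_absorb1 Int_absorb2)
    finally have "op_eq ?V (P + Q) (\<Sum>A\<in>?F. R A \<circ> A)"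
      using 1(7) 2(7) by (auto intro!: op_eq_add elim: op_eq_subset)
    moreover have "\<forall>A\<in>?F. R A \<in> DN ?V"
      unfolding R_def using 1 2 by (auto intro!: DN_add DN_zero elim: DN_subset)
    ultimately show "\<exists>V. open V \<and> x \<in> V \<and> V \<subseteq> U \<and>
      (\<exists>F R. finite F \<and> F \<subseteq> G \<and> (\<forall>A\<in>F. R A \<in> DN V) \<and> op_eq V (P + Q) (\<Sum>A\<in>F. R A \<circ> A))"
      using 1 2 by (intro exI[of _ ?V] conjI exI[of _ ?F] exI[of _ R]) auto
  qed
next
  fix P S and U :: "(complex^'n) set"
  assume U: "open U" and S: "S \<in> DN U" and P: "P \<in> left_ideal G U"
  show "S \<circ> P \<in> left_ideal G U"
    unfolding left_ideal_def
  proof (intro CollectI conjI ballI)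
    show "S \<circ> P \<in> DN U" using U S P by (auto simp: left_ideal_def intro: DN_comp)
    fix x assume "x \<in> U"
    obtain V F R where V: "open V" "x \<in> V" "V \<subseteq> U" "finite F" "F \<subseteq> G" and R: "\<forall>A\<in>F. R A \<in> DN V"
      and eq: "op_eq V P (\<Sum>A\<in>F. R A \<circ> A)"
      using P \<open>x \<in> U\<close> unfolding left_ideal_def by blast
    have SV: "S \<in> DN V" using S V(3) by (rule DN_subset)
    have A: "A \<in> DN V" if "A \<in> F" for A using that V G DN_UNIV by blast
    have PV: "P \<in> DN V" using P V(3) DN_subset unfolding left_ideal_def by blast
    have "op_eq V (S \<circ> P) (S \<circ> (\<Sum>A\<in>F. R A \<circ> A))"
      by (rule op_eq_comp[OF V(1) op_eq_refl eq SV PV])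
    moreover have "op_eq V (S \<circ> (\<Sum>A\<in>F. R A \<circ> A)) (\<Sum>A\<in>F. S \<circ> (R A \<circ> A))"
      using R A V by (intro comp_sum_right SV DN_comp) auto
    ultimately have "op_eq V (S \<circ> P) (\<Sum>A\<in>F. (S \<circ> R A) \<circ> A)"
      using op_eq_trans by (simp only: comp_assoc) blast
    moreover have "\<forall>A\<in>F. S \<circ> R A \<in> DN V"
      using R V(1) SV by (auto intro: DN_comp)
    ultimately show "\<exists>V. open V \<and> x \<in> V \<and> V \<subseteq> U \<and>
      (\<exists>F R. finite F \<and> F \<subseteq> G \<and> (\<forall>A\<in>F. R A \<in> DN V) \<and> op_eq V (S \<circ> P) (\<Sum>A\<in>F. R A \<circ> A))"
      using V by (intro exI[of _ V] conjI exI[of _ F] exI[of _ "\<lambda>A. S \<circ> R A"]) auto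
  qed
next
  fix P and U W :: "(complex^'n) set"
  assume U: "open U" "open W" "W \<subseteq> U" and P: "P \<in> left_ideal G U"
  show "P \<in> left_ideal G W"
    unfolding left_ideal_def
  proof (intro CollectI conjI ballI)
    show "P \<in> DN W" using U P by (auto simp: left_ideal_def intro: DN_subset)
    fix x assume "x \<in> W"
    then obtain V F R where V: "open V" "x \<in> V" "V \<subseteq> U" "finite F" "F \<subseteq> G" "\<forall>A\<in>F. R A \<in> DN V"
      "op_eq V P (\<Sum>A\<in>F. R A \<circ> A)"
      using P \<open>W \<subseteq> U\<close> unfolding left_ideal_def by blast
    have "op_eq (V \<inter> W) P (\<Sum>A\<in>F. R A \<circ> A)" "\<forall>A\<in>F. R A \<in> DN (V \<inter> W)"
      using V by (auto elim: op_eq_subset DN_subset)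
    then show "\<exists>V. open V \<and> x \<in> V \<and> V \<subseteq> W \<and>
      (\<exists>F R. finite F \<and> F \<subseteq> G \<and> (\<forall>A\<in>F. R A \<in> DN V) \<and> op_eq V P (\<Sum>A\<in>F. R A \<circ> A))"
      using V U \<open>x \<in> W\<close> by (intro exI[of _ "V \<inter> W"] conjI exI[of _ F] exI[of _ R]) auto
  qed
next
  fix P and U :: "(complex^'n) set"
  assume U: "open U" and loc: "\<And>x. x \<in> U \<Longrightarrow> \<exists>V. open V \<and> x \<in> V \<and> V \<subseteq> U \<and> P \<in> left_ideal G V"
  show "P \<in> left_ideal G U"
    unfolding left_ideal_def
  proof (intro CollectI conjI ballI)
    show "P \<in> DN U"
    proof (rule DN_locally)
      fix x assume "x \<in> U"
      from loc[OF this] show "\<exists>V. open V \<and> x \<in> V \<and> P \<in> DN V"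
        unfolding left_ideal_def by blast
    qed
    fix x assume "x \<in> U"
    then obtain V' where V': "open V'" "x \<in> V'" "V' \<subseteq> U" "P \<in> left_ideal G V'"
      using loc by blast
    then obtain V where "open V" "x \<in> V" "V \<subseteq> V'" and *: "\<exists>F R. finite F \<and> F \<subseteq> G \<and> (\<forall>A\<in>F. R A \<in> DN V) \<and>
        op_eq V P (\<Sum>A\<in>F. R A \<circ> A)"
      unfolding left_ideal_def by blast
    then show "\<exists>V. open V \<and> x \<in> V \<and> V \<subseteq> U \<and>
      (\<exists>F R. finite F \<and> F \<subseteq> G \<and> (\<forall>A\<in>F. R A \<in> DN V) \<and> op_eq V P (\<Sum>A\<in>F. R A \<circ> A))"
      using V'(3) by blast
  qed
qed

text \<open>Each local combination of generators lies in \<open>K\<close>, and glueing makes this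
  global; containment of sheaves is thus decided by global generators.\<close>

lemma left_ideal_least:
  assumes "ideal_sheaf K" "G \<subseteq> K UNIV" "open U" "P \<in> left_ideal G U"
  shows "P \<in> K U"
proof -
  interpret K: ideal_sheaf K by fact
  show ?thesis
  proof (rule K.glue[OF assms(3)])
    fix x assume "x \<in> U"
    then obtain V F R where V: "open V" "x \<in> V" "V \<subseteq> U" "finite F" "F \<subseteq> G" "\<forall>A\<in>F. R A \<in> DN V"
      "op_eq V P (\<Sum>A\<in>F. R A \<circ> A)"
      using assms(4) unfolding left_ideal_def by blast
    have "(\<Sum>A\<in>F. R A \<circ> A) \<in> K V"
      using V assms(2) K.restrict[OF open_UNIV V(1)] by (intro K.sum K.mult) auto
    then have "P \<in> K V"
      by (rule K.cong[OF V(1) op_eq_sym[OF V(7)]])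
    with V show "\<exists>V. open V \<and> x \<in> V \<and> V \<subseteq> U \<and> P \<in> K V" by blast
  qed
qed

lemma left_ideal_generator:
  assumes "A \<in> G" "A \<in> DN UNIV"
  shows "A \<in> left_ideal G UNIV"
proof -
  have "op_eq UNIV A (\<Sum>B\<in>{A}. scalar_op 1 \<circ> B)"
    by (simp add: op_eq_def scalar_op_def mult_op_def)
  then have "\<exists>F R. finite F \<and> F \<subseteq> G \<and> (\<forall>A\<in>F. R A \<in> DN UNIV) \<and> op_eq UNIV A (\<Sum>B\<in>F. R B \<circ> B)"
    using assms DN_scalar_op by (intro exI[of _ "{A}"] exI[of _ "\<lambda>_. scalar_op 1"]) auto
  then show ?thesis
    unfolding left_ideal_def using assms(2) open_UNIV by blast
qed

lemma ideal_sum_ideal_sheaf: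
  fixes I J :: "('n::finite) ideal_sheaf"
  assumes "ideal_sheaf I" "ideal_sheaf J"
  shows "ideal_sheaf (ideal_sum I J)"
proof -
  interpret I: ideal_sheaf I by fact
  interpret J: ideal_sheaf J by fact
  show ?thesis
  proof
    fix P and U :: "(complex^'n) set"
    assume "P \<in> ideal_sum I J U"
    then show "P \<in> DN U" by (simp add: ideal_sum_def)
  next
    fix P Q and U :: "(complex^'n) set"
    assume U: "open U" "op_eq U P Q" and P: "P \<in> ideal_sum I J U"
    show "Q \<in> ideal_sum I J U"
      unfolding ideal_sum_def
    proof (intro CollectI conjI ballI)
      show "Q \<in> DN U" using U P by (auto simp: ideal_sum_def intro: DN_cong)
      fix x assume "x \<in> U"
      then obtain V A B where "open V" "x \<in> V" "V \<subseteq> U" "A \<in> I V" "B \<in> J V" "op_eq V P (A + B)"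
        using P unfolding ideal_sum_def by blast
      moreover from this have "op_eq V Q (A + B)"
        using U(2) op_eq_trans op_eq_sym op_eq_subset by blast
      ultimately show "\<exists>V. open V \<and> x \<in> V \<and> V \<subseteq> U \<and> (\<exists>A\<in>I V. \<exists>B\<in>J V. op_eq V Q (A + B))"
        by blast
    qed
  next
    fix U :: "(complex^'n) set" assume U: "open U"
    have "op_eq U 0 (0 + 0)" by simp
    then show "0 \<in> ideal_sum I J U"
      unfolding ideal_sum_def using DN_zero U I.zero[OF U] J.zero[OF U] by blast
  next
    fix P Q and U :: "(complex^'n) set"
    assume U: "open U" and P: "P \<in> ideal_sum I J U" and Q: "Q \<in> ideal_sum I J U"
    show "P + Q \<in> ideal_sum I J U"
      unfolding ideal_sum_def
    proof (intro CollectI conjI ballI)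
      show "P + Q \<in> DN U" using U P Q by (auto simp: ideal_sum_def intro: DN_add)
      fix x assume "x \<in> U"
      obtain V1 A1 B1 where 1: "open V1" "x \<in> V1" "V1 \<subseteq> U" "A1 \<in> I V1" "B1 \<in> J V1" "op_eq V1 P (A1 + B1)"
        using P \<open>x \<in> U\<close> unfolding ideal_sum_def by blast
      obtain V2 A2 B2 where 2: "open V2" "x \<in> V2" "V2 \<subseteq> U" "A2 \<in> I V2" "B2 \<in> J V2" "op_eq V2 Q (A2 + B2)"
        using Q \<open>x \<in> U\<close> unfolding ideal_sum_def by blast
      let ?V = "V1 \<inter> V2"
      have V: "open ?V" using 1 2 by auto
      have "op_eq ?V (P + Q) ((A1 + B1) + (A2 + B2))"
        using 1(6) 2(6) by (auto intro!: op_eq_add elim: op_eq_subset)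
      then have "op_eq ?V (P + Q) ((A1 + A2) + (B1 + B2))"
        by (simp add: algebra_simps)
      moreover have "A1 + A2 \<in> I ?V"
        using I.restrict[OF 1(1) V _ 1(4)] I.restrict[OF 2(1) V _ 2(4)] I.add[OF V] by blast
      moreover have "B1 + B2 \<in> J ?V"
        using J.restrict[OF 1(1) V _ 1(5)] J.restrict[OF 2(1) V _ 2(5)] J.add[OF V] by blast
      moreover have "?V \<subseteq> U" "x \<in> ?V" using 1 2 by auto
      ultimately show "\<exists>V. open V \<and> x \<in> V \<and> V \<subseteq> U \<and> (\<exists>A\<in>I V. \<exists>B\<in>J V. op_eq V (P + Q) (A + B))"
        using V by blast
    qed
  next
    fix P S and U :: "(complex^'n) set"
    assume U: "open U" and S: "S \<in> DN U" and P: "P \<in> ideal_sum I J U"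
    show "S \<circ> P \<in> ideal_sum I J U"
      unfolding ideal_sum_def
    proof (intro CollectI conjI ballI)
      show "S \<circ> P \<in> DN U" using U S P by (auto simp: ideal_sum_def intro: DN_comp)
      fix x assume "x \<in> U"
      then obtain V A B where V: "open V" "x \<in> V" "V \<subseteq> U" "A \<in> I V" "B \<in> J V" and eq: "op_eq V P (A + B)"
        using P unfolding ideal_sum_def by blast
      have SV: "S \<in> DN V" using S V(3) by (rule DN_subset)
      have PV: "P \<in> DN V" using P V(3) DN_subset unfolding ideal_sum_def by blast
      have "op_eq V (S \<circ> P) (S \<circ> (A + B))"
        by (rule op_eq_comp[OF V(1) op_eq_refl eq SV PV])
      moreover have "op_eq V (S \<circ> (A + B)) ((S \<circ> A) + (S \<circ> B))"
        by (intro comp_add_right V SV I.in_DN[OF V(4)] J.in_DN[OF V(5)])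
      ultimately have "op_eq V (S \<circ> P) ((S \<circ> A) + (S \<circ> B))"
        by (rule op_eq_trans)
      then show "\<exists>V. open V \<and> x \<in> V \<and> V \<subseteq> U \<and> (\<exists>A\<in>I V. \<exists>B\<in>J V. op_eq V (S \<circ> P) (A + B))"
        using V I.mult[OF V(1) SV V(4)] J.mult[OF V(1) SV V(5)] by blast
    qed
  next
    fix P and U W :: "(complex^'n) set"
    assume U: "open U" "open W" "W \<subseteq> U" and P: "P \<in> ideal_sum I J U"
    show "P \<in> ideal_sum I J W"
      unfolding ideal_sum_def
    proof (intro CollectI conjI ballI)
      show "P \<in> DN W" using U P by (auto simp: ideal_sum_def intro: DN_subset)
      fix x assume "x \<in> W"
      then obtain V A B where V: "open V" "x \<in> V" "V \<subseteq> U" "A \<in> I V" "B \<in> J V" "op_eq V P (A + B)"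
        using P \<open>W \<subseteq> U\<close> unfolding ideal_sum_def by blast
      let ?V = "V \<inter> W"
      have V': "open ?V" "?V \<subseteq> W" "x \<in> ?V" using V U \<open>x \<in> W\<close> by auto
      have "op_eq ?V P (A + B)" using V(6) by (rule op_eq_subset) auto
      moreover have "A \<in> I ?V" "B \<in> J ?V"
        using I.restrict[OF V(1) V'(1) _ V(4)] J.restrict[OF V(1) V'(1) _ V(5)] by blast+
      ultimately show "\<exists>V. open V \<and> x \<in> V \<and> V \<subseteq> W \<and> (\<exists>A\<in>I V. \<exists>B\<in>J V. op_eq V P (A + B))"
        using V' by blast
    qed
  next
    fix P and U :: "(complex^'n) set"
    assume U: "open U" and loc: "\<And>x. x \<in> U \<Longrightarrow> \<exists>V. open V \<and> x \<in> V \<and> V \<subseteq> U \<and> P \<in> ideal_sum I J V"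
    show "P \<in> ideal_sum I J U"
      unfolding ideal_sum_def
    proof (intro CollectI conjI ballI)
      show "P \<in> DN U"
      proof (rule DN_locally)
        fix x assume "x \<in> U"
        from loc[OF this] show "\<exists>V. open V \<and> x \<in> V \<and> P \<in> DN V"
          unfolding ideal_sum_def by blast
      qed
      fix x assume "x \<in> U"
      then obtain V' where V': "open V'" "x \<in> V'" "V' \<subseteq> U" "P \<in> ideal_sum I J V'"
        using loc by blast
      then obtain V where "open V" "x \<in> V" "V \<subseteq> V'" "\<exists>A\<in>I V. \<exists>B\<in>J V. op_eq V P (A + B)"
        unfolding ideal_sum_def by blast
      then show "\<exists>V. open V \<and> x \<in> V \<and> V \<subseteq> U \<and> (\<exists>A\<in>I V. \<exists>B\<in>J V. op_eq V P (A + B))"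
        using V'(3) by blast
    qed
  qed
qed

lemma ideal_sum_least:
  assumes "ideal_sheaf K" "open U" "P \<in> ideal_sum I J U"
    and "\<And>V A. open V \<Longrightarrow> A \<in> I V \<Longrightarrow> A \<in> K V" "\<And>V A. open V \<Longrightarrow> A \<in> J V \<Longrightarrow> A \<in> K V"
  shows "P \<in> K U"
proof -
  interpret K: ideal_sheaf K by fact
  show ?thesis
  proof (rule K.glue[OF assms(2)])
    fix x assume "x \<in> U"
    then obtain V A B where V: "open V" "x \<in> V" "V \<subseteq> U" "A \<in> I V" "B \<in> J V" "op_eq V P (A + B)"
      using assms(3) unfolding ideal_sum_def by blast
    have "P \<in> K V"
      by (rule K.cong[OF V(1) op_eq_sym[OF V(6)] K.add[OF V(1) assms(4)[OF V(1,4)] assms(5)[OF V(1,5)]]])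
    with V show "\<exists>V. open V \<and> x \<in> V \<and> V \<subseteq> U \<and> P \<in> K V" by blast
  qed
qed

lemma ideal_sum_left:
  assumes "ideal_sheaf I" "ideal_sheaf J" "open U" "P \<in> I U"
  shows "P \<in> ideal_sum I J U"
proof -
  have "op_eq U P (P + 0)" by simp
  then show ?thesis
    unfolding ideal_sum_def
    using assms ideal_sheaf.in_DN[OF assms(1,4)] ideal_sheaf.zero[OF assms(2,3)] by blast
qed

lemma ideal_sum_right:
  assumes "ideal_sheaf I" "ideal_sheaf J" "open U" "P \<in> J U"
  shows "P \<in> ideal_sum I J U"
proof -
  have "op_eq U P (0 + P)" by simp
  then show ?thesis
    unfolding ideal_sum_def
    using assms ideal_sheaf.in_DN[OF assms(2,4)] ideal_sheaf.zero[OF assms(1,3)] by blast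
qed

text \<open>The operators carried into \<open>J\<close> by right multiplication by \<open>X\<close> form an ideal sheaf, so
  that well-definedness of right multiplication has to be checked on global generators only.\<close>

lemma ideal_sheaf_colon:
  fixes J :: "('n::finite) ideal_sheaf"
  assumes "ideal_sheaf J" and X: "X \<in> DN UNIV"
  shows "ideal_sheaf (\<lambda>U. {P \<in> DN U. P \<circ> X \<in> J U})"
proof -
  interpret J: ideal_sheaf J by fact
  note XU = DN_UNIV[OF X]
  show ?thesis
  proof
    fix P and U :: "(complex^'n) set"
    assume "P \<in> {P \<in> DN U. P \<circ> X \<in> J U}"
    then show "P \<in> DN U" by simp
  next
    fix P Q and U :: "(complex^'n) set"
    assume U: "open U" "op_eq U P Q" and P: "P \<in> {P \<in> DN U. P \<circ> X \<in> J U}"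
    then have "op_eq U (P \<circ> X) (Q \<circ> X)"
      by (intro op_eq_comp op_eq_refl XU) auto
    then show "Q \<in> {P \<in> DN U. P \<circ> X \<in> J U}"
      using U P J.cong[OF U(1)] DN_cong[OF U] by blast
  next
    fix U :: "(complex^'n) set" assume U: "open U"
    have "(0 :: 'n oper) \<circ> X = 0" by (simp add: fun_eq_iff)
    then show "0 \<in> {P \<in> DN U. P \<circ> X \<in> J U}"
      using J.zero[OF U] by (simp only: mem_Collect_eq DN_zero simp_thms)
  next
    fix P Q and U :: "(complex^'n) set"
    assume "open U" "P \<in> {P \<in> DN U. P \<circ> X \<in> J U}" "Q \<in> {P \<in> DN U. P \<circ> X \<in> J U}"
    then show "P + Q \<in> {P \<in> DN U. P \<circ> X \<in> J U}"
      by (auto simp: comp_add_left intro: DN_add J.add)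
  next
    fix P S and U :: "(complex^'n) set"
    assume "open U" "S \<in> DN U" "P \<in> {P \<in> DN U. P \<circ> X \<in> J U}"
    then show "S \<circ> P \<in> {P \<in> DN U. P \<circ> X \<in> J U}"
      by (auto simp: comp_assoc intro: DN_comp J.mult)
  next
    fix P and U V :: "(complex^'n) set"
    assume "open U" "open V" "V \<subseteq> U" "P \<in> {P \<in> DN U. P \<circ> X \<in> J U}"
    then show "P \<in> {P \<in> DN V. P \<circ> X \<in> J V}"
      using J.restrict DN_subset by blast
  next
    fix P and U :: "(complex^'n) set"
    assume U: "open U"
      and loc: "\<And>x. x \<in> U \<Longrightarrow> \<exists>V. open V \<and> x \<in> V \<and> V \<subseteq> U \<and> P \<in> {P \<in> DN V. P \<circ> X \<in> J V}"
    have "P \<in> DN U" using loc by (intro DN_locally) blast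
    moreover have "P \<circ> X \<in> J U" using loc by (intro J.glue[OF U]) blast
    ultimately show "P \<in> {P \<in> DN U. P \<circ> X \<in> J U}" by simp
  qed
qed

section \<open>Germs and sections of a quotient sheaf\<close>

context ideal_sheaf
begin

lemma germ_class_refl: "\<lbrakk>open V; x \<in> V; P \<in> DN V\<rbrakk> \<Longrightarrow> P \<in> germ_class J x P"
  unfolding germ_class_def using zero by auto

lemma germ_class_sym:
  assumes "Q \<in> germ_class J x P"
  shows "P \<in> germ_class J x Q"
proof -
  obtain V where V: "open V" "x \<in> V" "P \<in> DN V" "Q \<in> DN V" "P - Q \<in> J V"
    using assms unfolding germ_class_def by blast
  then have "Q - P \<in> J V" using uminus[of V "P - Q"] by simp
  then show ?thesis unfolding germ_class_def using V by blast
qed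

lemma germ_class_trans:
  assumes "Q \<in> germ_class J x P" "R \<in> germ_class J x Q"
  shows "R \<in> germ_class J x P"
proof -
  obtain V where V: "open V" "x \<in> V" "P \<in> DN V" "Q \<in> DN V" "P - Q \<in> J V"
    using assms(1) unfolding germ_class_def by blast
  obtain V' where V': "open V'" "x \<in> V'" "Q \<in> DN V'" "R \<in> DN V'" "Q - R \<in> J V'"
    using assms(2) unfolding germ_class_def by blast
  have W: "open (V \<inter> V')" "x \<in> V \<inter> V'" using V V' by auto
  have "(P - Q) + (Q - R) \<in> J (V \<inter> V')"
    using restrict[OF V(1) W(1) _ V(5)] restrict[OF V'(1) W(1) _ V'(5)] add[OF W(1)] by blast
  then have "P - R \<in> J (V \<inter> V')" by simp
  moreover have "P \<in> DN (V \<inter> V')" "R \<in> DN (V \<inter> V')"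
    using V V' by (auto elim: DN_subset)
  ultimately show ?thesis
    unfolding germ_class_def using W by blast
qed

lemma germ_class_eq: "Q \<in> germ_class J x P \<Longrightarrow> germ_class J x Q = germ_class J x P"
  by (blast intro: germ_class_sym germ_class_trans)

lemma germ_class_eqI:
  assumes "open V" "x \<in> V" "P \<in> DN V" "Q \<in> DN V" "P - Q \<in> J V"
  shows "germ_class J x P = germ_class J x Q"
  using germ_class_eq[of Q x P] assms unfolding germ_class_def by blast

lemma germ_class_cong:
  assumes "open V" "x \<in> V" "P \<in> DN V" "op_eq V P Q"
  shows "germ_class J x P = germ_class J x Q"
proof (rule germ_class_eqI[OF assms(1-3)])
  show "Q \<in> DN V" by (rule DN_cong[OF assms(1,4,3)])
  have "op_eq V 0 (P - Q)" using assms(4) by (simp add: op_eq_def)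
  then show "P - Q \<in> J V" by (rule cong[OF assms(1) _ zero[OF assms(1)]])
qed

lemma sections_quotient_sheafE:
  assumes "s \<in> sections (quotient_sheaf J) U" "x \<in> U"
  obtains V P where "open V" "x \<in> V" "V \<subseteq> U" "P \<in> DN V" "\<And>y. y \<in> V \<Longrightarrow> s y = germ_class J y P"
proof -
  have "\<exists>V P. open V \<and> x \<in> V \<and> V \<subseteq> U \<and> P \<in> DN V \<and> (\<forall>y\<in>V. s y = germ_class J y P)"
    using assms by (simp add: quotient_sheaf_def)
  then show ?thesis using that by blast
qed

lemma sections_outside: "s \<in> sections (quotient_sheaf J) U \<Longrightarrow> x \<notin> U \<Longrightarrow> s x = {}"
  by (simp add: quotient_sheaf_def)

text \<open>The union in \<open>plus_sec\<close> runs over all representatives. It collapses to one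
  class because the class of the sum does not depend on them and both index sets are
  non-empty.\<close>

lemma plus_sec_germ:
  assumes "open V" "x \<in> V" "P \<in> DN V" "Q \<in> DN V" "s x = germ_class J x P" "t x = germ_class J x Q"
  shows "plus_sec (quotient_sheaf J) s t x = germ_class J x (P + Q)"
proof -
  have "germ_class J x (P' + Q') = germ_class J x (P + Q)"
    if P': "P' \<in> germ_class J x P" and Q': "Q' \<in> germ_class J x Q" for P' Q'
  proof -
    obtain V1 where V1: "open V1" "x \<in> V1" "P \<in> DN V1" "P' \<in> DN V1" "P - P' \<in> J V1"
      using P' unfolding germ_class_def by blast
    obtain V2 where V2: "open V2" "x \<in> V2" "Q \<in> DN V2" "Q' \<in> DN V2" "Q - Q' \<in> J V2"
      using Q' unfolding germ_class_def by blast
    have W: "open (V1 \<inter> V2)" "x \<in> V1 \<inter> V2" using V1 V2 by auto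
    have "(P - P') + (Q - Q') \<in> J (V1 \<inter> V2)"
      using restrict[OF V1(1) W(1) _ V1(5)] restrict[OF V2(1) W(1) _ V2(5)] add[OF W(1)] by blast
    then have "(P + Q) - (P' + Q') \<in> J (V1 \<inter> V2)" by (simp add: algebra_simps)
    moreover have "P + Q \<in> DN (V1 \<inter> V2)" "P' + Q' \<in> DN (V1 \<inter> V2)"
      using V1 V2 W by (auto intro!: DN_add elim: DN_subset)
    ultimately show ?thesis using germ_class_eqI[OF W, of "P + Q" "P' + Q'"] by simp
  qed
  moreover have "germ_class J x P \<noteq> {}" "germ_class J x Q \<noteq> {}"
    using germ_class_refl[OF assms(1-3)] germ_class_refl[OF assms(1,2,4)] by auto
  ultimately have "(\<Union>P'\<in>germ_class J x P. \<Union>Q'\<in>germ_class J x Q. germ_class J x (P' + Q')) = germ_class J x (P + Q)"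
    by (intro SUP_eq_const)
  then show ?thesis
    by (simp add: quotient_sheaf_def assms(5,6))
qed

lemma act_germ:
  assumes "open V" "x \<in> V" "P \<in> DN V" "R \<in> DN V" "s x = germ_class J x P"
  shows "act (quotient_sheaf J) R s x = germ_class J x (R \<circ> P)"
proof -
  have "germ_class J x (R \<circ> P') = germ_class J x (R \<circ> P)" if P': "P' \<in> germ_class J x P" for P'
  proof -
    obtain V1 where V1: "open V1" "x \<in> V1" "P \<in> DN V1" "P' \<in> DN V1" "P - P' \<in> J V1"
      using P' unfolding germ_class_def by blast
    have W: "open (V \<inter> V1)" "x \<in> V \<inter> V1" using V1 assms by auto
    have DN: "P \<in> DN (V \<inter> V1)" "P' \<in> DN (V \<inter> V1)" "R \<in> DN (V \<inter> V1)"
      using V1 assms by (auto elim: DN_subset)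
    have "R \<circ> (P - P') \<in> J (V \<inter> V1)"
      using restrict[OF V1(1) W(1) _ V1(5)] mult[OF W(1) DN(3)] by blast
    \<comment> \<open>Distributing \<open>R\<close> over the difference is only an
      \<open>op_eq\<close>, absorbed by the closure of \<open>J\<close>.\<close>
    then have "(R \<circ> P) - (R \<circ> P') \<in> J (V \<inter> V1)"
      by (rule cong[OF W(1) comp_diff_right[OF W(1) DN(3,1,2)]])
    then show ?thesis using germ_class_eqI[OF W] DN_comp[OF DN(3) _ W(1)] DN(1,2) by metis
  qed
  moreover have "germ_class J x P \<noteq> {}"
    using germ_class_refl[OF assms(1-3)] by auto
  ultimately have "(\<Union>P'\<in>germ_class J x P. germ_class J x (R \<circ> P')) = germ_class J x (R \<circ> P)"
    by (intro SUP_eq_const)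
  then show ?thesis
    by (simp add: quotient_sheaf_def assms(5))
qed

end

section \<open>Right multiplication between quotient sheaves\<close>

locale ideal_sheaf_map = J1: ideal_sheaf J1 + J2: ideal_sheaf J2
  for J1 J2 :: "('n::finite) ideal_sheaf" +
  fixes X :: "'n oper"
  assumes X: "X \<in> DN UNIV" and comp_in: "open U \<Longrightarrow> P \<in> J1 U \<Longrightarrow> P \<circ> X \<in> J2 U"
begin

text \<open>\<open>comp_in\<close> is the well-definedness condition: it sends the difference of two
  representatives into \<open>J2\<close>, as composition distributes exactly over a difference in
  its left factor.\<close>

lemma right_mult_germ:
  assumes "open V" "x \<in> V" "P \<in> DN V" "s x = germ_class J1 x P"
  shows "right_mult J2 X U s x = germ_class J2 x (P \<circ> X)"
proof -
  have "germ_class J2 x (P' \<circ> X) = germ_class J2 x (P \<circ> X)" if P': "P' \<in> germ_class J1 x P" for P'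
  proof -
    obtain V1 where V1: "open V1" "x \<in> V1" "P \<in> DN V1" "P' \<in> DN V1" "P - P' \<in> J1 V1"
      using P' unfolding germ_class_def by blast
    have "(P \<circ> X) - (P' \<circ> X) \<in> J2 V1"
      using comp_in[OF V1(1,5)] by (simp only: comp_diff_left)
    then show ?thesis
      using J2.germ_class_eqI[OF V1(1,2) DN_comp[OF V1(3) DN_UNIV[OF X] V1(1)]
          DN_comp[OF V1(4) DN_UNIV[OF X] V1(1)]] by simp
  qed
  moreover have "germ_class J1 x P \<noteq> {}"
    using J1.germ_class_refl[OF assms(1-3)] by auto
  ultimately show ?thesis
    unfolding right_mult_def assms(4) by (intro SUP_eq_const)
qed

lemma right_mult_outside: "s x = {} \<Longrightarrow> right_mult J2 X U s x = {}"
  by (simp add: right_mult_def)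

lemma right_mult_sections:
  assumes "s \<in> sections (quotient_sheaf J1) U"
  shows "right_mult J2 X U s \<in> sections (quotient_sheaf J2) U"
proof -
  have "\<exists>V P. open V \<and> x \<in> V \<and> V \<subseteq> U \<and> P \<in> DN V \<and> (\<forall>y\<in>V. right_mult J2 X U s y = germ_class J2 y P)"
    if x: "x \<in> U" for x
  proof -
    obtain V P where V: "open V" "x \<in> V" "V \<subseteq> U" "P \<in> DN V" "\<And>y. y \<in> V \<Longrightarrow> s y = germ_class J1 y P"
      using J1.sections_quotient_sheafE[OF assms x] by blast
    show ?thesis
      by (intro exI[of _ V] exI[of _ "P \<circ> X"] conjI ballI V(1-3) DN_comp[OF V(4) DN_UNIV[OF X] V(1)])
        (rule right_mult_germ[OF V(1) _ V(4) V(5)])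
  qed
  moreover have "\<forall>x. x \<notin> U \<longrightarrow> right_mult J2 X U s x = {}"
    using J1.sections_outside[OF assms] right_mult_outside by blast
  ultimately show ?thesis by (simp add: quotient_sheaf_def)
qed

lemma right_mult_section_class:
  assumes "open U" "P \<in> DN U"
  shows "right_mult J2 X U (section_class J1 U P) = section_class J2 U (P \<circ> X)"
proof
  fix x
  show "right_mult J2 X U (section_class J1 U P) x = section_class J2 U (P \<circ> X) x"
  proof (cases "x \<in> U")
    case True
    then show ?thesis
      using right_mult_germ[OF assms(1) True assms(2), of "section_class J1 U P" U]
      by (simp add: section_class_def)
  next
    case False
    then show ?thesis by (simp add: section_class_def right_mult_outside)
  qed
qed

lemma right_mult_hom: "dmodule_hom (quotient_sheaf J1) (quotient_sheaf J2) (right_mult J2 X)"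
  unfolding dmodule_hom_def
proof (intro allI impI ballI conjI)
  fix U s assume U: "open U" and s: "s \<in> sections (quotient_sheaf J1) U"
  show "right_mult J2 X U s \<in> sections (quotient_sheaf J2) U"
    by (rule right_mult_sections[OF s])
  show "right_mult J2 X V (restr (quotient_sheaf J1) V s) = restr (quotient_sheaf J2) V (right_mult J2 X U s)" for V
    by (auto simp: right_mult_def quotient_sheaf_def fun_eq_iff)
  show "right_mult J2 X U (plus_sec (quotient_sheaf J1) s t)
      = plus_sec (quotient_sheaf J2) (right_mult J2 X U s) (right_mult J2 X U t)"
    if t: "t \<in> sections (quotient_sheaf J1) U" for t
  proof
    fix x
    show "right_mult J2 X U (plus_sec (quotient_sheaf J1) s t) x
      = plus_sec (quotient_sheaf J2) (right_mult J2 X U s) (right_mult J2 X U t) x"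
    proof (cases "x \<in> U")
      case True
      obtain V P where V: "open V" "x \<in> V" "V \<subseteq> U" "P \<in> DN V" "\<And>y. y \<in> V \<Longrightarrow> s y = germ_class J1 y P"
        using J1.sections_quotient_sheafE[OF s True] by blast
      obtain V' Q where V': "open V'" "x \<in> V'" "V' \<subseteq> U" "Q \<in> DN V'" "\<And>y. y \<in> V' \<Longrightarrow> t y = germ_class J1 y Q"
        using J1.sections_quotient_sheafE[OF t True] by blast
      let ?W = "V \<inter> V'"
      have W: "open ?W" "x \<in> ?W" using V V' by auto
      have DN: "P \<in> DN ?W" "Q \<in> DN ?W" using V V' by (auto elim: DN_subset)
      note DN_X = DN_comp[OF _ DN_UNIV[OF X] W(1)]
      have sx: "s x = germ_class J1 x P" and tx: "t x = germ_class J1 x Q"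
        using V V' by auto
      show ?thesis
        using right_mult_germ[where s="plus_sec (quotient_sheaf J1) s t" and U=U,
            OF W DN_add[OF DN W(1)] J1.plus_sec_germ[where s=s and t=t, OF W DN sx tx]]
          J2.plus_sec_germ[where s="right_mult J2 X U s" and t="right_mult J2 X U t",
            OF W DN_X[OF DN(1)] DN_X[OF DN(2)]
              right_mult_germ[where s=s, OF W DN(1) sx] right_mult_germ[where s=t, OF W DN(2) tx]]
        by (simp add: comp_add_left)
    next
      case False
      then have "s x = {}" using J1.sections_outside[OF s] by simp
      then show ?thesis by (simp add: right_mult_def quotient_sheaf_def)
    qed
  qed
  show "right_mult J2 X U (act (quotient_sheaf J1) R s) = act (quotient_sheaf J2) R (right_mult J2 X U s)"
    if R: "R \<in> DN U" for R
  proof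
    fix x
    show "right_mult J2 X U (act (quotient_sheaf J1) R s) x = act (quotient_sheaf J2) R (right_mult J2 X U s) x"
    proof (cases "x \<in> U")
      case True
      obtain V P where V: "open V" "x \<in> V" "V \<subseteq> U" "P \<in> DN V" "\<And>y. y \<in> V \<Longrightarrow> s y = germ_class J1 y P"
        using J1.sections_quotient_sheafE[OF s True] by blast
      have RV: "R \<in> DN V" using R V(3) by (rule DN_subset)
      have sx: "s x = germ_class J1 x P" using V by auto
      show ?thesis
        using right_mult_germ[where s="act (quotient_sheaf J1) R s" and U=U,
            OF V(1,2) DN_comp[OF RV V(4,1)] J1.act_germ[where s=s, OF V(1,2,4) RV sx]]
          J2.act_germ[where s="right_mult J2 X U s",
            OF V(1,2) DN_comp[OF V(4) DN_UNIV[OF X] V(1)] RV right_mult_germ[where s=s, OF V(1,2,4) sx]]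
        by (simp add: comp_assoc)
    next
      case False
      then have "s x = {}" using J1.sections_outside[OF s] by simp
      then show ?thesis by (simp add: right_mult_def quotient_sheaf_def)
    qed
  qed
qed

end

text \<open>Multiplying the global relation by a local representative \<open>P\<close> from the left
  keeps it in the ideal, so \<open>P \<circ> X \<circ> Y\<close> has the class of
  \<open>P \<circ> scalar_op a\<close>; the scalar then moves to the left by linearity of
  \<open>P\<close>.\<close>

lemma right_mult_right_mult:
  assumes "ideal_sheaf_map J1 J2 X" "ideal_sheaf_map J2 J1 Y"
    and XY: "(X \<circ> Y) - scalar_op a \<in> J1 UNIV"
    and U: "open U" and s: "s \<in> sections (quotient_sheaf J1) U"
  shows "right_mult J1 Y U (right_mult J2 X U s) = act (quotient_sheaf J1) (scalar_op a) s"
proof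
  interpret X: ideal_sheaf_map J1 J2 X by fact
  interpret Y: ideal_sheaf_map J2 J1 Y by fact
  fix x
  show "right_mult J1 Y U (right_mult J2 X U s) x = act (quotient_sheaf J1) (scalar_op a) s x"
  proof (cases "x \<in> U")
    case True
    obtain V P where V: "open V" "x \<in> V" "V \<subseteq> U" "P \<in> DN V" "\<And>y. y \<in> V \<Longrightarrow> s y = germ_class J1 y P"
      using X.J1.sections_quotient_sheafE[OF s True] by blast
    note XV = DN_UNIV[OF X.X, of V] and YV = DN_UNIV[OF Y.X, of V]
    have sx: "s x = germ_class J1 x P" using V by auto
    have 1: "right_mult J1 Y U (right_mult J2 X U s) x = germ_class J1 x ((P \<circ> X) \<circ> Y)"
      by (rule Y.right_mult_germ[where s="right_mult J2 X U s",
            OF V(1,2) DN_comp[OF V(4) XV V(1)] X.right_mult_germ[where s=s, OF V(1,2,4) sx]])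
    have 2: "act (quotient_sheaf J1) (scalar_op a) s x = germ_class J1 x (scalar_op a \<circ> P)"
      by (rule X.J1.act_germ[where s=s, OF V(1,2,4) DN_scalar_op sx])
    have "P \<circ> ((X \<circ> Y) - scalar_op a) \<in> J1 V"
      using X.J1.mult[OF V(1,4) X.J1.restrict[OF open_UNIV V(1) _ XY]] by simp
    then have "(P \<circ> (X \<circ> Y)) - (P \<circ> scalar_op a) \<in> J1 V"
      by (rule X.J1.cong[OF V(1), rotated])
        (intro comp_diff_right V DN_comp XV YV DN_scalar_op)
    then have "((P \<circ> X) \<circ> Y) - (P \<circ> scalar_op a) \<in> J1 V"
      by (simp only: comp_assoc)
    then have "germ_class J1 x ((P \<circ> X) \<circ> Y) = germ_class J1 x (P \<circ> scalar_op a)"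
      by (intro X.J1.germ_class_eqI[OF V(1,2)] DN_comp V XV YV DN_scalar_op)
    also have "\<dots> = germ_class J1 x (scalar_op a \<circ> P)"
      by (intro X.J1.germ_class_cong[OF V(1,2)] DN_comp V DN_scalar_op comp_scalar)
    finally show ?thesis using 1 2 by simp
  next
    case False
    then have "s x = {}" using X.J1.sections_outside[OF s] by simp
    then show ?thesis by (simp add: right_mult_def quotient_sheaf_def)
  qed
qed

lemma act_scalar_1:
  assumes "ideal_sheaf J" and U: "open U" and s: "s \<in> sections (quotient_sheaf J) U"
  shows "act (quotient_sheaf J) (scalar_op 1) s = s"
proof
  interpret J: ideal_sheaf J by fact
  fix x
  show "act (quotient_sheaf J) (scalar_op 1) s x = s x"
  proof (cases "x \<in> U")
    case True
    obtain V P where V: "open V" "x \<in> V" "V \<subseteq> U" "P \<in> DN V" "\<And>y. y \<in> V \<Longrightarrow> s y = germ_class J y P"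
      using J.sections_quotient_sheafE[OF s True] by blast
    have "scalar_op 1 \<circ> P = P" by (simp add: fun_eq_iff scalar_op_def mult_op_def)
    then show ?thesis
      using J.act_germ[where s=s and R="scalar_op 1", OF V(1,2,4) DN_scalar_op V(5)[OF V(2)]] V(5)[OF V(2)]
      by simp
  next
    case False
    then have "s x = {}" using J.sections_outside[OF s] by simp
    then show ?thesis by (simp add: quotient_sheaf_def)
  qed
qed

text \<open>The inverse is right multiplication by \<open>Y\<close> divided by \<open>a\<close>,
  which is again compatible with the ideals; both composites are then the action of the scalar
  1.\<close>

lemma right_mult_iso:
  fixes J1 J2 :: "('n::finite) ideal_sheaf"
  assumes X: "ideal_sheaf_map J1 J2 X" and Y: "ideal_sheaf_map J2 J1 Y"
    and XY: "(X \<circ> Y) - scalar_op a \<in> J1 UNIV" and YX: "(Y \<circ> X) - scalar_op a \<in> J2 UNIV"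
    and a: "a \<noteq> 0"
  shows "dmodule_iso (quotient_sheaf J1) (quotient_sheaf J2) (right_mult J2 X)"
proof -
  interpret X: ideal_sheaf_map J1 J2 X by fact
  interpret Y: ideal_sheaf_map J2 J1 Y by fact
  let ?b = "scalar_op (1 / a)"
  define Y' where "Y' = Y \<circ> ?b"
  have Y': "ideal_sheaf_map J2 J1 Y'"
  proof
    show "Y' \<in> DN UNIV" unfolding Y'_def by (intro DN_comp Y.X DN_scalar_op open_UNIV)
    fix U P assume "open U" "P \<in> J2 U"
    then show "P \<circ> Y' \<in> J1 U"
      unfolding Y'_def comp_assoc[symmetric] by (intro X.J1.comp_scalar_in Y.comp_in)
  qed
  \<comment> \<open>The division by \<open>a\<close> is performed from the left, where ideals are
    closed; the \<open>op_eq\<close> premise reconciles this with the position of the scalar in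
    \<open>Y'\<close>.\<close>
  have scaled: "Z - scalar_op 1 \<in> J UNIV"
    if J: "ideal_sheaf J" and Z: "op_eq UNIV (?b \<circ> Z') Z" and "Z' - scalar_op a \<in> J UNIV" and Z': "Z' \<in> DN UNIV"
    for J Z Z'
  proof -
    interpret J: ideal_sheaf J by fact
    have "?b \<circ> (Z' - scalar_op a) \<in> J UNIV"
      by (intro J.mult DN_scalar_op open_UNIV that)
    moreover have "op_eq UNIV (?b \<circ> (Z' - scalar_op a)) (Z - scalar_op 1)"
    proof (rule op_eq_trans[OF comp_diff_right op_eq_diff[OF Z]])
      show "op_eq UNIV (?b \<circ> scalar_op a) (scalar_op 1)"
        using a by (simp add: op_eq_def scalar_op_def mult_op_def)
    qed (intro open_UNIV DN_scalar_op Z')+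
    ultimately show ?thesis using J.cong open_UNIV by blast
  qed
  have XY': "(X \<circ> Y') - scalar_op 1 \<in> J1 UNIV"
  proof (rule scaled[OF X.J1.ideal_sheaf_axioms _ XY])
    show "op_eq UNIV (?b \<circ> (X \<circ> Y)) (X \<circ> Y')"
      unfolding Y'_def comp_assoc[symmetric, of X Y]
      by (rule op_eq_sym) (intro comp_scalar DN_comp X.X Y.X open_UNIV)
  qed (intro DN_comp X.X Y.X open_UNIV)
  have Y'X: "(Y' \<circ> X) - scalar_op 1 \<in> J2 UNIV"
  proof (rule scaled[OF X.J2.ideal_sheaf_axioms _ YX])
    show "op_eq UNIV (?b \<circ> (Y \<circ> X)) (Y' \<circ> X)"
      unfolding Y'_def comp_assoc[symmetric, of ?b Y]
      by (rule op_eq_sym) (intro op_eq_comp op_eq_refl comp_scalar DN_comp DN_scalar_op X.X Y.X open_UNIV)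
  qed (intro DN_comp X.X Y.X open_UNIV)
  interpret Y': ideal_sheaf_map J2 J1 Y' by fact
  show ?thesis
    unfolding dmodule_iso_def
  proof (intro conjI exI[of _ "right_mult J1 Y'"] allI impI ballI)
    fix U :: "(complex^'n) set" assume U: "open U"
    show "right_mult J1 Y' U (right_mult J2 X U s) = s" if s: "s \<in> sections (quotient_sheaf J1) U" for s
      using right_mult_right_mult[OF X Y' XY' U s] act_scalar_1[OF X.J1.ideal_sheaf_axioms U s] by simp
    show "right_mult J2 X U (right_mult J1 Y' U t) = t" if t: "t \<in> sections (quotient_sheaf J2) U" for t
      using right_mult_right_mult[OF Y' X Y'X U t] act_scalar_1[OF X.J2.ideal_sheaf_axioms U t] by simp
  qed (rule X.right_mult_hom Y'.right_mult_hom)+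
qed

section \<open>The maps between the quotients\<close>

lemma abs_diff_op_eq_iff:
  assumes "P \<in> DN UNIV" "Q \<in> DN UNIV"
  shows "abs_diff_op P = abs_diff_op Q \<longleftrightarrow> op_eq UNIV P Q"
  using Quotient_rel[OF Quotient_diff_op, of P Q] assms by auto

lemma
  assumes "P \<in> DN UNIV" "Q \<in> DN UNIV"
  shows abs_diff_op_add: "abs_diff_op (P + Q) = abs_diff_op P + abs_diff_op Q"
    and abs_diff_op_diff: "abs_diff_op (P - Q) = abs_diff_op P - abs_diff_op Q"
    and abs_diff_op_comp: "abs_diff_op (P \<circ> Q) = abs_diff_op P * abs_diff_op Q"
  using assms by (simp_all add: plus_diff_op.abs_eq minus_diff_op.abs_eq times_diff_op.abs_eq)

lemma abs_diff_op_sum: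
  assumes "\<And>i. i \<in> S \<Longrightarrow> f i \<in> DN UNIV"
  shows "abs_diff_op (sum f S) = (\<Sum>i\<in>S. abs_diff_op (f i))"
  using assms
  by (induction S rule: infinite_finite_induct)
    (simp_all add: abs_diff_op_add DN_sum flip: zero_diff_op.abs_eq)

lemma abs_diff_op_cases:
  fixes r :: "('n::finite) diff_op"
  obtains P where "P \<in> DN UNIV" "r = abs_diff_op P"
  using that[of "rep_diff_op r"] Quotient_abs_rep[OF Quotient_diff_op, of r]
    Quotient_rep_reflp[OF Quotient_diff_op, of r] by simp

text \<open>Global sections suffice, because the generators, the multipliers and the two product
  relations are all global.\<close>

definition ring_ideal :: "('n::finite) ideal_sheaf \<Rightarrow> 'n diff_op set" where
  "ring_ideal J = abs_diff_op ` J UNIV"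

context ideal_sheaf
begin

lemma abs_in_ring_ideal_iff:
  assumes "P \<in> DN UNIV"
  shows "abs_diff_op P \<in> ring_ideal J \<longleftrightarrow> P \<in> J UNIV"
proof
  assume "abs_diff_op P \<in> ring_ideal J"
  then obtain Q where Q: "Q \<in> J UNIV" "abs_diff_op P = abs_diff_op Q"
    by (auto simp: ring_ideal_def)
  then have "op_eq UNIV Q P"
    using abs_diff_op_eq_iff[OF assms in_DN[OF Q(1)]] op_eq_sym by blast
  then show "P \<in> J UNIV" using Q(1) by (rule cong[OF open_UNIV])
qed (auto simp: ring_ideal_def)

lemma left_ideal_ring_ideal: "left_ideal_of_ring (ring_ideal J)"
proof
  show "0 \<in> ring_ideal J"
    unfolding zero_diff_op.abs_eq by (simp add: abs_in_ring_ideal_iff DN_zero zero)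
  fix a b r :: "'n diff_op"
  assume a: "a \<in> ring_ideal J"
  then obtain P where P: "P \<in> J UNIV" "a = abs_diff_op P" by (auto simp: ring_ideal_def)
  note PD = in_DN[OF P(1)]
  show "a + b \<in> ring_ideal J" if "b \<in> ring_ideal J"
  proof -
    obtain Q where Q: "Q \<in> J UNIV" "b = abs_diff_op Q" using \<open>b \<in> ring_ideal J\<close> by (auto simp: ring_ideal_def)
    show ?thesis
      using add[OF open_UNIV P(1) Q(1)] abs_diff_op_add[OF PD in_DN[OF Q(1)]]
      by (simp add: ring_ideal_def P(2) Q(2) image_iff) metis
  qed
  obtain R where R: "R \<in> DN UNIV" "r = abs_diff_op R" by (rule abs_diff_op_cases)
  have "R \<circ> P \<in> J UNIV" by (rule mult[OF open_UNIV R(1) P(1)])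
  then have "abs_diff_op (R \<circ> P) \<in> ring_ideal J" by (auto simp: ring_ideal_def)
  then show "r * a \<in> ring_ideal J"
    using abs_diff_op_comp[OF R(1) PD] by (simp only: P(2) R(2))
qed

end

section \<open>The Weyl algebra relations for the concrete operators\<close>

definition scalar_diff_op :: "complex \<Rightarrow> ('n::finite) diff_op" where
  "scalar_diff_op a = abs_diff_op (scalar_op a)"

text \<open>Centrality of scalars is the complex homogeneity of operators in
  \<open>DN\<close>.\<close>

lemma scalar_diff_op_commute: "scalar_diff_op a * r = r * scalar_diff_op a"
proof -
  obtain R where R: "R \<in> DN UNIV" "r = abs_diff_op R" by (rule abs_diff_op_cases)
  have "abs_diff_op (scalar_op a \<circ> R) = abs_diff_op (R \<circ> scalar_op a)"
    using comp_scalar[OF open_UNIV R(1)]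
    by (subst abs_diff_op_eq_iff) (auto intro: DN_comp DN_scalar_op R op_eq_sym)
  then show ?thesis
    by (simp add: R(2) scalar_diff_op_def abs_diff_op_comp DN_scalar_op R(1))
qed

lemma scalar_diff_op_1: "scalar_diff_op 1 = 1"
  by (simp add: scalar_diff_op_def one_diff_op.abs_eq)

lemma scalar_diff_op_add: "scalar_diff_op (a + b) = scalar_diff_op a + scalar_diff_op b"
proof -
  have "scalar_op (a + b) = scalar_op a + (scalar_op b :: 'a oper)"
    by (simp add: fun_eq_iff scalar_op_def mult_op_def distrib_right)
  then show ?thesis
    by (simp add: scalar_diff_op_def abs_diff_op_add DN_scalar_op)
qed

lemma scalar_diff_op_mult: "scalar_diff_op (a * b) = scalar_diff_op a * scalar_diff_op b"
proof -
  have "scalar_op (a * b) = scalar_op a \<circ> (scalar_op b :: 'a oper)"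
    by (simp add: fun_eq_iff scalar_op_def mult_op_def)
  then show ?thesis
    by (simp add: scalar_diff_op_def abs_diff_op_comp DN_scalar_op)
qed

lemma scalar_diff_op_0: "scalar_diff_op 0 = 0"
  using scalar_diff_op_add[of 0 0] by simp

lemma scalar_diff_op_of_nat: "scalar_diff_op (of_nat n) = of_nat n"
  by (induction n) (simp_all add: scalar_diff_op_0 scalar_diff_op_add scalar_diff_op_1)

lemma pd_comp_mult_op:
  fixes g :: "complex^('n::finite) \<Rightarrow> complex"
  assumes "hol_on g UNIV"
  shows "op_eq UNIV (pd i \<circ> mult_op g) ((mult_op g \<circ> pd i) + mult_op (pd i g))"
proof (rule op_eqI[OF open_UNIV])
  fix W and f :: "complex^'n \<Rightarrow> complex" and x assume W: "open W" "hol_on f W" "x \<in> W"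
  have "hol_on g W" using assms by (rule hol_on_subset) simp
  from pd_mult[OF this W(2,3)]
  show "(pd i \<circ> mult_op g) f x = ((mult_op g \<circ> pd i) + mult_op (pd i g)) f x"
    by (simp add: mult_op_def)
qed

lemma hol_on_sig: "hol_on (sig k c h) W"
  unfolding sig_def
  by (cases "h = 0"; cases "h \<le> k") (auto intro: hol_on_const hol_on_coord)

lemma DN_sig: "mult_op (sig k c h) \<in> DN V"
  by (intro DN_mult_op hol_on_sig)

lemma hol_on_minus:
  assumes "hol_on f W" "hol_on g W"
  shows "hol_on (\<lambda>x. f x - g x) W"
  using hol_on_add[OF assms(1) hol_on_mult[OF hol_on_const assms(2)], of "- 1"] by simp

definition sig_diff_op :: "nat \<Rightarrow> (nat \<Rightarrow> 'n::finite) \<Rightarrow> nat \<Rightarrow> 'n diff_op" where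
  "sig_diff_op k c h = abs_diff_op (mult_op (sig k c h))"

definition pd_diff_op :: "(nat \<Rightarrow> 'n::finite) \<Rightarrow> nat \<Rightarrow> 'n diff_op" where
  "pd_diff_op c h = abs_diff_op (pd (c h))"

lemma weyl_algebra_diff_op:
  fixes c :: "nat \<Rightarrow> 'n::finite"
  assumes c: "inj_on c {1..k}"
  shows "weyl_algebra (sig_diff_op k c) (pd_diff_op c) k (scalar_diff_op \<mu>)"
proof
  have "mult_op (sig k c 0) = scalar_op 1"
    by (simp add: sig_def scalar_op_def)
  then show "sig_diff_op k c 0 = 1"
    by (simp add: sig_diff_op_def one_diff_op.abs_eq)
  have "mult_op (sig k c (Suc k)) = scalar_op 0"
    by (simp add: sig_def scalar_op_def)
  then show "sig_diff_op k c (Suc k) = 0"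
    using scalar_diff_op_0 by (simp add: sig_diff_op_def scalar_diff_op_def)
  show "sig_diff_op k c i * sig_diff_op k c j = sig_diff_op k c j * sig_diff_op k c i" for i j
  proof -
    have "mult_op (sig k c i) \<circ> mult_op (sig k c j) = mult_op (sig k c j) \<circ> mult_op (sig k c i)"
      by (simp add: fun_eq_iff mult_op_def)
    then show ?thesis
      unfolding sig_diff_op_def by (simp only: DN_sig flip: abs_diff_op_comp)
  qed
  show "pd_diff_op c i * pd_diff_op c j = pd_diff_op c j * pd_diff_op c i" for i j
  proof -
    have "op_eq UNIV (pd (c i) \<circ> pd (c j)) (pd (c j) \<circ> pd (c i))"
      by (rule op_eqI[OF open_UNIV]) (simp add: pd_commute)
    then show ?thesis
      unfolding pd_diff_op_def
      by (simp add: DN_pd DN_comp abs_diff_op_eq_iff flip: abs_diff_op_comp)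
  qed
  show "pd_diff_op c i * sig_diff_op k c j = sig_diff_op k c j * pd_diff_op c i + (if i = j then 1 else 0)"
    if "i \<in> {1..k}" "j \<le> k" for i j
  proof -
    \<comment> \<open>Injectivity of \<open>c\<close> converts the Kronecker delta on the index type
      into one on numbers; for \<open>j = 0\<close> the function is constant, and \<open>i\<close>
      is positive.\<close>
    have "pd (c i) (sig k c j) x = (if i = j then 1 else 0)" for x
      using that inj_on_eq_iff[OF c, of i j]
      by (cases "j = 0") (auto simp: sig_def pd_const pd_coord)
    then have eq: "mult_op (pd (c i) (sig k c j)) = scalar_op (if i = j then 1 else 0)"
      by (simp add: scalar_op_def fun_eq_iff mult_op_def)
    have "abs_diff_op (pd (c i) \<circ> mult_op (sig k c j))
        = abs_diff_op ((mult_op (sig k c j) \<circ> pd (c i)) + scalar_op (if i = j then 1 else 0))"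
      using pd_comp_mult_op[OF hol_on_sig, of "c i" k c j]
      by (subst abs_diff_op_eq_iff) (auto simp: eq intro: DN_add DN_comp DN_sig DN_pd DN_scalar_op)
    then have "pd_diff_op c i * sig_diff_op k c j
        = sig_diff_op k c j * pd_diff_op c i + scalar_diff_op (if i = j then 1 else 0)"
      by (simp add: abs_diff_op_comp abs_diff_op_add DN_comp DN_sig DN_pd DN_scalar_op
          pd_diff_op_def sig_diff_op_def scalar_diff_op_def)
    then show ?thesis by (simp add: scalar_diff_op_1 scalar_diff_op_0)
  qed
qed (rule scalar_diff_op_commute)+

text \<open>The terms with factor \<open>s 1\<close> sum to \<open>s 1 * (E + m)\<close>, which is
  the missing summand \<open>j = 0\<close> of \<open>Up\<close>; the term with
  \<open>s (Suc k)\<close> vanishes.\<close>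

lemma (in weyl_algebra) Up_eq:
  assumes "k \<ge> 1"
  shows "(\<Sum>h=1..k. (s 1 * s h - of_nat (Suc h) * s (Suc h)) * D h) + m * s 1 = Up"
proof -
  have "E = (\<Sum>h=1..k. s h * D h)" by (simp add: W_def)
  then have "(\<Sum>h=1..k. (s 1 * s h - of_nat (Suc h) * s (Suc h)) * D h)
      = s 1 * E - (\<Sum>h=1..k. of_nat (Suc h) * (s (Suc h) * D h))"
    by (simp only: left_diff_distrib sum_subtractf sum_distrib_left mult.assoc)
  moreover have "(\<Sum>h=1..k. of_nat (Suc h) * (s (Suc h) * D h)) = (\<Sum>h=1..<k. of_nat (Suc h) * (s (Suc h) * d h))"
  proof -
    have "{1..k} = insert k {1..<k}" using assms by auto
    then show ?thesis by (simp add: s_gt d_def del: of_nat_Suc)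
  qed
  moreover have "Up = - (s 1 * d 0) - (\<Sum>h=1..<k. of_nat (Suc h) * (s (Suc h) * d h))"
  proof -
    have "{..<k} = insert 0 {1..<k}" using assms by auto
    then show ?thesis by (simp add: Up_def)
  qed
  ultimately show ?thesis
    using m_s[of 1] by (simp add: d_def distrib_left right_diff_distrib)
qed

lemma abs_mult_op_scale:
  assumes "hol_on g UNIV"
  shows "abs_diff_op (mult_op (\<lambda>x. a * g x)) = scalar_diff_op a * abs_diff_op (mult_op g)"
proof -
  have "mult_op (\<lambda>x. a * g x) = scalar_op a \<circ> mult_op g"
    by (simp add: fun_eq_iff scalar_op_def mult_op_def)
  then show ?thesis
    by (simp add: scalar_diff_op_def abs_diff_op_comp DN_scalar_op DN_mult_op assms)
qed

lemma DN_scaled_sig: "mult_op (\<lambda>x. a * sig k c h x) \<in> DN V"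
  by (intro DN_mult_op hol_on_mult hol_on_const hol_on_sig)

lemma DN_U1_coeff: "mult_op (\<lambda>x. sig k c 1 x * sig k c h x - of_nat (h + 1) * sig k c (h + 1) x) \<in> DN V"
  by (intro DN_mult_op hol_on_minus hol_on_mult hol_on_const hol_on_sig)

lemma
  shows DN_E_op: "E_op k c \<in> DN UNIV" and DN_Um1_op: "Um1_op k c \<in> DN UNIV"
    and DN_U0_op: "U0_op k c \<in> DN UNIV" and DN_U1_op: "U1_op k c \<in> DN UNIV"
  unfolding E_op_def Um1_op_def U0_op_def U1_op_def
  by (intro DN_sum DN_comp DN_sig DN_scaled_sig DN_U1_coeff DN_pd open_UNIV)+

lemma DN_A_op: "A_op c p q \<in> DN UNIV"
  unfolding A_op_def by (intro DN_diff DN_comp DN_pd open_UNIV)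

lemma DN_T_op: "T_op k c \<mu> j \<in> DN UNIV"
  unfolding T_op_def by (intro DN_add DN_comp DN_pd DN_E_op DN_scalar_op open_UNIV)

lemma abs_E_op: "abs_diff_op (E_op k c) = (\<Sum>h=1..k. sig_diff_op k c h * pd_diff_op c h)"
  unfolding E_op_def sig_diff_op_def pd_diff_op_def
  by (simp add: abs_diff_op_sum abs_diff_op_comp DN_comp DN_sig DN_pd)

lemma abs_U0_op: "abs_diff_op (U0_op k c) = (\<Sum>h=1..k. of_nat h * (sig_diff_op k c h * pd_diff_op c h))"
  unfolding U0_op_def sig_diff_op_def pd_diff_op_def
  by (simp add: abs_diff_op_sum abs_diff_op_comp DN_comp DN_scaled_sig DN_pd abs_mult_op_scale hol_on_sig
      scalar_diff_op_of_nat mult.assoc)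

lemma abs_Um1_op:
  "k \<ge> 1 \<Longrightarrow> abs_diff_op (Um1_op k c) = (\<Sum>h<k. of_nat (k - h) * (sig_diff_op k c h * pd_diff_op c (Suc h)))"
proof -
  assume "k \<ge> 1"
  then have "{0..k - 1} = {..<k}" by auto
  then show ?thesis
    unfolding Um1_op_def sig_diff_op_def pd_diff_op_def
    by (simp add: abs_diff_op_sum abs_diff_op_comp DN_comp DN_scaled_sig DN_pd abs_mult_op_scale hol_on_sig
        scalar_diff_op_of_nat mult.assoc del: of_nat_diff)
qed

lemma abs_U1_op: "abs_diff_op (U1_op k c) = (\<Sum>h=1..k.
    (sig_diff_op k c 1 * sig_diff_op k c h - of_nat (Suc h) * sig_diff_op k c (Suc h)) * pd_diff_op c h)"
proof -
  have "abs_diff_op (mult_op (\<lambda>x. sig k c 1 x * sig k c h x - of_nat (h + 1) * sig k c (h + 1) x))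
      = sig_diff_op k c 1 * sig_diff_op k c h - of_nat (Suc h) * sig_diff_op k c (Suc h)" for h
  proof -
    have "mult_op (\<lambda>x. sig k c 1 x * sig k c h x - of_nat (h + 1) * sig k c (h + 1) x)
        = (mult_op (sig k c 1) \<circ> mult_op (sig k c h)) - mult_op (\<lambda>x. of_nat (Suc h) * sig k c (Suc h) x)"
      by (simp add: fun_eq_iff mult_op_def left_diff_distrib)
    moreover have "abs_diff_op (mult_op (\<lambda>x. of_nat (Suc h) * sig k c (Suc h) x)) = of_nat (Suc h) * sig_diff_op k c (Suc h)"
      by (simp only: abs_mult_op_scale hol_on_sig scalar_diff_op_of_nat sig_diff_op_def)
    ultimately show ?thesis
      by (simp only: abs_diff_op_diff abs_diff_op_comp DN_comp DN_sig DN_scaled_sig open_UNIV sig_diff_op_def)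
  qed
  then show ?thesis
    unfolding U1_op_def pd_diff_op_def
    by (simp only: abs_diff_op_sum abs_diff_op_comp DN_comp DN_U1_coeff DN_pd open_UNIV)
qed

section \<open>The ideals of the statement and the operators between them\<close>

lemma J_ideal_ideal_sheaf: "ideal_sheaf (J_ideal k c \<mu> l)"
  unfolding J_ideal_def I_ideal_def
  by (intro ideal_sum_ideal_sheaf left_ideal_ideal_sheaf)
    (auto intro: DN_A_op DN_T_op DN_diff DN_U0_op DN_scalar_op)

lemma J_ideal_least:
  assumes K: "ideal_sheaf K"
    and A: "\<And>p q. p \<in> {1..k-1} \<Longrightarrow> q \<in> {2..k} \<Longrightarrow> A_op c p q \<in> K UNIV"
    and T: "\<And>j. j \<in> {2..k} \<Longrightarrow> T_op k c \<mu> j \<in> K UNIV"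
    and U0: "U0_op k c - scalar_op l \<in> K UNIV"
    and U: "open U" and P: "P \<in> J_ideal k c \<mu> l U"
  shows "P \<in> K U"
proof (rule ideal_sum_least[OF K U P[unfolded J_ideal_def]])
  show "Q \<in> K V" if "open V" "Q \<in> I_ideal k c \<mu> V" for Q V
    using that(2) unfolding I_ideal_def
    by (rule left_ideal_least[OF K _ that(1), rotated]) (use A T in auto)
  show "Q \<in> K V" if "open V" "Q \<in> left_ideal {U0_op k c - scalar_op l} V" for Q V
    by (rule left_ideal_least[OF K _ that]) (use U0 in simp)
qed

lemma J_ideal_generators:
  shows "p \<in> {1..k-1} \<Longrightarrow> q \<in> {2..k} \<Longrightarrow> A_op c p q \<in> J_ideal k c \<mu> l UNIV"
    and "j \<in> {2..k} \<Longrightarrow> T_op k c \<mu> j \<in> J_ideal k c \<mu> l UNIV"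
    and "U0_op k c - scalar_op l \<in> J_ideal k c \<mu> l UNIV"
proof -
  let ?G = "{A_op c p q | p q. p \<in> {1..k-1} \<and> q \<in> {2..k}} \<union> {T_op k c \<mu> m | m. m \<in> {2..k}}"
  have I: "ideal_sheaf (left_ideal ?G)" and H: "ideal_sheaf (left_ideal {U0_op k c - scalar_op l})"
    by (intro left_ideal_ideal_sheaf; auto intro: DN_A_op DN_T_op DN_diff DN_U0_op DN_scalar_op)+
  show "A_op c p q \<in> J_ideal k c \<mu> l UNIV" if "p \<in> {1..k-1}" "q \<in> {2..k}"
    unfolding J_ideal_def I_ideal_def
    by (rule ideal_sum_left[OF I H open_UNIV left_ideal_generator[OF _ DN_A_op]]) (use that in blast)
  show "T_op k c \<mu> j \<in> J_ideal k c \<mu> l UNIV" if "j \<in> {2..k}"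
    unfolding J_ideal_def I_ideal_def
    by (rule ideal_sum_left[OF I H open_UNIV left_ideal_generator[OF _ DN_T_op]]) (use that in blast)
  show "U0_op k c - scalar_op l \<in> J_ideal k c \<mu> l UNIV"
    unfolding J_ideal_def I_ideal_def
    by (rule ideal_sum_right[OF I H open_UNIV left_ideal_generator])
      (rule insertI1, intro DN_diff DN_U0_op DN_scalar_op open_UNIV)
qed

context
  fixes k :: nat and c :: "nat \<Rightarrow> 'n::finite" and \<mu> :: complex
  assumes k: "k \<ge> 2" and c: "bij_betw c {1..k} (UNIV :: 'n set)"
begin

interpretation weyl_algebra "sig_diff_op k c" "pd_diff_op c" k "scalar_diff_op \<mu>"
  by (rule weyl_algebra_diff_op) (use c in \<open>simp add: bij_betw_def\<close>)

abbreviation "U1_mu \<equiv> U1_op k c + mult_op (\<lambda>x. \<mu> * sig k c 1 x)"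

lemma DN_U1_mu: "U1_mu \<in> DN UNIV"
  by (intro DN_add DN_U1_op DN_scaled_sig open_UNIV)

lemma abs_ops:
  "abs_diff_op (E_op k c) = E" "abs_diff_op (U0_op k c) = U0"
  "abs_diff_op (Um1_op k c) = Um" "abs_diff_op U1_mu = Up"
proof -
  show "abs_diff_op (E_op k c) = E" "abs_diff_op (U0_op k c) = U0"
    by (simp_all add: abs_E_op abs_U0_op W_def)
  show "abs_diff_op (Um1_op k c) = Um"
    using k by (simp add: abs_Um1_op Um_def d_def)
  have "abs_diff_op U1_mu = abs_diff_op (U1_op k c) + scalar_diff_op \<mu> * sig_diff_op k c 1"
    by (simp only: abs_diff_op_add DN_U1_op DN_scaled_sig abs_mult_op_scale hol_on_sig sig_diff_op_def)
  then show "abs_diff_op U1_mu = Up"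
    using Up_eq k by (simp add: abs_U1_op)
qed

lemma abs_A_op: "abs_diff_op (A_op c p q)
    = pd_diff_op c p * pd_diff_op c q - pd_diff_op c (p + 1) * pd_diff_op c (q - 1)"
  unfolding A_op_def pd_diff_op_def
  by (simp only: abs_diff_op_diff abs_diff_op_comp DN_comp DN_pd open_UNIV)

lemma abs_T_op: "abs_diff_op (T_op k c \<mu> j)
    = pd_diff_op c 1 * pd_diff_op c (j - 1) + pd_diff_op c j * (E + scalar_diff_op \<mu>)"
  unfolding T_op_def
  by (simp only: abs_diff_op_add abs_diff_op_comp DN_comp DN_pd DN_add DN_E_op DN_scalar_op open_UNIV
      abs_ops pd_diff_op_def[symmetric] scalar_diff_op_def[symmetric])

lemma weyl_ideal_J: "weyl_ideal (sig_diff_op k c) (pd_diff_op c) k (scalar_diff_op \<mu>) (ring_ideal (J_ideal k c \<mu> l))"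
proof -
  interpret J: ideal_sheaf "J_ideal k c \<mu> l" by (rule J_ideal_ideal_sheaf)
  interpret left_ideal_of_ring "ring_ideal (J_ideal k c \<mu> l)" by (rule J.left_ideal_ring_ideal)
  show ?thesis
  proof
    show "pd_diff_op c p * pd_diff_op c q - pd_diff_op c (p + 1) * pd_diff_op c (q - 1)
        \<in> ring_ideal (J_ideal k c \<mu> l)" if "p \<in> {1..k-1}" "q \<in> {2..k}" for p q
      using J_ideal_generators(1)[OF that] J.abs_in_ring_ideal_iff[OF DN_A_op] by (metis abs_A_op)
    show "pd_diff_op c 1 * pd_diff_op c (j - 1) + pd_diff_op c j * (E + scalar_diff_op \<mu>)
        \<in> ring_ideal (J_ideal k c \<mu> l)" if "j \<in> {2..k}" for j
      using J_ideal_generators(2)[OF that] J.abs_in_ring_ideal_iff[OF DN_T_op] by (metis abs_T_op)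
  qed (rule k)
qed

lemma U0_minus_in: "U0 - scalar_diff_op l \<in> ring_ideal (J_ideal k c \<mu> l)"
proof -
  interpret J: ideal_sheaf "J_ideal k c \<mu> l" by (rule J_ideal_ideal_sheaf)
  have "abs_diff_op (U0_op k c - scalar_op l) = U0 - scalar_diff_op l"
    by (simp only: abs_diff_op_diff DN_U0_op DN_scalar_op abs_ops scalar_diff_op_def)
  then show ?thesis
    using J_ideal_generators(3) J.abs_in_ring_ideal_iff[OF DN_diff[OF DN_U0_op DN_scalar_op open_UNIV]]
    by metis
qed

text \<open>By \<open>ideal_sheaf_colon\<close> the operators that \<open>X\<close> carries into the
  target form an ideal sheaf, so \<open>J_ideal_least\<close> leaves only the three kinds of
  generators, which are tested in the ring.\<close>

lemma ideal_sheaf_map_J: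
  assumes X: "X \<in> DN UNIV"
    and A: "\<And>p q. p \<in> {1..k-1} \<Longrightarrow> q \<in> {2..k} \<Longrightarrow> abs_diff_op (A_op c p q) * abs_diff_op X \<in> ring_ideal (J_ideal k c \<mu> l')"
    and T: "\<And>j. j \<in> {2..k} \<Longrightarrow> abs_diff_op (T_op k c \<mu> j) * abs_diff_op X \<in> ring_ideal (J_ideal k c \<mu> l')"
    and U0: "(U0 - scalar_diff_op l) * abs_diff_op X \<in> ring_ideal (J_ideal k c \<mu> l')"
  shows "ideal_sheaf_map (J_ideal k c \<mu> l) (J_ideal k c \<mu> l') X"
proof -
  interpret J: ideal_sheaf "J_ideal k c \<mu> l" by (rule J_ideal_ideal_sheaf)
  interpret J': ideal_sheaf "J_ideal k c \<mu> l'" by (rule J_ideal_ideal_sheaf)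
  have *: "P \<circ> X \<in> J_ideal k c \<mu> l' UNIV"
    if "P \<in> DN UNIV" "abs_diff_op P * abs_diff_op X \<in> ring_ideal (J_ideal k c \<mu> l')" for P
    using that J'.abs_in_ring_ideal_iff[OF DN_comp[OF that(1) X open_UNIV]]
    by (simp only: abs_diff_op_comp X)
  have DN_U0: "U0_op k c - scalar_op l \<in> DN UNIV" by (intro DN_diff DN_U0_op DN_scalar_op open_UNIV)
  have "abs_diff_op (U0_op k c - scalar_op l) = U0 - scalar_diff_op l"
    by (simp only: abs_diff_op_diff DN_U0_op DN_scalar_op abs_ops scalar_diff_op_def)
  with U0 have U0': "abs_diff_op (U0_op k c - scalar_op l) * abs_diff_op X \<in> ring_ideal (J_ideal k c \<mu> l')"
    by simp
  show ?thesis
  proof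
    show "X \<in> DN UNIV" by (rule X)
    fix U :: "(complex^'n) set" and P assume "open U" "P \<in> J_ideal k c \<mu> l U"
    then have "P \<in> {P \<in> DN U. P \<circ> X \<in> J_ideal k c \<mu> l' U}"
    proof (rule J_ideal_least[OF ideal_sheaf_colon[OF J'.ideal_sheaf_axioms X], rotated 3])
      show "A_op c p q \<in> {P \<in> DN UNIV. P \<circ> X \<in> J_ideal k c \<mu> l' UNIV}"
        if "p \<in> {1..k-1}" "q \<in> {2..k}" for p q
        using *[OF DN_A_op A[OF that]] DN_A_op by simp
      show "T_op k c \<mu> j \<in> {P \<in> DN UNIV. P \<circ> X \<in> J_ideal k c \<mu> l' UNIV}" if "j \<in> {2..k}" for j
        using *[OF DN_T_op T[OF that]] DN_T_op by simp
      show "U0_op k c - scalar_op l \<in> {P \<in> DN UNIV. P \<circ> X \<in> J_ideal k c \<mu> l' UNIV}"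
        using *[OF DN_U0 U0'] DN_U0 by simp
    qed
    then show "P \<circ> X \<in> J_ideal k c \<mu> l' U" by simp
  qed
qed

lemma ideal_sheaf_map_U1: "ideal_sheaf_map (J_ideal k c \<mu> (l + 1)) (J_ideal k c \<mu> l) U1_mu"
proof -
  interpret weyl_ideal "sig_diff_op k c" "pd_diff_op c" k "scalar_diff_op \<mu>" "ring_ideal (J_ideal k c \<mu> l)"
    by (rule weyl_ideal_J)
  show ?thesis
  proof (rule ideal_sheaf_map_J[OF DN_U1_mu])
    \<comment> \<open>Only this generator depends on \<lambda>: passing \<open>Up\<close>, of weight
      1, turns it into a left multiple of the generator for \<open>l\<close>.\<close>
    have "(U0 - scalar_diff_op (l + 1)) * Up = Up * (U0 - scalar_diff_op l)"
      using U0_Up scalar_diff_op_commute[of l Up]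
      by (simp add: scalar_diff_op_add scalar_diff_op_1 algebra_simps)
    then show "(U0 - scalar_diff_op (l + 1)) * abs_diff_op U1_mu \<in> ring_ideal (J_ideal k c \<mu> l)"
      using mult[OF U0_minus_in] by (simp only: abs_ops)
  qed (simp_all only: abs_ops abs_A_op abs_T_op A_mult_in T_mult_in)
qed

lemma ideal_sheaf_map_Um1: "ideal_sheaf_map (J_ideal k c \<mu> l) (J_ideal k c \<mu> (l + 1)) (Um1_op k c)"
proof -
  interpret weyl_ideal "sig_diff_op k c" "pd_diff_op c" k "scalar_diff_op \<mu>" "ring_ideal (J_ideal k c \<mu> (l + 1))"
    by (rule weyl_ideal_J)
  show ?thesis
  proof (rule ideal_sheaf_map_J[OF DN_Um1_op])
    have "(U0 - scalar_diff_op l) * Um = Um * (U0 - scalar_diff_op (l + 1))"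
      using U0_Um scalar_diff_op_commute[of l Um]
      by (simp add: scalar_diff_op_add scalar_diff_op_1 algebra_simps)
    then show "(U0 - scalar_diff_op l) * abs_diff_op (Um1_op k c) \<in> ring_ideal (J_ideal k c \<mu> (l + 1))"
      using mult[OF U0_minus_in] by (simp only: abs_ops)
  qed (simp_all only: abs_ops abs_A_op abs_T_op A_mult_in T_mult_in)
qed

lemma scalar_product:
  "scalar_diff_op ((l + of_nat k * \<mu>) * (l + 1))
    = (scalar_diff_op l + of_nat k * scalar_diff_op \<mu>) * (scalar_diff_op l + 1)"
  by (simp only: scalar_diff_op_mult scalar_diff_op_add scalar_diff_op_1 scalar_diff_op_of_nat)

text \<open>Right multiplications compose in the order of the product, so this product governs first
  \<open>T_map\<close>, then \<open>G_map\<close>, and belongs to the ideal at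
  \<open>l\<close>.\<close>

lemma Um1_U1_in: "(Um1_op k c \<circ> U1_mu) - scalar_op ((l + of_nat k * \<mu>) * (l + 1)) \<in> J_ideal k c \<mu> l UNIV"
proof -
  interpret J: ideal_sheaf "J_ideal k c \<mu> l" by (rule J_ideal_ideal_sheaf)
  interpret weyl_ideal "sig_diff_op k c" "pd_diff_op c" k "scalar_diff_op \<mu>" "ring_ideal (J_ideal k c \<mu> l)"
    by (rule weyl_ideal_J)
  let ?L = "scalar_diff_op l :: 'n diff_op" and ?M = "of_nat k * scalar_diff_op \<mu> :: 'n diff_op"
  have M: "?M * r = r * ?M" for r
    by (metis mult_of_nat_commute mult.assoc scalar_diff_op_commute)
  \<comment> \<open>\<open>U0\<close> may be replaced by \<lambda> only through a factor
    \<open>U0 - ?L\<close> at the right end, the ideal being a left one; centrality of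
    \<open>?L\<close> and \<open>?M\<close> allows this.\<close>
  have "(U0 + 1) * (U0 + ?M) - (?L + ?M) * (?L + 1) = (U0 + 1) * (U0 - ?L) + (?L + ?M) * (U0 - ?L)"
    using scalar_diff_op_commute[of l U0] M[of U0] by (simp add: algebra_simps)
  also have "\<dots> \<in> ring_ideal (J_ideal k c \<mu> l)"
    by (intro add mult U0_minus_in)
  finally have "cong ((U0 + 1) * (U0 + ?M)) ((?L + ?M) * (?L + 1))" by (simp only: cong_def)
  then have "cong (Um * Up) ((?L + ?M) * (?L + 1))" by (rule cong_trans[OF Um_Up])
  then have "abs_diff_op ((Um1_op k c \<circ> U1_mu) - scalar_op ((l + of_nat k * \<mu>) * (l + 1)))
      \<in> ring_ideal (J_ideal k c \<mu> l)"
    by (simp only: abs_diff_op_diff abs_diff_op_comp DN_comp DN_Um1_op DN_U1_mu DN_scalar_op open_UNIV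
        abs_ops scalar_diff_op_def[symmetric] scalar_product cong_def)
  then show ?thesis
    by (subst (asm) J.abs_in_ring_ideal_iff)
      (intro DN_diff DN_comp DN_Um1_op DN_U1_mu DN_scalar_op open_UNIV)
qed

text \<open>In this quotient \<open>U0\<close> acts as \<open>l + 1\<close>, so
  \<open>U0 * (U0 + ?M - 1)\<close> reduces to the same scalar as the opposite product does at
  \<open>l\<close>.\<close>

lemma U1_Um1_in: "(U1_mu \<circ> Um1_op k c) - scalar_op ((l + of_nat k * \<mu>) * (l + 1)) \<in> J_ideal k c \<mu> (l + 1) UNIV"
proof -
  interpret J: ideal_sheaf "J_ideal k c \<mu> (l + 1)" by (rule J_ideal_ideal_sheaf)
  interpret weyl_ideal "sig_diff_op k c" "pd_diff_op c" k "scalar_diff_op \<mu>" "ring_ideal (J_ideal k c \<mu> (l + 1))"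
    by (rule weyl_ideal_J)
  let ?L = "scalar_diff_op l :: 'n diff_op" and ?M = "of_nat k * scalar_diff_op \<mu> :: 'n diff_op"
  have M: "?M * r = r * ?M" for r
    by (metis mult_of_nat_commute mult.assoc scalar_diff_op_commute)
  have L: "U0 - (?L + 1) \<in> ring_ideal (J_ideal k c \<mu> (l + 1))"
    using U0_minus_in[of "l + 1"] by (simp only: scalar_diff_op_add scalar_diff_op_1)
  have "U0 * (U0 + ?M - 1) - (?L + ?M) * (?L + 1) = U0 * (U0 - (?L + 1)) + (?L + ?M) * (U0 - (?L + 1))"
    using scalar_diff_op_commute[of l U0] M[of U0] by (simp add: algebra_simps)
  also have "\<dots> \<in> ring_ideal (J_ideal k c \<mu> (l + 1))"
    by (intro add mult L)
  finally have "cong (U0 * (U0 + ?M - 1)) ((?L + ?M) * (?L + 1))" by (simp only: cong_def)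
  then have "cong (Up * Um) ((?L + ?M) * (?L + 1))" by (rule cong_trans[OF Up_Um])
  then have "abs_diff_op ((U1_mu \<circ> Um1_op k c) - scalar_op ((l + of_nat k * \<mu>) * (l + 1)))
      \<in> ring_ideal (J_ideal k c \<mu> (l + 1))"
    by (simp only: abs_diff_op_diff abs_diff_op_comp DN_comp DN_Um1_op DN_U1_mu DN_scalar_op open_UNIV
        abs_ops scalar_diff_op_def[symmetric] scalar_product cong_def)
  then show ?thesis
    by (subst (asm) J.abs_in_ring_ideal_iff)
      (intro DN_diff DN_comp DN_Um1_op DN_U1_mu DN_scalar_op open_UNIV)
qed

end

theorem theorem3p1p5:
  fixes k :: nat and c :: "nat \<Rightarrow> 'n::finite" and l \<mu> :: complex
  assumes k: "k \<ge> 2"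
    and c: "bij_betw c {1..k} (UNIV :: 'n set)"
  shows "dmodule_hom (N_mod k c \<mu> (l + 1)) (N_mod k c \<mu> l) (G_map k c \<mu> l) \<and>
         dmodule_hom (N_mod k c \<mu> l) (N_mod k c \<mu> (l + 1)) (T_map k c \<mu> l) \<and>
         (\<forall>U. open U \<longrightarrow> (\<forall>P\<in>DN U.
           G_map k c \<mu> l U (section_class (J_ideal k c \<mu> (l + 1)) U P) =
             section_class (J_ideal k c \<mu> l) U
               (P \<circ> (U1_op k c + mult_op (\<lambda>x. \<mu> * sig k c 1 x))))) \<and>
         (\<forall>U. open U \<longrightarrow> (\<forall>P\<in>DN U.
           T_map k c \<mu> l U (section_class (J_ideal k c \<mu> l) U P) =
             section_class (J_ideal k c \<mu> (l + 1)) U (P \<circ> Um1_op k c))) \<and>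
         (\<forall>U. open U \<longrightarrow> (\<forall>s\<in>sections (N_mod k c \<mu> (l + 1)) U.
           T_map k c \<mu> l U (G_map k c \<mu> l U s) =
             act (N_mod k c \<mu> (l + 1)) (scalar_op ((l + of_nat k * \<mu>) * (l + 1))) s)) \<and>
         (\<forall>U. open U \<longrightarrow> (\<forall>s\<in>sections (N_mod k c \<mu> l) U.
           G_map k c \<mu> l U (T_map k c \<mu> l U s) =
             act (N_mod k c \<mu> l) (scalar_op ((l + of_nat k * \<mu>) * (l + 1))) s)) \<and>
         (l \<noteq> -1 \<and> l \<noteq> - (of_nat k * \<mu>) \<longrightarrow>
           dmodule_iso (N_mod k c \<mu> l) (N_mod k c \<mu> (l + 1)) (T_map k c \<mu> l)) \<and>
         (l \<noteq> -1 \<and> l \<noteq> - (of_nat k * \<mu>) \<longrightarrow>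
           dmodule_iso (N_mod k c \<mu> (l + 1)) (N_mod k c \<mu> l) (G_map k c \<mu> l))"
proof -
  note X = ideal_sheaf_map_U1[OF k c, where l=l and \<mu>=\<mu>]
    and Y = ideal_sheaf_map_Um1[OF k c, where l=l and \<mu>=\<mu>]
  note XY = U1_Um1_in[OF k c, where l=l and \<mu>=\<mu>] and YX = Um1_U1_in[OF k c, where l=l and \<mu>=\<mu>]
  have nz: "(l + of_nat k * \<mu>) * (l + 1) \<noteq> 0" if "l \<noteq> -1 \<and> l \<noteq> - (of_nat k * \<mu>)"
    using that by (auto simp: add_eq_0_iff2)
  show ?thesis
    unfolding G_map_def T_map_def N_mod_def
    by (intro conjI allI impI ballI
        ideal_sheaf_map.right_mult_hom[OF X] ideal_sheaf_map.right_mult_hom[OF Y]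
        ideal_sheaf_map.right_mult_section_class[OF X] ideal_sheaf_map.right_mult_section_class[OF Y]
        right_mult_right_mult[OF X Y XY] right_mult_right_mult[OF Y X YX]
        right_mult_iso[OF X Y XY YX nz] right_mult_iso[OF Y X YX XY nz]) auto
qed

end
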